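(* For any fixed integer $k\geq 2$, we have, as $n\to\infty$, $$\lambda_{k,max}(n)=\sqrt{n/k}+ 1+ O\left(\frac{1}{\sqrt{n}} \right).$$ Moreover, any outerplanar graph $G$ on $n$ vertices with $\lambda_k(G) =\lambda_{k,max}(n)$ contains exactly $k$ vertices of degree $\frac{n}{k} \pm O(1)$.
   Context: For a graph $G$ on $n$ vertices, $\lambda_1(G)\ge\lambda_2(G)\ge\cdots\ge\lambda_n(G)$ denote the eigenvalues of its adjacency matrix in non-increasing order. A graph is outerplanar if it can be drawn in the plane without crossing edges such that each vertex lies on the outer face. $\lambda_{k,max}(n)$ denotes the maximum of $\lambda_k(G)$ among all connected outerplanar graphs $G$ on $n$ vertices. The constants implied by $O(\cdot)$ may depend on $k$ but not on $n$ or $G$, and asymptotic statements are for $n$ large. *)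

theory Defs
  imports
    "HOL-Analysis.Analysis"
    "HOL-Library.Landau_Symbols"
    "Jordan_Normal_Form.Char_Poly"
    "Graph_Theory.Digraph_Component"
begin

text \<open>
  Finite simple graphs are the locale predicate \<^const>\<open>pair_graph\<close>: each edge
  occurs as the two arcs \<open>(u, v)\<close> and \<open>(v, u)\<close>, so the degree of a vertex is its out-degree.
  The graphs on \<open>n\<close> vertices are taken with vertex set \<open>{0..<n}\<close>, which covers all of them up to
  isomorphism.
\<close>

definition graph_on :: "nat \<Rightarrow> nat pair_pre_digraph \<Rightarrow> bool" where
  "graph_on n G \<longleftrightarrow> pair_graph G \<and> pverts G = {0..<n}"

definition adj_matrix :: "nat \<Rightarrow> nat pair_pre_digraph \<Rightarrow> real mat" where
  "adj_matrix n G = mat n n (\<lambda>(i, j). if (i, j) \<in> parcs G then 1 else 0)"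

text \<open>
  An adjacency matrix is real symmetric, so all roots of its characteristic polynomial are real;
  \<^const>\<open>proots\<close> counts them with multiplicity. Meaningful for \<open>1 \<le> k \<le> n\<close>.
\<close>

definition lambda :: "nat \<Rightarrow> nat \<Rightarrow> nat pair_pre_digraph \<Rightarrow> real" where
  "lambda k n G = rev (sorted_list_of_multiset (proots (char_poly (adj_matrix n G)))) ! (k - 1)"

text \<open>
  A drawing without crossings: vertices are distinct points, edges are simple arcs joining their
  ends and containing no other vertex, and two edges meet at most in common ends. The two
  arcs \<open>(u, v)\<close> and \<open>(v, u)\<close> of an edge are drawn as the same curve.
\<close>

definition plane_drawing ::
    "'a pair_pre_digraph \<Rightarrow> ('a \<Rightarrow> complex) \<Rightarrow> ('a \<times> 'a \<Rightarrow> real \<Rightarrow> complex) \<Rightarrow> bool" where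
  "plane_drawing G p \<gamma> \<longleftrightarrow>
     inj_on p (pverts G) \<and>
     (\<forall>(u, v) \<in> parcs G.
        Path_Connected.arc (\<gamma> (u, v)) \<and> pathstart (\<gamma> (u, v)) = p u \<and> pathfinish (\<gamma> (u, v)) = p v \<and>
        path_image (\<gamma> (v, u)) = path_image (\<gamma> (u, v)) \<and>
        path_image (\<gamma> (u, v)) \<inter> p ` pverts G = {p u, p v}) \<and>
     (\<forall>(u, v) \<in> parcs G. \<forall>(x, y) \<in> parcs G. {u, v} \<noteq> {x, y} \<longrightarrow>
        path_image (\<gamma> (u, v)) \<inter> path_image (\<gamma> (x, y)) \<subseteq> p ` ({u, v} \<inter> {x, y}))"

definition drawing_image ::
    "'a pair_pre_digraph \<Rightarrow> ('a \<Rightarrow> complex) \<Rightarrow> ('a \<times> 'a \<Rightarrow> real \<Rightarrow> complex) \<Rightarrow> complex set" where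
  "drawing_image G p \<gamma> = p ` pverts G \<union> (\<Union>e \<in> parcs G. path_image (\<gamma> e))"

text \<open>
  As a drawing is compact, \<^const>\<open>outside\<close> of it is its unbounded face; a vertex lies
  on that face if it belongs to its boundary.
\<close>

definition outerplanar :: "'a pair_pre_digraph \<Rightarrow> bool" where
  "outerplanar G \<longleftrightarrow> (\<exists>p \<gamma>. plane_drawing G p \<gamma> \<and>
     (\<forall>v \<in> pverts G. p v \<in> frontier (outside (drawing_image G p \<gamma>))))"

definition lambda_max :: "nat \<Rightarrow> nat \<Rightarrow> real" where
  "lambda_max k n =
     Max (lambda k n ` {G. graph_on n G \<and> Digraph_Component.connected (with_proj G) \<and> outerplanar G})"

end

theory Submission
  imports Defs
begin

text \<open>
  Write \<open>N = n / k\<close>. In an outerplanar graph two vertices have at most two common neighbours, and the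
  edges can be oriented with bounded out-degree. So only boundedly many vertices have degree
  above \<open>\<epsilon> n\<close>, and their neighbourhoods are almost disjoint: spectrally the graph is a
  union of stars, perturbed by edges that run between non-hubs. A single hub of degree \<open>d\<close> has
  largest eigenvalue about \<open>\<surd>d + 1\<close>: the star gives \<open>\<surd>d\<close>, and the neighbours of the hub span
  a graph of maximum degree 2, which adds at most \<open>2 / 2 = 1\<close>, as half of the squared norm of the
  leading eigenvector of a star lies on the leaves. Fans show that this is sharp.

  \<^bold>\<open>Upper bound.\<close> Let \<open>K\<close> consist of the \<open>k\<close> vertices of largest degree and let \<open>h\<close> have the
  smallest degree in \<open>K\<close>. By the min-max principle \<open>\<lambda>\<^sub>k\<close> is at most the maximum of the quadratic form
  on unit vectors that vanish on \<open>K - {h}\<close>. As neighbourhoods are almost disjoint,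
  \<open>deg h \<le> N + O(1)\<close>. If \<open>deg h\<close> is smaller than \<open>N\<close> by a large multiple of \<open>\<surd>n\<close>, a crude
  estimate \<open>\<surd>(deg h) + O(1)\<close>, valid for any number of hubs, already stays below \<open>\<surd>N\<close>
  (\<open>form_bound_of_max_degree\<close>). Otherwise \<open>K\<close> uses up all but \<open>O(\<surd>n)\<close> of the vertices, so after
  the deletion \<open>h\<close> is the only hub, and the sharp estimate \<open>\<surd>(deg h) + 1 + O(1/\<surd>n)\<close> applies
  (\<open>form_bound_of_single_hub\<close>). Both estimates distribute each product \<open>2 x\<^sub>u x\<^sub>v\<close> between \<open>x\<^sub>u\<^sup>2\<close> and
  \<open>x\<^sub>v\<^sup>2\<close> with weights \<open>t\<close> and \<open>1/t\<close> chosen edge by edge.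

  \<^bold>\<open>Lower bound.\<close> Take \<open>k\<close> disjoint fans on about \<open>N\<close> vertices each, and one more vertex that is
  joined to all their hubs and to the few vertices left over. Vectors supported on the fans vanish
  on the extra vertex, so the fans contribute \<open>k\<close> eigenvalues of size \<open>\<surd>N + 1 - O(1/\<surd>n)\<close>.

  \<^bold>\<open>Structure.\<close> If \<open>\<lambda>\<^sub>k\<close> is maximal, the lower bound excludes the first case above, and the
  second one forces \<open>deg h \<ge> N - O(1)\<close>. The sum of the degrees in \<open>K\<close> is at most \<open>n + O(1)\<close>, so
  all of them are \<open>N \<plusminus> O(1)\<close>, while all other degrees are \<open>O(\<surd>n)\<close>.

  \<^bold>\<open>Topology.\<close> The only facts about outerplanar graphs that enter are consequences of one: three arcs
  with common ends, drawn without further intersections, cannot all have an inner point on the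
  boundary of the unbounded face, because one of them runs inside the closed curve formed by the other
  two. This excludes \<open>K\<^sub>2\<^sub>,\<^sub>3\<close>, even with one of its two vertices of degree 3 replaced by a
  connected set; breadth-first layers then give the orientation.
\<close>

section \<open>Theta curves and the outer face\<close>

definition theta :: "(real \<Rightarrow> complex) \<Rightarrow> (real \<Rightarrow> complex) \<Rightarrow> (real \<Rightarrow> complex) \<Rightarrow> complex \<Rightarrow> complex \<Rightarrow> bool" where
  "theta c1 c2 c3 a b \<longleftrightarrow>
     (\<forall>c \<in> {c1, c2, c3}. Path_Connected.arc c \<and> pathstart c = a \<and> pathfinish c = b) \<and>
     path_image c1 \<inter> path_image c2 = {a, b} \<and>
     path_image c1 \<inter> path_image c3 = {a, b} \<and>
     path_image c2 \<inter> path_image c3 = {a, b}"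

lemma theta_closed_curve:
  assumes "Path_Connected.arc c1" "pathstart c1 = a" "pathfinish c1 = b"
    and "Path_Connected.arc c2" "pathstart c2 = a" "pathfinish c2 = b"
    and "path_image c1 \<inter> path_image c2 = {a, b}"
  obtains g where "simple_path g" "pathfinish g = pathstart g"
    "path_image g = path_image c1 \<union> path_image c2"
proof
  let ?g = "c1 +++ reversepath c2"
  show "simple_path ?g"
    using assms by (intro simple_path_join_loop) (auto simp: arc_reversepath)
  show "pathfinish ?g = pathstart ?g"
    using assms by auto
  show "path_image ?g = path_image c1 \<union> path_image c2"
    using assms by (subst path_image_join) auto
qed

text \<open>
  Suppose each arc avoids the inside of the other two. A point \<open>z\<close> inside \<open>c1 \<union> c2\<close> is then
  outside \<open>c1 \<union> c3\<close> and outside \<open>c2 \<union> c3\<close>; these two curves meet in the connected set \<open>c3\<close>, so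
  by Janiszewski's theorem \<open>z\<close> can escape to infinity from their union, hence from \<open>c1 \<union> c2\<close>.
\<close>

lemma theta_inside:
  assumes "theta c1 c2 c3 a b"
  shows "path_image c3 \<inter> inside (path_image c1 \<union> path_image c2) \<noteq> {} \<or>
         path_image c1 \<inter> inside (path_image c2 \<union> path_image c3) \<noteq> {} \<or>
         path_image c2 \<inter> inside (path_image c1 \<union> path_image c3) \<noteq> {}"
proof (rule ccontr)
  let ?A = "path_image c1" and ?B = "path_image c2" and ?C = "path_image c3"
  let ?\<Theta> = "?A \<union> ?B \<union> ?C"
  assume neg: "\<not> ?thesis"
  have arcs: "Path_Connected.arc c1" "Path_Connected.arc c2" "Path_Connected.arc c3"
    and ends: "pathstart c1 = a" "pathfinish c1 = b" "pathstart c2 = a" "pathfinish c2 = b"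
      "pathstart c3 = a" "pathfinish c3 = b"
    and meet: "?A \<inter> ?B = {a, b}" "?A \<inter> ?C = {a, b}" "?B \<inter> ?C = {a, b}"
    using assms by (auto simp: theta_def)
  from neg have disj: "?C \<inter> inside (?A \<union> ?B) = {}" "?A \<inter> inside (?B \<union> ?C) = {}"
    "?B \<inter> inside (?A \<union> ?C) = {}"
    by simp_all
  have comp: "compact ?A" "compact ?B" "compact ?C"
    using arcs by (auto simp: compact_arc_image)
  obtain g12 where g12: "simple_path g12" "pathfinish g12 = pathstart g12"
      "path_image g12 = ?A \<union> ?B"
    using theta_closed_curve arcs ends meet by metis
  note J12 = Jordan_inside_outside[OF g12(1,2), unfolded g12(3)]
  have conI: "Topological_Spaces.connected (inside (?A \<union> ?B))" and neI: "inside (?A \<union> ?B) \<noteq> {}"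
    and frI: "frontier (inside (?A \<union> ?B)) = ?A \<union> ?B" using J12 by auto
  then obtain z where z: "z \<in> inside (?A \<union> ?B)" by auto
  have zC: "z \<notin> ?A \<union> ?B \<union> ?C"
    using z disj inside_no_overlap by blast
  have out: "z \<in> outside (D \<union> ?C)"
    if D: "D = ?A \<and> E = ?B \<or> D = ?B \<and> E = ?A"
      and Edisj: "E \<inter> inside (D \<union> ?C) = {}" for D E
  proof (rule ccontr)
    assume "z \<notin> outside (D \<union> ?C)"
    moreover have "z \<notin> D \<union> ?C" using zC D by auto
    ultimately have zin: "z \<in> inside (D \<union> ?C)"
      by (metis ComplI UnE inside_Un_outside)
    have "inside (?A \<union> ?B) \<inter> (D \<union> ?C) = {}"
      using disj(1) D inside_no_overlap[of "?A \<union> ?B"] by blast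
    then have "inside (?A \<union> ?B) \<subseteq> connected_component_set (- (D \<union> ?C)) z"
      using conI z by (intro connected_component_maximal) auto
    then have sub: "inside (?A \<union> ?B) \<subseteq> inside (D \<union> ?C)"
      using zin inside_same_component by fastforce
    have "closed (D \<union> ?C)" using D comp by (auto simp: compact_imp_closed)
    then have clo: "closure (inside (D \<union> ?C)) \<subseteq> inside (D \<union> ?C) \<union> (D \<union> ?C)"
      using closure_inside_subset[of "D \<union> ?C"] by auto
    have "E \<subseteq> closure (inside (?A \<union> ?B))"
      using frI D by (auto simp: frontier_def)
    then have "E \<subseteq> inside (D \<union> ?C) \<union> (D \<union> ?C)"
      using closure_mono[OF sub] clo by blast
    then have "E \<subseteq> {a, b}" using Edisj D meet by blast
    then have "finite E" by (meson finite.emptyI finite_insert finite_subset)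
    moreover have "Topological_Spaces.connected E" "a \<in> E" "b \<in> E"
      using D arcs meet connected_arc_image by auto
    ultimately have "a = b" by (metis connected_finite_iff_sing empty_iff singletonD)
    then show False using arc_distinct_ends[OF arcs(1)] ends by simp
  qed
  have zo1: "z \<in> outside (?A \<union> ?C)" using out[of ?A ?B] disj by blast
  have zo2: "z \<in> outside (?B \<union> ?C)" using out[of ?B ?A] disj by blast
  have bdd: "bounded ?\<Theta>" using comp by (simp add: compact_imp_bounded)
  obtain x where x: "x \<in> outside ?\<Theta>"
    using outside_bounded_nonempty[OF bdd] by auto
  have xo: "x \<in> outside (?A \<union> ?C)" "x \<in> outside (?B \<union> ?C)"
    using x outside_mono[of "?A \<union> ?C" ?\<Theta>] outside_mono[of "?B \<union> ?C" ?\<Theta>] by auto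
  have cc: "connected_component (- (D \<union> ?C)) x z"
    if "compact D" "x \<in> outside (D \<union> ?C)" "z \<in> outside (D \<union> ?C)" for D
  proof -
    have "Topological_Spaces.connected (outside (D \<union> ?C))"
      using that comp by (intro connected_outside compact_imp_bounded compact_Un) auto
    then show ?thesis
      using that outside_no_overlap by (metis connected_component_def disjoint_eq_subset_Compl
          inf_commute)
  qed
  have "connected_component (- ((?A \<union> ?C) \<union> (?B \<union> ?C))) x z"
  proof (rule Janiszewski)
    have "(?A \<union> ?C) \<inter> (?B \<union> ?C) = ?C" using meet ends by auto
    then show "Topological_Spaces.connected ((?A \<union> ?C) \<inter> (?B \<union> ?C))"
      using arcs by (simp add: connected_arc_image)
  qed (use comp cc xo zo1 zo2 in \<open>auto simp: compact_imp_closed\<close>)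
  then have "connected_component (- ?\<Theta>) x z" by (simp add: Un_ac)
  then have "z \<in> outside ?\<Theta>" using x outside_same_component by blast
  then have "z \<in> outside (?A \<union> ?B)" using outside_mono[of "?A \<union> ?B" ?\<Theta>] by auto
  then show False using z inside_Int_outside by blast
qed

text \<open>
  An inner point of an arc that runs inside the other two has a neighbourhood disjoint from the
  unbounded face of any larger drawing \<open>U\<close>.
\<close>

lemma theta_not_all_on_outer_face:
  assumes th: "theta c1 c2 c3 a b"
    and sub: "path_image c1 \<union> path_image c2 \<union> path_image c3 \<subseteq> U"
    and x1: "x1 \<in> path_image c1 - {a, b}" "x1 \<in> closure (outside U)"
    and x2: "x2 \<in> path_image c2 - {a, b}" "x2 \<in> closure (outside U)"
    and x3: "x3 \<in> path_image c3 - {a, b}" "x3 \<in> closure (outside U)"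
  shows False
proof -
  have arcs: "Path_Connected.arc c1" "Path_Connected.arc c2" "Path_Connected.arc c3"
    and ends: "pathstart c1 = a" "pathfinish c1 = b" "pathstart c2 = a" "pathfinish c2 = b"
      "pathstart c3 = a" "pathfinish c3 = b"
    and meet: "path_image c1 \<inter> path_image c2 = {a, b}" "path_image c1 \<inter> path_image c3 = {a, b}"
      "path_image c2 \<inter> path_image c3 = {a, b}"
    using th by (auto simp: theta_def)
  have key: "path_image c \<inter> inside D = {}"
    if c: "Path_Connected.arc c" "pathstart c = a" "pathfinish c = b"
      and D: "compact D" "path_image c \<inter> D = {a, b}" "D \<subseteq> U"
      and x: "x \<in> path_image c - {a, b}" "x \<in> closure (outside U)" for c D x
  proof -
    have "open (inside D)" using D by (simp add: compact_imp_closed open_inside)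
    moreover have "outside U \<inter> inside D = {}"
      using outside_mono[OF D(3)] inside_Int_outside by blast
    ultimately have "closure (outside U) \<inter> inside D = {}"
      by (metis inf_commute open_Int_closure_eq_empty)
    then have "x \<in> outside D" using x D inside_Un_outside[of D] by blast
    moreover have "Topological_Spaces.connected (path_image c - {a, b})"
      using c connected_simple_path_endless[of c] arc_imp_simple_path by auto
    then have "path_image c - {a, b} \<subseteq> connected_component_set (- D) x"
      using D x by (intro connected_component_maximal) auto
    ultimately have "path_image c - {a, b} \<subseteq> outside D"
      using outside_same_component by fastforce
    moreover have "a \<in> D" "b \<in> D" using D by auto
    ultimately show ?thesis
      using inside_no_overlap[of D] inside_Int_outside[of D] by blast
  qed
  have comp: "compact (path_image c1)" "compact (path_image c2)" "compact (path_image c3)"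
    using arcs by (auto simp: compact_arc_image)
  have "path_image c3 \<inter> inside (path_image c1 \<union> path_image c2) = {}"
    using meet sub comp arcs ends x3 by (intro key[of c3 _ x3]) auto
  moreover have "path_image c1 \<inter> inside (path_image c2 \<union> path_image c3) = {}"
    using meet sub comp arcs ends x1 by (intro key[of c1 _ x1]) auto
  moreover have "path_image c2 \<inter> inside (path_image c1 \<union> path_image c3) = {}"
    using meet sub comp arcs ends x2 by (intro key[of c2 _ x2]) auto
  ultimately show False using theta_inside[OF th] by blast
qed

section \<open>Outerplanar graphs have no fat \<open>K\<^sub>2\<^sub>,\<^sub>3\<close>\<close>

fun path_edges :: "'a list \<Rightarrow> ('a \<times> 'a) set" where
  "path_edges (u # v # vs) = insert (u, v) (path_edges (v # vs))"
| "path_edges _ = {}"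

lemma path_edges_verts: "(x, y) \<in> path_edges xs \<Longrightarrow> x \<in> set xs \<and> y \<in> set xs"
  by (induction xs rule: path_edges.induct) auto

lemma path_edges_mid:
  "(x, y) \<in> path_edges (a # ms @ [b]) \<Longrightarrow> ms \<noteq> [] \<Longrightarrow> x \<in> set ms \<or> y \<in> set ms"
proof (induction ms arbitrary: a)
  case (Cons m ms)
  then show ?case by (cases ms) auto
qed simp

lemma path_edges_cover:
  "x \<in> set xs \<Longrightarrow> 2 \<le> length xs \<Longrightarrow> \<exists>e \<in> path_edges xs. x = fst e \<or> x = snd e"
proof (induction xs rule: path_edges.induct)
  case (1 u v vs)
  then show ?case by (cases vs) auto
qed auto

lemma successively_path_edges: "successively (\<lambda>u v. (u, v) \<in> E) xs \<longleftrightarrow> path_edges xs \<subseteq> E"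
  by (induction xs rule: path_edges.induct) auto

lemma plane_drawing_edge:
  assumes d: "plane_drawing G p \<gamma>" and e: "(u, v) \<in> parcs G"
  shows "Path_Connected.arc (\<gamma> (u, v))" "pathstart (\<gamma> (u, v)) = p u" "pathfinish (\<gamma> (u, v)) = p v"
  using bspec[OF d[unfolded plane_drawing_def, THEN conjunct2, THEN conjunct1] e] by simp_all

lemma plane_drawing_meet:
  assumes d: "plane_drawing G p \<gamma>" and e: "(u, v) \<in> parcs G" "(x, y) \<in> parcs G" "{u, v} \<noteq> {x, y}"
  shows "path_image (\<gamma> (u, v)) \<inter> path_image (\<gamma> (x, y)) \<subseteq> p ` ({u, v} \<inter> {x, y})"
proof -
  have "\<forall>e \<in> parcs G. case e of (u, v) \<Rightarrow> \<forall>f \<in> parcs G. case f of (x, y) \<Rightarrow> {u, v} \<noteq> {x, y} \<longrightarrow>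
        path_image (\<gamma> (u, v)) \<inter> path_image (\<gamma> (x, y)) \<subseteq> p ` ({u, v} \<inter> {x, y})"
    using d unfolding plane_drawing_def by (elim conjE)
  from bspec[OF this e(1), simplified, THEN bspec, OF e(2), simplified] e(3)
  show ?thesis by simp
qed

text \<open>
  Edges meet only in common ends, so the curves of the edges along a path concatenate to an arc.
\<close>

lemma plane_drawing_path_arc:
  assumes "plane_drawing G p \<gamma>" "2 \<le> length xs" "distinct xs" "path_edges xs \<subseteq> parcs G"
  shows "\<exists>c. Path_Connected.arc c \<and> pathstart c = p (hd xs) \<and> pathfinish c = p (last xs) \<and>
     path_image c = (\<Union>e \<in> path_edges xs. path_image (\<gamma> e))"
  using assms(2-)
proof (induction xs rule: path_edges.induct)
  case (1 u v vs)
  have edge: "(u, v) \<in> parcs G" using 1(4) by simp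
  then have uv: "Path_Connected.arc (\<gamma> (u, v))" "pathstart (\<gamma> (u, v)) = p u" "pathfinish (\<gamma> (u, v)) = p v"
    using plane_drawing_edge[OF assms(1) edge] by auto
  show ?case
  proof (cases vs)
    case Nil
    then show ?thesis using uv by auto
  next
    case (Cons w ws)
    with 1 obtain c where c: "Path_Connected.arc c" "pathstart c = p v" "pathfinish c = p (last (v # vs))"
      "path_image c = (\<Union>e \<in> path_edges (v # vs). path_image (\<gamma> e))"
      by auto
    have "path_image (\<gamma> (u, v)) \<inter> path_image (\<gamma> (x, y)) \<subseteq> {p v}"
      if xy: "(x, y) \<in> path_edges (v # vs)" for x y
    proof -
      have "u \<notin> {x, y}" using xy 1(3) path_edges_verts[OF xy] by auto
      then have ne: "{u, v} \<noteq> {x, y}" and sub: "p ` ({u, v} \<inter> {x, y}) \<subseteq> {p v}" by auto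
      have "(x, y) \<in> parcs G" using xy 1(4) by auto
      from plane_drawing_meet[OF assms(1) edge this ne] sub show ?thesis by (rule order_trans)
    qed
    then have meet: "path_image (\<gamma> (u, v)) \<inter> path_image c \<subseteq> {pathstart c}"
      unfolding c by fastforce
    have "Path_Connected.arc (\<gamma> (u, v) +++ c)"
      using uv c meet by (intro arc_join) auto
    moreover have "path_image (\<gamma> (u, v) +++ c) = (\<Union>e \<in> path_edges (u # v # vs). path_image (\<gamma> e))"
      using uv c by (subst path_image_join) auto
    ultimately show ?thesis using uv c by (intro exI[of _ "\<gamma> (u, v) +++ c"]) auto
  qed
qed auto

text \<open>
  The combinatorial form of the preceding fact. The lists hold the inner vertices of three
  internally disjoint paths from \<open>a\<close> to \<open>b\<close>, and each has one: an edge \<open>a\<close>--\<open>b\<close> would have no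
  inner point that must lie on the outer face.
\<close>

lemma outerplanar_no_theta:
  assumes op: "outerplanar G" and wf: "parcs G \<subseteq> pverts G \<times> pverts G"
    and paths: "\<And>ms. ms \<in> {ms1, ms2, ms3} \<Longrightarrow>
        ms \<noteq> [] \<and> distinct (a # ms @ [b]) \<and> path_edges (a # ms @ [b]) \<subseteq> parcs G"
    and disj: "set ms1 \<inter> set ms2 = {}" "set ms1 \<inter> set ms3 = {}" "set ms2 \<inter> set ms3 = {}"
  shows False
proof -
  obtain p \<gamma> where d: "plane_drawing G p \<gamma>"
    and outer: "\<And>v. v \<in> pverts G \<Longrightarrow> p v \<in> frontier (outside (drawing_image G p \<gamma>))"
    using op unfolding outerplanar_def by blast
  let ?I = "\<lambda>ms. \<Union>e \<in> path_edges (a # ms @ [b]). path_image (\<gamma> e)"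
  have "\<exists>c. Path_Connected.arc c \<and> pathstart c = p a \<and> pathfinish c = p b \<and> path_image c = ?I ms"
    if "ms \<in> {ms1, ms2, ms3}" for ms
    using plane_drawing_path_arc[OF d, of "a # ms @ [b]"] paths[OF that] by auto
  then have "\<forall>ms \<in> {ms1, ms2, ms3}. \<exists>c. Path_Connected.arc c \<and> pathstart c = p a \<and>
      pathfinish c = p b \<and> path_image c = ?I ms"
    by blast
  from bchoice[OF this] obtain c where "\<forall>ms \<in> {ms1, ms2, ms3}. Path_Connected.arc (c ms) \<and>
      pathstart (c ms) = p a \<and> pathfinish (c ms) = p b \<and> path_image (c ms) = ?I ms" ..
  then have c: "Path_Connected.arc (c ms) \<and> pathstart (c ms) = p a \<and> pathfinish (c ms) = p b \<and>
      path_image (c ms) = ?I ms" if "ms \<in> {ms1, ms2, ms3}" for ms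
    using that by blast
  have inV: "set (a # ms @ [b]) \<subseteq> pverts G" if "ms \<in> {ms1, ms2, ms3}" for ms
  proof
    fix x assume "x \<in> set (a # ms @ [b])"
    then obtain e where "e \<in> path_edges (a # ms @ [b])" "x = fst e \<or> x = snd e"
      using path_edges_cover[of x "a # ms @ [b]"] by auto
    then show "x \<in> pverts G" using wf paths[OF that] by (cases e) auto
  qed
  have ends: "p a \<in> path_image (c ms)" "p b \<in> path_image (c ms)" if "ms \<in> {ms1, ms2, ms3}" for ms
    using c[OF that] pathstart_in_path_image[of "c ms"] pathfinish_in_path_image[of "c ms"] by simp_all
  have inter: "path_image (c ms) \<inter> path_image (c ns) = {p a, p b}"
    if ms: "ms \<in> {ms1, ms2, ms3}" and ns: "ns \<in> {ms1, ms2, ms3}" and dj: "set ms \<inter> set ns = {}" for ms ns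
  proof
    show "path_image (c ms) \<inter> path_image (c ns) \<subseteq> {p a, p b}"
    proof
      fix z assume "z \<in> path_image (c ms) \<inter> path_image (c ns)"
      then obtain u v x y where e: "(u, v) \<in> path_edges (a # ms @ [b])" "z \<in> path_image (\<gamma> (u, v))"
        "(x, y) \<in> path_edges (a # ns @ [b])" "z \<in> path_image (\<gamma> (x, y))"
        using c[OF ms] c[OF ns] by auto
      have sub: "{u, v} \<subseteq> insert a (insert b (set ms))" "{x, y} \<subseteq> insert a (insert b (set ns))"
        using path_edges_verts[OF e(1)] path_edges_verts[OF e(3)] by auto
      have "u \<in> set ms \<or> v \<in> set ms" using path_edges_mid[OF e(1)] paths[OF ms] by blast
      moreover have "set ms \<inter> insert a (insert b (set ns)) = {}" using dj paths[OF ms] by auto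
      then have "x \<notin> set ms" "y \<notin> set ms" using sub(2) by auto
      ultimately have ne: "{u, v} \<noteq> {x, y}" by (auto simp: doubleton_eq_iff)
      have "(u, v) \<in> parcs G" "(x, y) \<in> parcs G" using e paths[OF ms] paths[OF ns] by auto
      from plane_drawing_meet[OF d this ne] have "z \<in> p ` ({u, v} \<inter> {x, y})" using e by auto
      moreover have "{u, v} \<inter> {x, y} \<subseteq> {a, b}" using sub dj by blast
      ultimately show "z \<in> {p a, p b}" by blast
    qed
  qed (use ends ms ns in auto)
  have th: "theta (c ms1) (c ms2) (c ms3) (p a) (p b)"
    using c[of ms1] c[of ms2] c[of ms3] inter[of ms1 ms2] inter[of ms1 ms3] inter[of ms2 ms3] disj
    unfolding theta_def by simp
  have point: "\<exists>x. x \<in> path_image (c ms) - {p a, p b} \<and> x \<in> closure (outside (drawing_image G p \<gamma>))"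
    if ms: "ms \<in> {ms1, ms2, ms3}" for ms
  proof -
    obtain m where m: "m \<in> set ms" using paths[OF ms] by (cases ms) auto
    obtain x y where e: "(x, y) \<in> path_edges (a # ms @ [b])" "m = x \<or> m = y"
      using path_edges_cover[of m "a # ms @ [b]"] m by auto
    then have "(x, y) \<in> parcs G" using paths[OF ms] by auto
    then have "pathstart (\<gamma> (x, y)) = p x" "pathfinish (\<gamma> (x, y)) = p y"
      using plane_drawing_edge[OF d] by auto
    then have "p m \<in> path_image (\<gamma> (x, y))"
      using e(2) pathstart_in_path_image[of "\<gamma> (x, y)"] pathfinish_in_path_image[of "\<gamma> (x, y)"] by auto
    then have "p m \<in> path_image (c ms)" using c[OF ms] e(1) by auto
    moreover have "p m \<noteq> p a" "p m \<noteq> p b"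
      using d m inV[OF ms] paths[OF ms] unfolding plane_drawing_def inj_on_def by auto
    moreover have "p m \<in> closure (outside (drawing_image G p \<gamma>))"
      using outer[of m] m inV[OF ms] by (auto simp: frontier_def)
    ultimately show ?thesis by auto
  qed
  have sub: "path_image (c ms) \<subseteq> drawing_image G p \<gamma>" if "ms \<in> {ms1, ms2, ms3}" for ms
    using c[OF that] paths[OF that] by (auto simp: drawing_image_def)
  obtain x1 where x1: "x1 \<in> path_image (c ms1) - {p a, p b}" "x1 \<in> closure (outside (drawing_image G p \<gamma>))"
    using point[of ms1] by blast
  obtain x2 where x2: "x2 \<in> path_image (c ms2) - {p a, p b}" "x2 \<in> closure (outside (drawing_image G p \<gamma>))"
    using point[of ms2] by blast
  obtain x3 where x3: "x3 \<in> path_image (c ms3) - {p a, p b}" "x3 \<in> closure (outside (drawing_image G p \<gamma>))"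
    using point[of ms3] by blast
  have "path_image (c ms1) \<union> path_image (c ms2) \<union> path_image (c ms3) \<subseteq> drawing_image G p \<gamma>"
    using sub[of ms1] sub[of ms2] sub[of ms3] by simp
  from theta_not_all_on_outer_face[OF th this x1 x2 x3] show False .
qed

lemma rtrancl_distinct_path:
  "(u, v) \<in> R\<^sup>* \<Longrightarrow> \<exists>xs. xs \<noteq> [] \<and> hd xs = u \<and> last xs = v \<and> distinct xs \<and> path_edges xs \<subseteq> R"
proof (induction rule: converse_rtrancl_induct)
  case base
  show ?case by (rule exI[of _ "[v]"]) simp
next
  case (step u w)
  then obtain xs where xs: "xs \<noteq> []" "hd xs = w" "last xs = v" "distinct xs" "path_edges xs \<subseteq> R"
    by blast
  show ?case
  proof (cases "u \<in> set xs")
    case True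
    then obtain ys zs where "xs = ys @ u # zs" by (meson split_list)
    then show ?thesis using xs
      by (intro exI[of _ "u # zs"])
        (auto simp: successively_path_edges[symmetric] successively_append_iff)
  next
    case False
    then show ?thesis using xs step(1)
      by (intro exI[of _ "u # xs"]) (cases xs, auto)
  qed
qed

definition connected_in :: "('a \<times> 'a) set \<Rightarrow> 'a set \<Rightarrow> bool" where
  "connected_in E K \<longleftrightarrow> (\<forall>u \<in> K. \<forall>v \<in> K. (u, v) \<in> (E \<inter> K \<times> K)\<^sup>*)"

text \<open>
  No \<open>K\<^sub>2\<^sub>,\<^sub>3\<close> in which one of the two vertices of degree 3 is blown up to a connected set \<open>K\<close>; the
  other is \<open>p\<close>, and \<open>Q\<close> collects the vertices that are adjacent to both. For a singleton \<open>K\<close> this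
  bounds the number of common neighbours of two vertices.
\<close>

definition fat_K23_free :: "('a \<times> 'a) set \<Rightarrow> bool" where
  "fat_K23_free E \<longleftrightarrow> (\<forall>p K Q. connected_in E K \<and> p \<notin> K \<and> Q \<inter> K = {} \<and>
     (\<forall>q \<in> Q. (p, q) \<in> E \<and> (\<exists>x \<in> K. (q, x) \<in> E)) \<longrightarrow> finite Q \<and> card Q \<le> 2)"

text \<open>
  Inside \<open>K\<close> the three entry points are joined by a path \<open>rs\<close> between the first two and a path
  \<open>ws\<close> from the third one, stopped at its first vertex \<open>t\<close> on \<open>rs\<close>. So \<open>t\<close> and \<open>p\<close> are the
  branch vertices of a subdivision of \<open>K\<^sub>2\<^sub>,\<^sub>3\<close>.
\<close>

lemma outerplanar_fat_K23_free:
  fixes G :: "'a pair_pre_digraph"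
  assumes op: "outerplanar G" and wf: "parcs G \<subseteq> pverts G \<times> pverts G"
    and sym: "sym (parcs G)" and irr: "irrefl (parcs G)"
  shows "fat_K23_free (parcs G)"
  unfolding fat_K23_free_def
proof (intro allI impI)
  fix p K Q
  let ?E = "parcs G"
  assume as: "connected_in ?E K \<and> p \<notin> K \<and> Q \<inter> K = {} \<and>
     (\<forall>q \<in> Q. (p, q) \<in> ?E \<and> (\<exists>x \<in> K. (q, x) \<in> ?E))"
  show "finite Q \<and> card Q \<le> 2"
  proof (rule ccontr)
    assume "\<not> (finite Q \<and> card Q \<le> 2)"
    then have "infinite Q \<or> 3 \<le> card Q" by auto
    then obtain T where "T \<subseteq> Q" "card T = 3"
      by (metis infinite_arbitrarily_large obtain_subset_with_card_n)
    then obtain q1 q2 q3 where q: "q1 \<in> Q" "q2 \<in> Q" "q3 \<in> Q" "q1 \<noteq> q2" "q1 \<noteq> q3" "q2 \<noteq> q3"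
      by (auto simp: card_3_iff)
    obtain x1 x2 x3 where x: "x1 \<in> K" "(q1, x1) \<in> ?E" "x2 \<in> K" "(q2, x2) \<in> ?E" "x3 \<in> K" "(q3, x3) \<in> ?E"
      using as q by metis
    have path: "\<exists>xs. xs \<noteq> [] \<and> hd xs = u \<and> last xs = v \<and> distinct xs \<and> path_edges xs \<subseteq> ?E \<and> set xs \<subseteq> K"
      if "u \<in> K" "v \<in> K" for u v
    proof -
      have "(u, v) \<in> (?E \<inter> K \<times> K)\<^sup>*" using as that by (auto simp: connected_in_def)
      then obtain xs where xs: "xs \<noteq> []" "hd xs = u" "last xs = v" "distinct xs"
          "path_edges xs \<subseteq> ?E \<inter> K \<times> K"
        using rtrancl_distinct_path by metis
      have "set xs \<subseteq> K"
      proof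
        fix y assume y: "y \<in> set xs"
        show "y \<in> K"
        proof (cases "2 \<le> length xs")
          case True
          then show ?thesis using path_edges_cover[OF y] xs(5) by auto
        next
          case False
          then obtain w where "xs = [w]" using xs(1) by (cases xs; cases "tl xs") auto
          then show ?thesis using xs y that by auto
        qed
      qed
      then show ?thesis using xs by blast
    qed
    obtain rs where rs: "rs \<noteq> []" "hd rs = x1" "last rs = x2" "distinct rs" "path_edges rs \<subseteq> ?E" "set rs \<subseteq> K"
      using path[OF x(1,3)] by auto
    obtain ws where ws: "ws \<noteq> []" "hd ws = x3" "last ws = x1" "distinct ws" "path_edges ws \<subseteq> ?E" "set ws \<subseteq> K"
      using path[OF x(5,1)] by auto
    have "\<exists>y \<in> set ws. y \<in> set rs" using ws rs by (metis hd_in_set last_in_set)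
    then obtain ys t zs where split: "ws = ys @ t # zs" "t \<in> set rs" "\<forall>y \<in> set ys. y \<notin> set rs"
      using split_list_first_prop[of ws "\<lambda>y. y \<in> set rs"] by blast
    obtain cs ds where rsplit: "rs = cs @ t # ds" using split(2) by (meson split_list)
    note sp = successively_path_edges[symmetric]
    have symE: "(v, u) \<in> ?E \<longleftrightarrow> (u, v) \<in> ?E" for u v using sym by (meson symD)
    have tK: "t \<in> K" using split rs by auto
    have out: "p \<notin> K" "q1 \<notin> K" "q2 \<notin> K" "q3 \<notin> K" using as q by auto
    have pq: "(p, q1) \<in> ?E" "(p, q2) \<in> ?E" "(p, q3) \<in> ?E" using as q by auto
    then have pne: "p \<noteq> q1" "p \<noteq> q2" "p \<noteq> q3" using irr by (auto simp: irrefl_def)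
    have s1: "successively (\<lambda>u v. (u, v) \<in> ?E) (cs @ [t])"
      using rs(5) unfolding sp rsplit by (auto simp: successively_append_iff)
    have s2: "successively (\<lambda>u v. (u, v) \<in> ?E) (rev ds @ [t])"
    proof -
      have "successively (\<lambda>u v. (u, v) \<in> ?E) (t # ds)"
        using rs(5) unfolding sp rsplit by (auto simp: successively_append_iff)
      then have "successively (\<lambda>u v. (u, v) \<in> ?E) (rev (t # ds))"
        unfolding successively_rev by (simp add: symE)
      then show ?thesis by simp
    qed
    have s3: "successively (\<lambda>u v. (u, v) \<in> ?E) (ys @ [t])"
      using ws(5) unfolding sp split(1) by (auto simp: successively_append_iff)
    have hds: "hd (cs @ [t]) = x1" "hd (rev ds @ [t]) = x2" "hd (ys @ [t]) = x3"
      using rs(2,3) ws(2) unfolding rsplit split(1)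
      by (auto simp: hd_append hd_rev split: if_splits)
    have ext: "path_edges (p # (q # l) @ [t]) \<subseteq> ?E"
      if "successively (\<lambda>u v. (u, v) \<in> ?E) (l @ [t])" "(p, q) \<in> ?E" "(q, hd (l @ [t])) \<in> ?E" for q l
      using that unfolding sp by (cases l) auto
    have inK: "set cs \<subseteq> K" "set ds \<subseteq> K" "set ys \<subseteq> K"
      using rs(6) ws(6) unfolding rsplit split(1) by auto
    have dist: "distinct (cs @ [t])" "distinct (rev ds @ [t])" "distinct (ys @ [t])"
        "set cs \<inter> set ds = {}"
      using rs(4) ws(4) unfolding rsplit split(1) by auto
    have "set cs \<subseteq> set rs" "set ds \<subseteq> set rs" unfolding rsplit by auto
    then have apart: "set cs \<inter> set ys = {}" "set ds \<inter> set ys = {}"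
      using split(3) by blast+
    have xs: "(q1, hd (cs @ [t])) \<in> ?E" "(q2, hd (rev ds @ [t])) \<in> ?E" "(q3, hd (ys @ [t])) \<in> ?E"
      using hds x by simp_all
    have good: "q # l \<noteq> [] \<and> distinct (p # (q # l) @ [t]) \<and> path_edges (p # (q # l) @ [t]) \<subseteq> ?E"
      if "successively (\<lambda>u v. (u, v) \<in> ?E) (l @ [t])" "(p, q) \<in> ?E" "(q, hd (l @ [t])) \<in> ?E"
        "set l \<subseteq> K" "distinct (l @ [t])" "q \<notin> K" "p \<noteq> q" for q l
    proof -
      have "t \<noteq> q" "t \<noteq> p" "q \<notin> set l" "p \<notin> set l" using that tK out by blast+
      then show ?thesis using ext[OF that(1-3)] that by auto
    qed
    note g = good[OF s1 pq(1) xs(1) inK(1) dist(1) out(2) pne(1)]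
      good[OF s2 pq(2) xs(2) inK(2)[folded set_rev[of ds]] dist(2) out(3) pne(2)]
      good[OF s3 pq(3) xs(3) inK(3) dist(3) out(4) pne(3)]
    have "q1 \<notin> set ds" "q1 \<notin> set ys" "q2 \<notin> set cs" "q2 \<notin> set ys" "q3 \<notin> set cs" "q3 \<notin> set ds"
      using inK out by blast+
    then have dj: "set (q1 # cs) \<inter> set (q2 # rev ds) = {}" "set (q1 # cs) \<inter> set (q3 # ys) = {}"
        "set (q2 # rev ds) \<inter> set (q3 # ys) = {}"
      using q(4-6) apart dist(4) by auto
    have "ms \<noteq> [] \<and> distinct (p # ms @ [t]) \<and> path_edges (p # ms @ [t]) \<subseteq> ?E"
      if "ms \<in> {q1 # cs, q2 # rev ds, q3 # ys}" for ms
      using that g by (elim insertE emptyE) (simp_all only: simp_thms)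
    from outerplanar_no_theta[OF op wf this dj] show False by simp
  qed
qed

section \<open>Small codegrees and orientations of small out-degree\<close>

lemma fat_K23_free_codegree:
  assumes "fat_K23_free E" "sym E" "irrefl E" "u \<noteq> v"
  shows "finite (E `` {u} \<inter> E `` {v}) \<and> card (E `` {u} \<inter> E `` {v}) \<le> 2"
proof -
  have "connected_in E {v}" by (simp add: connected_in_def)
  moreover have "\<forall>q \<in> E `` {u} \<inter> E `` {v}. (u, q) \<in> E \<and> (\<exists>x \<in> {v}. (q, x) \<in> E)"
    using assms(2) by (auto dest: symD)
  moreover have "(E `` {u} \<inter> E `` {v}) \<inter> {v} = {}"
    using assms(3) by (auto simp: irrefl_def)
  ultimately show ?thesis
    using assms(1,4) unfolding fat_K23_free_def by blast
qed

text \<open>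
  A canonical vertex of the component of \<open>v\<close>, so that breadth-first search needs no connectedness.
\<close>

definition comp_root :: "(nat \<times> nat) set \<Rightarrow> nat \<Rightarrow> nat" where
  "comp_root E v = (LEAST w. (w, v) \<in> E\<^sup>*)"

definition level :: "(nat \<times> nat) set \<Rightarrow> nat \<Rightarrow> nat" where
  "level E v = (LEAST d. (comp_root E v, v) \<in> E ^^ d)"

lemma comp_root_reaches: "(comp_root E v, v) \<in> E\<^sup>*"
  unfolding comp_root_def by (rule LeastI[of _ v]) simp

lemma comp_root_edge:
  assumes "sym E" "(u, v) \<in> E"
  shows "comp_root E u = comp_root E v"
proof -
  have "(v, u) \<in> E" using assms by (meson symD)
  then have "(w, u) \<in> E\<^sup>* \<longleftrightarrow> (w, v) \<in> E\<^sup>*" for w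
    using assms(2) by (meson rtrancl.rtrancl_into_rtrancl)
  then show ?thesis by (simp add: comp_root_def)
qed

lemma level_walk: "(comp_root E v, v) \<in> E ^^ level E v"
proof -
  obtain d where "(comp_root E v, v) \<in> E ^^ d"
    using comp_root_reaches rtrancl_imp_relpow by metis
  then show ?thesis unfolding level_def by (rule LeastI)
qed

lemma level_le: "(comp_root E v, v) \<in> E ^^ d \<Longrightarrow> level E v \<le> d"
  unfolding level_def by (rule Least_le)

lemma level_edge:
  assumes "sym E" "(u, v) \<in> E"
  shows "level E v \<le> Suc (level E u)"
  using level_walk[of E u] assms comp_root_edge[OF assms] by (intro level_le) auto

lemma level_parent:
  assumes "sym E" "level E v = Suc d"
  obtains u where "(u, v) \<in> E" "level E u = d"
proof -
  obtain u where u: "(comp_root E v, u) \<in> E ^^ d" "(u, v) \<in> E"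
    using level_walk[of E v] assms(2) by auto
  then have "level E u \<le> d"
    using comp_root_edge[OF assms(1) u(2)] by (intro level_le) auto
  moreover have "d \<le> level E u" using level_edge[OF assms(1) u(2)] assms(2) by simp
  ultimately show ?thesis using that u(2) by simp
qed

lemma level_0: "level E v = 0 \<Longrightarrow> v = comp_root E v"
  using level_walk[of E v] by simp

lemma lower_levels_connected:
  assumes "sym E"
  shows "connected_in E {u. comp_root E u = r \<and> level E u < j}"
proof -
  let ?K = "{u. comp_root E u = r \<and> level E u < j}"
  let ?R = "E \<inter> ?K \<times> ?K"
  have "sym ?R" using assms by (auto simp: sym_def)
  then have sR: "sym (?R\<^sup>*)" by (rule sym_rtrancl)
  have "(r, u) \<in> ?R\<^sup>*" if "u \<in> ?K" for u
    using that
  proof (induction "level E u" arbitrary: u)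
    case 0
    then have "u = r" using level_0 by force
    then show ?case by simp
  next
    case (Suc d)
    obtain w where w: "(w, u) \<in> E" "level E w = d"
      using level_parent[OF assms Suc(2)[symmetric]] by metis
    then have "w \<in> ?K" using Suc comp_root_edge[OF assms w(1)] by auto
    then have "(r, w) \<in> ?R\<^sup>*" "(w, u) \<in> ?R" using Suc w by auto
    then show ?case by (rule rtrancl_into_rtrancl)
  qed
  then show ?thesis
    unfolding connected_in_def using sR by (meson rtrancl_trans symD)
qed

text \<open>
  The levels below \<open>j\<close> of a component form a connected set to which every vertex on level \<open>j\<close> is
  adjacent. It acts as the fat vertex of a \<open>K\<^sub>2\<^sub>,\<^sub>3\<close> whose other centre is \<open>p\<close>. Level 0 of a
  component is a single vertex.
\<close>

lemma card_nbrs_on_lower_level: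
  assumes E: "fat_K23_free E" "sym E" and j: "j \<le> level E p"
  defines "Q \<equiv> {q. (p, q) \<in> E \<and> level E q = j}"
  shows "finite Q \<and> card Q \<le> 2"
proof (cases j)
  case 0
  have "Q \<subseteq> {comp_root E p}"
    using level_0[of E] comp_root_edge[OF E(2)] 0 unfolding Q_def by force
  then show ?thesis
    using card_mono[of "{comp_root E p}" Q] finite_subset[of Q "{comp_root E p}"] by simp
next
  case (Suc i)
  let ?K = "{u. comp_root E u = comp_root E p \<and> level E u < j}"
  have "\<exists>x \<in> ?K. (q, x) \<in> E" if q: "q \<in> Q" for q
  proof -
    obtain x where x: "(x, q) \<in> E" "level E x = i"
      using level_parent[OF E(2), of q i] q Suc by (auto simp: Q_def)
    then have "comp_root E x = comp_root E p"
      using comp_root_edge[OF E(2), of x q] comp_root_edge[OF E(2), of p q] q by (simp add: Q_def)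
    then show ?thesis using x Suc E(2) by (auto dest: symD)
  qed
  moreover have "\<forall>q \<in> Q. (p, q) \<in> E" "Q \<inter> ?K = {}" "p \<notin> ?K"
    using j by (auto simp: Q_def)
  ultimately show ?thesis
    using E(1) lower_levels_connected[OF E(2), of "comp_root E p" j]
    unfolding fat_K23_free_def by blast
qed

text \<open>
  Orient every edge towards the lower level, in both directions within a level. An edge stays within a
  level or joins adjacent levels, and each of the two levels in question holds at most two
  neighbours.
\<close>

lemma fat_K23_free_orientation:
  fixes E :: "(nat \<times> nat) set"
  assumes "fat_K23_free E" "sym E"
  obtains F where "F \<subseteq> E" "E \<subseteq> F \<union> F\<inverse>" "\<And>v. finite (F `` {v}) \<and> card (F `` {v}) \<le> 4"
proof
  let ?F = "{(p, q) \<in> E. level E q \<le> level E p}"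
  show "?F \<subseteq> E" by auto
  show "E \<subseteq> ?F \<union> ?F\<inverse>" using assms(2) by (auto dest: symD)
  fix p
  let ?Q = "\<lambda>j. {q. (p, q) \<in> E \<and> level E q = j}"
  have fin: "finite (?Q j) \<and> card (?Q j) \<le> 2" if "j \<le> level E p" for j
    using card_nbrs_on_lower_level[OF assms that] .
  have "?F `` {p} \<subseteq> ?Q (level E p) \<union> ?Q (level E p - 1)"
  proof
    fix q assume "q \<in> ?F `` {p}"
    then have q: "(p, q) \<in> E" "level E q \<le> level E p" by auto
    then have "level E p \<le> Suc (level E q)"
      using level_edge[OF assms(2), of q p] assms(2) by (auto dest: symD)
    then have "level E q = level E p \<or> level E q = level E p - 1" using q(2) by linarith
    then show "q \<in> ?Q (level E p) \<union> ?Q (level E p - 1)" using q by blast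
  qed
  moreover have "finite (?Q (level E p) \<union> ?Q (level E p - 1))" using fin by simp
  moreover have "card (?Q (level E p) \<union> ?Q (level E p - 1)) \<le> 4"
    using card_Un_le[of "?Q (level E p)" "?Q (level E p - 1)"] fin[of "level E p"] fin[of "level E p - 1"]
    by simp
  ultimately show "finite (?F `` {p}) \<and> card (?F `` {p}) \<le> 4"
    by (meson card_mono finite_subset le_trans)
qed

section \<open>The spectral theorem for real symmetric matrices\<close>

text \<open>
  The value \<open>w\<^sup>* A w\<close> equals its own conjugate, as \<open>A\<close> is real and symmetric, and also
  \<open>\<mu> |w|\<^sup>2\<close>.
\<close>

lemma complex_symmetric_eigenvalue_real:
  fixes A :: "real mat"
  assumes A: "A \<in> carrier_mat n n" and sym: "transpose_mat A = A"
    and w: "w \<in> carrier_vec n" "w \<noteq> 0\<^sub>v n" "map_mat complex_of_real A *\<^sub>v w = \<mu> \<cdot>\<^sub>v w"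
  shows "\<mu> \<in> \<real>"
proof -
  define s where "s = (\<Sum>i<n. cnj (w $ i) * (\<Sum>j<n. complex_of_real (A $$ (i, j)) * w $ j))"
  define N where "N = (\<Sum>i<n. (cmod (w $ i))\<^sup>2)"
  have Asym: "A $$ (j, i) = A $$ (i, j)" if "i < n" "j < n" for i j
    using arg_cong[OF sym, of "\<lambda>M. M $$ (i, j)"] A that by simp
  have row: "(\<Sum>j<n. complex_of_real (A $$ (i, j)) * w $ j) = \<mu> * w $ i" if "i < n" for i
    using arg_cong[OF w(3), of "\<lambda>v. v $ i"] A w(1) that
    by (simp add: scalar_prod_def lessThan_atLeast0)
  have "s = (\<Sum>i<n. \<mu> * complex_of_real ((cmod (w $ i))\<^sup>2))"
    unfolding s_def using row
    by (intro sum.cong) (auto simp: complex_norm_square mult_ac simp del: of_real_power)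
  also have "\<dots> = \<mu> * complex_of_real N"
    by (simp add: N_def sum_distrib_left)
  finally have s: "s = \<mu> * complex_of_real N" .
  have "cnj s = (\<Sum>i<n. \<Sum>j<n. w $ i * complex_of_real (A $$ (i, j)) * cnj (w $ j))"
    by (simp add: s_def sum_distrib_left mult.assoc)
  also have "\<dots> = (\<Sum>j<n. \<Sum>i<n. w $ i * complex_of_real (A $$ (i, j)) * cnj (w $ j))"
    by (rule sum.swap)
  also have "\<dots> = s"
    unfolding s_def sum_distrib_left using Asym
    by (intro sum.cong refl) (auto simp: mult_ac)
  finally have "cnj s = s" .
  then have sR: "s \<in> \<real>" by (simp add: Reals_cnj_iff)
  have "N \<noteq> 0"
  proof
    assume "N = 0"
    then have "\<forall>i \<in> {..<n}. (cmod (w $ i))\<^sup>2 = 0"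
      unfolding N_def by (subst (asm) sum_nonneg_eq_0_iff) auto
    then have "w = 0\<^sub>v n" using w(1) by (intro eq_vecI) auto
    then show False using w(2) by simp
  qed
  then have "\<mu> = s / complex_of_real N" using s by simp
  then show ?thesis using sR by simp
qed

lemma symmetric_real_eigenvector:
  fixes A :: "real mat"
  assumes A: "A \<in> carrier_mat n n" and sym: "transpose_mat A = A" and n: "n > 0"
  obtains e v where "v \<in> carrier_vec n" "v \<noteq> 0\<^sub>v n" "A *\<^sub>v v = e \<cdot>\<^sub>v v"
proof -
  let ?B = "map_mat complex_of_real A"
  have B: "?B \<in> carrier_mat n n" using A by simp
  have "degree (char_poly ?B) = n" using degree_monic_char_poly[OF B] by simp
  then have "\<not> constant (poly (char_poly ?B))" using n by (simp add: constant_degree)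
  then obtain \<mu> where mu: "poly (char_poly ?B) \<mu> = 0"
    using fundamental_theorem_of_algebra by blast
  then obtain w where w: "w \<in> carrier_vec n" "w \<noteq> 0\<^sub>v n" "?B *\<^sub>v w = \<mu> \<cdot>\<^sub>v w"
    using eigenvalue_root_char_poly[OF B] A unfolding eigenvalue_def eigenvector_def by auto
  obtain e where e: "\<mu> = complex_of_real e"
    using complex_symmetric_eigenvalue_real[OF A sym w] by (auto elim: Reals_cases)
  have "char_poly ?B = map_poly complex_of_real (char_poly A)"
    by (rule of_real_hom.char_poly_hom[OF A])
  then have "poly (char_poly A) e = 0"
    using mu e by simp
  then obtain v where "v \<in> carrier_vec n" "v \<noteq> 0\<^sub>v n" "A *\<^sub>v v = e \<cdot>\<^sub>v v"
    using eigenvalue_root_char_poly[OF A] A unfolding eigenvalue_def eigenvector_def by auto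
  then show ?thesis by (rule that)
qed

text \<open>
  A reflection is its own transpose and its own inverse, so conjugation by it preserves symmetry and
  splits off an eigenvector without any Gram--Schmidt process.
\<close>

lemma householder_reflection:
  fixes v :: "nat \<Rightarrow> real"
  assumes v: "(\<Sum>i<n. (v i)\<^sup>2) = 1" and n: "n > 0"
  obtains H where "H \<in> carrier_mat n n" "transpose_mat H = H" "H * H = 1\<^sub>m n"
    "col H 0 = vec n v"
proof -
  define u where "u i = v i - (if i = 0 then 1 else 0)" for i :: nat
  define c where "c = 2 / (\<Sum>i<n. (u i)\<^sup>2)"
  define H where "H = Matrix.mat n n (\<lambda>(i, j). (if i = j then 1 else 0) - c * u i * u j)"
  have "(\<Sum>i<n. (u i)\<^sup>2) = (\<Sum>i<n. (v i)\<^sup>2 + (if i = 0 then 1 - 2 * v i else 0))"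
    by (intro sum.cong) (auto simp: u_def power2_eq_square algebra_simps)
  also have "\<dots> = 2 - 2 * v 0" using v n by (simp add: sum.distrib)
  finally have U: "(\<Sum>i<n. (u i)\<^sup>2) = - 2 * u 0" by (simp add: u_def)
  have cc: "c * c * (\<Sum>i<n. (u i)\<^sup>2) = 2 * c" by (auto simp: c_def)
  have "H * H = 1\<^sub>m n"
  proof (rule eq_matI)
    fix i j assume ij: "i < dim_row (1\<^sub>m n :: real mat)" "j < dim_col (1\<^sub>m n :: real mat)"
    have "(H * H) $$ (i, j) = (\<Sum>k<n. ((if i = k then 1 else 0) - c * u i * u k) * ((if k = j then 1 else 0) - c * u k * u j))"
      using ij by (simp add: H_def scalar_prod_def lessThan_atLeast0)
    also have "\<dots> = (\<Sum>k<n. (if k = i then (if i = j then 1 else 0) - c * u i * u j else 0) - (if k = j then c * u i * u j else 0)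
        + c * c * u i * u j * (u k)\<^sup>2)"
      by (intro sum.cong) (auto simp: power2_eq_square algebra_simps)
    also have "\<dots> = (if i = j then 1 else 0) - 2 * c * u i * u j + (c * c * (\<Sum>k<n. (u k)\<^sup>2)) * u i * u j"
      using ij by (simp add: sum.distrib sum_subtractf sum_distrib_left[symmetric] algebra_simps)
    also have "\<dots> = 1\<^sub>m n $$ (i, j)" using ij unfolding cc by simp
    finally show "(H * H) $$ (i, j) = 1\<^sub>m n $$ (i, j)" .
  qed (auto simp: H_def)
  moreover have "col H 0 = vec n v"
  proof (rule eq_vecI)
    fix i assume i: "i < dim_vec (vec n v)"
    have "c * u i * u 0 = - u i"
    proof (cases "u 0 = 0")
      case True
      then have "(\<Sum>i<n. (u i)\<^sup>2) = 0" using U by simp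
      then have "\<forall>i \<in> {..<n}. (u i)\<^sup>2 = 0" by (subst (asm) sum_nonneg_eq_0_iff) auto
      then show ?thesis using i by simp
    next
      case False
      then show ?thesis unfolding c_def U by simp
    qed
    then show "col H 0 $ i = vec n v $ i" using i n by (simp add: H_def u_def)
  qed (auto simp: H_def)
  moreover have "transpose_mat H = H" by (rule eq_matI) (auto simp: H_def)
  ultimately show ?thesis using that[of H] by (simp add: H_def)
qed

theorem symmetric_diagonalization:
  fixes A :: "real mat"
  assumes "A \<in> carrier_mat n n" "transpose_mat A = A"
  shows "\<exists>P d. P \<in> carrier_mat n n \<and> transpose_mat P * P = 1\<^sub>m n \<and>
     transpose_mat P * A * P = mat_diag n d"
  using assms
proof (induction n arbitrary: A)
  case 0
  then show ?case
    by (intro exI[of _ "1\<^sub>m 0"] exI[of _ "\<lambda>_. 0"]) (auto intro!: eq_matI simp: mat_diag_def)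
next
  case (Suc n)
  let ?N = "Suc n"
  note A = Suc.prems(1) and sym = Suc.prems(2)
  obtain e w where w: "w \<in> carrier_vec ?N" "w \<noteq> 0\<^sub>v ?N" "A *\<^sub>v w = e \<cdot>\<^sub>v w"
    using symmetric_real_eigenvector[OF A sym] by blast
  define r where "r = sqrt (\<Sum>i<?N. (w $ i)\<^sup>2)"
  have "(\<Sum>i<?N. (w $ i)\<^sup>2) \<noteq> 0"
  proof
    assume "(\<Sum>i<?N. (w $ i)\<^sup>2) = 0"
    then have "\<forall>i \<in> {..<?N}. (w $ i)\<^sup>2 = 0" by (subst (asm) sum_nonneg_eq_0_iff) auto
    then have "w = 0\<^sub>v ?N" using w(1) by (intro eq_vecI) auto
    then show False using w(2) by simp
  qed
  then have r2: "r\<^sup>2 = (\<Sum>i<?N. (w $ i)\<^sup>2)" "r \<noteq> 0"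
    by (auto simp: r_def sum_nonneg)
  define v where "v i = w $ i / r" for i
  have "(\<Sum>i<?N. (v i)\<^sup>2) = r\<^sup>2 / r\<^sup>2"
    unfolding r2(1) v_def power_divide sum_divide_distrib by simp
  then have "(\<Sum>i<?N. (v i)\<^sup>2) = 1" using r2(2) by simp
  then obtain H where H: "H \<in> carrier_mat ?N ?N" "transpose_mat H = H" "H * H = 1\<^sub>m ?N"
    "col H 0 = vec ?N v" by (rule householder_reflection) auto
  have vw: "vec ?N v = (1 / r) \<cdot>\<^sub>v w" using w(1) by (intro eq_vecI) (auto simp: v_def)
  have Av: "A *\<^sub>v vec ?N v = e \<cdot>\<^sub>v vec ?N v"
    unfolding vw using A w by (simp add: mult_mat_vec smult_smult_assoc mult.commute)
  define B where "B = H * A * H"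
  have B: "B \<in> carrier_mat ?N ?N" using H A by (simp add: B_def)
  have Bsym: "transpose_mat B = B"
    unfolding B_def using H A sym
    by (simp add: transpose_mult[of _ ?N ?N _ ?N] assoc_mult_mat[of _ ?N ?N _ ?N _ ?N])
  have "col B 0 = (H * A) *\<^sub>v col H 0"
    unfolding B_def using H A by (intro col_mult2[of _ ?N ?N _ ?N]) auto
  also have "\<dots> = H *\<^sub>v (A *\<^sub>v vec ?N v)"
    unfolding H(4) using H(1) A by (rule assoc_mult_mat_vec) simp
  also have "\<dots> = e \<cdot>\<^sub>v (H *\<^sub>v col H 0)"
    unfolding Av H(4) using H by (simp add: mult_mat_vec[of _ ?N ?N])
  also have "H *\<^sub>v col H 0 = col (H * H) 0"
    using H(1) by (intro col_mult2[of _ ?N ?N _ ?N, symmetric]) auto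
  also have "\<dots> = unit_vec ?N 0" unfolding H(3) by simp
  finally have col0: "col B 0 = e \<cdot>\<^sub>v unit_vec ?N 0" .
  have B0: "B $$ (i, 0) = (if i = 0 then e else 0)" if "i < ?N" for i
    using arg_cong[OF col0, of "\<lambda>v. v $ i"] that B by simp
  have Bs: "B $$ (j, i) = B $$ (i, j)" if "i < ?N" "j < ?N" for i j
    using arg_cong[OF Bsym, of "\<lambda>M. M $$ (i, j)"] that B by simp
  define C where "C = Matrix.mat n n (\<lambda>(i, j). B $$ (Suc i, Suc j))"
  let ?E = "mat_diag 1 (\<lambda>_. e)"
  let ?Z = "0\<^sub>m 1 n :: real mat" and ?Z' = "0\<^sub>m n 1 :: real mat"
  have C: "C \<in> carrier_mat n n" by (simp add: C_def)
  have Bblock: "B = four_block_mat ?E ?Z ?Z' C"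
  proof (rule eq_matI)
    fix i j assume "i < dim_row (four_block_mat ?E ?Z ?Z' C)" "j < dim_col (four_block_mat ?E ?Z ?Z' C)"
    then have ij: "i < ?N" "j < ?N" by (auto simp: C_def mat_diag_def)
    then show "B $$ (i, j) = four_block_mat ?E ?Z ?Z' C $$ (i, j)"
      using B0[of i] B0[of j] Bs[of 0 j]
      by (cases i; cases j) (auto simp: C_def mat_diag_def)
  qed (use B in \<open>auto simp: C_def mat_diag_def\<close>)
  have "transpose_mat C = C" using Bs by (intro eq_matI) (auto simp: C_def)
  from Suc.IH[OF C this] obtain P d where P: "P \<in> carrier_mat n n" "transpose_mat P * P = 1\<^sub>m n"
      "transpose_mat P * C * P = mat_diag n d" by blast
  let ?Q = "four_block_mat (1\<^sub>m 1) ?Z ?Z' P"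
  have Q: "?Q \<in> carrier_mat ?N ?N" using P(1) by auto
  have Qt: "transpose_mat ?Q = four_block_mat (1\<^sub>m 1) ?Z ?Z' (transpose_mat P)"
    using P(1) by (subst transpose_four_block_mat) auto
  have QQ: "transpose_mat ?Q * ?Q = 1\<^sub>m ?N"
    unfolding Qt using P(1,2) by (subst mult_four_block_mat) auto
  have QBQ: "transpose_mat ?Q * B * ?Q = mat_diag ?N (\<lambda>i. case i of 0 \<Rightarrow> e | Suc j \<Rightarrow> d j)"
  proof -
    have carr: "transpose_mat P \<in> carrier_mat n n" "?E \<in> carrier_mat 1 1"
      using P(1) by auto
    have E: "mat_diag (Suc 0) (\<lambda>_. e) \<in> carrier_mat (Suc 0) (Suc 0)" by simp
    note units = left_mult_one_mat[OF E] right_mult_one_mat[OF E] left_mult_zero_mat[OF E] right_mult_zero_mat[OF E]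
      right_add_zero_mat[OF E]
    have "transpose_mat ?Q * B = four_block_mat ?E ?Z ?Z' (transpose_mat P * C)"
      unfolding Qt Bblock using carr C
      by (subst mult_four_block_mat[of _ 1 1 _ n _ n _ _ 1 _ n]) (auto simp: units)
    then have "transpose_mat ?Q * B * ?Q = four_block_mat ?E ?Z ?Z' (transpose_mat P * C * P)"
      using carr C P(1)
      by (simp only:) (subst mult_four_block_mat[of _ 1 1 _ n _ n _ _ 1 _ n], auto simp: units)
    also have "\<dots> = mat_diag ?N (\<lambda>i. case i of 0 \<Rightarrow> e | Suc j \<Rightarrow> d j)"
      unfolding P(3) by (rule eq_matI) (auto simp: mat_diag_def split: nat.splits)
    finally show ?thesis .
  qed
  let ?P = "H * ?Q"
  have Pt: "transpose_mat ?P = transpose_mat ?Q * H"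
    using H Q by (simp add: transpose_mult[of _ ?N ?N _ ?N])
  have Qt': "transpose_mat ?Q \<in> carrier_mat ?N ?N" using Q by simp
  have "transpose_mat ?P * ?P = transpose_mat ?Q * (H * H) * ?Q"
    unfolding Pt using H(1) Q Qt'
    by (simp add: assoc_mult_mat[of _ ?N ?N _ ?N _ ?N] del: transpose_carrier_mat)
  also have "\<dots> = transpose_mat ?Q * ?Q"
    unfolding H(3) using right_mult_one_mat[OF Qt'] by simp
  finally have "transpose_mat ?P * ?P = 1\<^sub>m ?N" unfolding QQ .
  moreover have "transpose_mat ?P * A * ?P = transpose_mat ?Q * B * ?Q"
    unfolding Pt B_def using H(1) Q Qt' A
    by (simp add: assoc_mult_mat[of _ ?N ?N _ ?N _ ?N] del: transpose_carrier_mat)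
  moreover have "?P \<in> carrier_mat ?N ?N" using H Q by simp
  ultimately show ?case using QBQ by metis
qed

lemma sum_squares_form:
  fixes P :: "nat \<Rightarrow> nat \<Rightarrow> real"
  shows "(\<Sum>i<n. \<Sum>j<n. (\<Sum>m<n. P i m * d m * P j m) * x i * x j) =
    (\<Sum>m<n. d m * (\<Sum>i<n. P i m * x i)\<^sup>2)"
proof -
  have "(\<Sum>i<n. \<Sum>j<n. (\<Sum>m<n. P i m * d m * P j m) * x i * x j) =
      (\<Sum>i<n. \<Sum>j<n. \<Sum>m<n. d m * ((P i m * x i) * (P j m * x j)))"
    by (simp add: sum_distrib_left sum_distrib_right mult_ac)
  also have "\<dots> = (\<Sum>i<n. \<Sum>m<n. \<Sum>j<n. d m * ((P i m * x i) * (P j m * x j)))"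
    by (intro sum.cong refl sum.swap)
  also have "\<dots> = (\<Sum>m<n. \<Sum>i<n. \<Sum>j<n. d m * ((P i m * x i) * (P j m * x j)))"
    by (rule sum.swap)
  also have "\<dots> = (\<Sum>m<n. d m * (\<Sum>i<n. P i m * x i)\<^sup>2)"
    by (simp only: power2_eq_square sum_product) (simp only: sum_distrib_left)
  finally show ?thesis .
qed

text \<open>
  The spectral theorem in terms of coordinates: \<open>P\<close> is orthogonal, its columns are eigenvectors, and the
  entries of \<open>d\<close> are the eigenvalues with their multiplicities in the characteristic polynomial.
\<close>

lemma symmetric_form_diagonalization:
  fixes A :: "real mat"
  assumes A: "A \<in> carrier_mat n n" and sym: "transpose_mat A = A"
  obtains P :: "nat \<Rightarrow> nat \<Rightarrow> real" and d where
    "\<And>x. (\<Sum>i<n. \<Sum>j<n. A $$ (i, j) * x i * x j) = (\<Sum>m<n. d m * (\<Sum>i<n. P i m * x i)\<^sup>2)"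
    "\<And>x. (\<Sum>i<n. (x i)\<^sup>2) = (\<Sum>m<n. (\<Sum>i<n. P i m * x i)\<^sup>2)"
    "\<And>c m. m < n \<Longrightarrow> (\<Sum>i<n. P i m * (\<Sum>l<n. P i l * c l)) = c m"
    "proots (char_poly A) = image_mset d (mset_set {..<n})"
proof -
  obtain P d where P: "P \<in> carrier_mat n n" and PtP: "transpose_mat P * P = 1\<^sub>m n"
    and D: "transpose_mat P * A * P = mat_diag n d"
    using symmetric_diagonalization[OF A sym] by blast
  have Pt: "transpose_mat P \<in> carrier_mat n n" using P by simp
  have PPt: "P * transpose_mat P = 1\<^sub>m n"
    using mat_mult_left_right_inverse[OF Pt P PtP] .
  have "P * (transpose_mat P * A * P) * transpose_mat P = (P * transpose_mat P) * A * (P * transpose_mat P)"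
    using P Pt A by (simp add: assoc_mult_mat[of _ n n _ n _ n] del: transpose_carrier_mat)
  also have "\<dots> = A" unfolding PPt using A by simp
  finally have AD: "A = P * mat_diag n d * transpose_mat P" unfolding D by simp
  have entry: "A $$ (i, j) = (\<Sum>m<n. P $$ (i, m) * d m * P $$ (j, m))" if "i < n" "j < n" for i j
  proof -
    have "A $$ (i, j) = (P * mat_diag n d * transpose_mat P) $$ (i, j)" using AD by simp
    then show ?thesis
      using that P unfolding mat_diag_mult_right[OF P]
      by (simp add: scalar_prod_def lessThan_atLeast0)
  qed
  have one: "(\<Sum>m<n. P $$ (i, m) * 1 * P $$ (j, m)) = (if i = j then 1 else 0)" if "i < n" "j < n" for i j
    using arg_cong[OF PPt, of "\<lambda>M. M $$ (i, j)"] that P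
    by (simp add: scalar_prod_def lessThan_atLeast0)
  have one': "(\<Sum>i<n. P $$ (i, m) * P $$ (i, l)) = (if m = l then 1 else 0)" if "m < n" "l < n" for m l
    using arg_cong[OF PtP, of "\<lambda>M. M $$ (m, l)"] that P
    by (simp add: scalar_prod_def lessThan_atLeast0)
  show ?thesis
  proof (rule that[where P = "\<lambda>i m. P $$ (i, m)" and d = d])
    fix x :: "nat \<Rightarrow> real"
    show "(\<Sum>i<n. \<Sum>j<n. A $$ (i, j) * x i * x j) = (\<Sum>m<n. d m * (\<Sum>i<n. P $$ (i, m) * x i)\<^sup>2)"
      unfolding sum_squares_form[symmetric] using entry by (intro sum.cong refl) auto
    have "(\<Sum>i<n. (x i)\<^sup>2) = (\<Sum>i<n. \<Sum>j<n. (if i = j then 1 else 0) * x i * x j)"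
      by (intro sum.cong refl) (simp add: power2_eq_square if_distrib[of "\<lambda>z. z * _"] cong: if_cong)
    also have "\<dots> = (\<Sum>i<n. \<Sum>j<n. (\<Sum>m<n. P $$ (i, m) * 1 * P $$ (j, m)) * x i * x j)"
      using one by (intro sum.cong refl) auto
    also have "\<dots> = (\<Sum>m<n. 1 * (\<Sum>i<n. P $$ (i, m) * x i)\<^sup>2)"
      by (rule sum_squares_form)
    finally show "(\<Sum>i<n. (x i)\<^sup>2) = (\<Sum>m<n. (\<Sum>i<n. P $$ (i, m) * x i)\<^sup>2)" by simp
  next
    fix c :: "nat \<Rightarrow> real" and m assume m: "m < n"
    have "(\<Sum>i<n. P $$ (i, m) * (\<Sum>l<n. P $$ (i, l) * c l)) = (\<Sum>l<n. (\<Sum>i<n. P $$ (i, m) * P $$ (i, l)) * c l)"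
      unfolding sum_distrib_left sum_distrib_right by (subst sum.swap) (simp add: mult_ac)
    also have "\<dots> = (\<Sum>l<n. (if m = l then 1 else 0) * c l)"
      using one' m by (intro sum.cong) auto
    also have "\<dots> = c m" using m by (simp add: if_distrib[of "\<lambda>z. z * _"] cong: if_cong)
    finally show "(\<Sum>i<n. P $$ (i, m) * (\<Sum>l<n. P $$ (i, l) * c l)) = c m" .
  next
    have "similar_mat A (mat_diag n d)"
      using P Pt A PPt PtP AD by (intro similar_matI[of _ _ P "transpose_mat P" n]) auto
    then have "char_poly A = char_poly (mat_diag n d)" by (rule char_poly_similar)
    also have "\<dots> = (\<Prod>a \<leftarrow> diag_mat (mat_diag n d). [:- a, 1:])"
      by (rule char_poly_upper_triangular[of _ n]) (auto simp: mat_diag_def)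
    also have "diag_mat (mat_diag n d) = map d [0..<n]"
      by (simp add: diag_mat_def mat_diag_def)
    also have "(\<Prod>a \<leftarrow> map d [0..<n]. [:- a, 1:]) = (\<Prod>m<n. [:- d m, 1:])"
      by (simp add: prod.distinct_set_conv_list[symmetric] o_def lessThan_atLeast0)
    finally have "char_poly A = (\<Prod>m<n. [:- d m, 1:])" .
    moreover have "proots (\<Prod>m<n. [:- d m, 1:]) = image_mset d (mset_set {..<n})"
    proof (induction n)
      case (Suc n)
      then show ?case
        by (simp add: lessThan_Suc proots_mult prod_zero_iff del: mult_pCons_left mult_pCons_right)
    qed simp
    ultimately show "proots (char_poly A) = image_mset d (mset_set {..<n})" by simp
  qed
qed

text \<open>
  All that min-max arguments need to know about the position of an eigenvalue in the sorted list.
\<close>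

lemma nth_largest_counts:
  fixes M :: "real multiset"
  assumes k: "1 \<le> k" "k \<le> size M"
  defines "x \<equiv> rev (sorted_list_of_multiset M) ! (k - 1)"
  shows "k \<le> size (filter_mset (\<lambda>y. x \<le> y) M)" "size (filter_mset (\<lambda>y. x < y) M) < k"
proof -
  let ?xs = "rev (sorted_list_of_multiset M)"
  have len: "length ?xs = size M" by (metis length_rev mset_sorted_list_of_multiset size_mset)
  have mset: "mset ?xs = M" by simp
  have mono: "?xs ! j \<le> ?xs ! i" if "i \<le> j" "j < size M" for i j
    using sorted_rev_nth_mono[of ?xs i j] that len by simp
  have count: "size (filter_mset P M) = card {i. i < size M \<and> P (?xs ! i)}" for P
  proof -
    have "filter_mset P M = mset (filter P ?xs)" by (simp add: mset_filter)
    then have "size (filter_mset P M) = length (filter P ?xs)" by (simp only: size_mset)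
    then show ?thesis unfolding length_filter_conv_card len .
  qed
  have "{..<k} \<subseteq> {i. i < size M \<and> x \<le> ?xs ! i}"
    using mono k unfolding x_def by auto
  then show "k \<le> size (filter_mset (\<lambda>y. x \<le> y) M)"
    unfolding count using card_mono[of "{i. i < size M \<and> x \<le> ?xs ! i}" "{..<k}"] by simp
  have "{i. i < size M \<and> x < ?xs ! i} \<subseteq> {..<k - 1}"
  proof
    fix i assume "i \<in> {i. i < size M \<and> x < ?xs ! i}"
    then have "i < size M" "\<not> ?xs ! i \<le> x" by auto
    then have "\<not> k - 1 \<le> i" using mono[of "k - 1" i] unfolding x_def by blast
    then show "i \<in> {..<k - 1}" by simp
  qed
  then have "card {i. i < size M \<and> x < ?xs ! i} \<le> k - 1"
    using card_mono[of "{..<k - 1}" "{i. i < size M \<and> x < ?xs ! i}"] by simp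
  then show "size (filter_mset (\<lambda>y. x < y) M) < k"
    unfolding count using k by linarith
qed

lemma homogeneous_system_solution:
  fixes M :: "'s \<Rightarrow> 'i \<Rightarrow> real"
  assumes "finite S" "finite I" "card S < card I"
  shows "\<exists>c. (\<exists>i \<in> I. c i \<noteq> 0) \<and> (\<forall>s \<in> S. (\<Sum>i \<in> I. M s i * c i) = 0)"
  using assms
proof (induction S arbitrary: I M rule: finite_induct)
  case empty
  then have "I \<noteq> {}" by auto
  then show ?case by (intro exI[of _ "\<lambda>_. 1"]) auto
next
  case (insert s S)
  show ?case
  proof (cases "\<forall>i \<in> I. M s i = 0")
    case True
    have "card S < card I" using insert by simp
    from insert.IH[OF insert.prems(1) this, of M] True show ?thesis by auto
  next
    case False
    then obtain j where j: "j \<in> I" "M s j \<noteq> 0" by auto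
    let ?J = "I - {j}"
    \<comment> \<open>Eliminate the unknown with index \<open>j\<close> by means of equation \<open>s\<close>.\<close>
    let ?M = "\<lambda>t i. M t i - M t j * M s i / M s j"
    have "card S < card ?J" using insert j by simp
    from insert.IH[OF _ this, of ?M] insert.prems(1) obtain c where
      c: "\<exists>i \<in> ?J. c i \<noteq> 0" "\<forall>t \<in> S. (\<Sum>i \<in> ?J. ?M t i * c i) = 0" by auto
    define T where "T = (\<Sum>i \<in> ?J. M s i * c i)"
    define c' where "c' i = (if i = j then - T / M s j else c i)" for i
    have split: "(\<Sum>i \<in> I. M t i * c' i) = (\<Sum>i \<in> ?J. M t i * c i) - M t j * T / M s j" for t
    proof -
      have "(\<Sum>i \<in> I. M t i * c' i) = M t j * c' j + (\<Sum>i \<in> ?J. M t i * c' i)"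
        using j insert.prems(1) by (simp add: sum.remove)
      also have "(\<Sum>i \<in> ?J. M t i * c' i) = (\<Sum>i \<in> ?J. M t i * c i)"
        by (intro sum.cong) (auto simp: c'_def)
      finally show ?thesis by (simp add: c'_def)
    qed
    have "(\<Sum>i \<in> I. M t i * c' i) = 0" if "t \<in> insert s S" for t
    proof (cases "t = s")
      case True
      then show ?thesis unfolding split using j by (simp add: T_def)
    next
      case False
      then have "(\<Sum>i \<in> ?J. ?M t i * c i) = 0" using c(2) that by auto
      moreover have "(\<Sum>i \<in> ?J. ?M t i * c i) = (\<Sum>i \<in> ?J. M t i * c i) - M t j * T / M s j"
      proof -
        have "(\<Sum>i \<in> ?J. ?M t i * c i) = (\<Sum>i \<in> ?J. M t i * c i - M t j / M s j * (M s i * c i))"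
          by (simp add: left_diff_distrib mult.assoc)
        then show ?thesis
          unfolding T_def by (simp add: sum_subtractf sum_distrib_left sum_divide_distrib)
      qed
      ultimately show ?thesis unfolding split by simp
    qed
    moreover have "\<exists>i \<in> I. c' i \<noteq> 0" using c(1) by (auto simp: c'_def)
    ultimately show ?thesis by blast
  qed
qed

section \<open>Min-max bounds for adjacency eigenvalues\<close>

abbreviation edge_form :: "('a \<times> 'a) set \<Rightarrow> ('a \<Rightarrow> real) \<Rightarrow> real" where
  "edge_form E x \<equiv> (\<Sum>(u, v) \<in> E. x u * x v)"

lemma graph_on_parcs:
  assumes "graph_on n G"
  shows "parcs G \<subseteq> {0..<n} \<times> {0..<n}" "finite (parcs G)" "sym (parcs G)" "irrefl (parcs G)"
    "parcs G \<subseteq> pverts G \<times> pverts G"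
proof -
  interpret pair_graph G using assms by (simp add: graph_on_def)
  show "parcs G \<subseteq> {0..<n} \<times> {0..<n}"
    using assms in_arcsD1 in_arcsD2 unfolding graph_on_def by auto
  show "parcs G \<subseteq> pverts G \<times> pverts G"
    using in_arcsD1 in_arcsD2 by auto
  show "finite (parcs G)" by (rule pair_finite_arcs)
  show "sym (parcs G)" using pair_sym_arcs by (simp add: symmetric_def)
  show "irrefl (parcs G)" using pair_no_loops by (fastforce simp: irrefl_def)
qed

lemma adj_matrix_form:
  assumes "graph_on n G"
  shows "(\<Sum>i<n. \<Sum>j<n. adj_matrix n G $$ (i, j) * x i * x j) = edge_form (parcs G) x"
proof -
  have "(\<Sum>i<n. \<Sum>j<n. adj_matrix n G $$ (i, j) * x i * x j) =
      (\<Sum>e \<in> {..<n} \<times> {..<n}. if e \<in> parcs G then x (fst e) * x (snd e) else 0)"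
    unfolding sum.cartesian_product by (intro sum.cong) (auto simp: adj_matrix_def)
  also have "\<dots> = (\<Sum>e \<in> parcs G. x (fst e) * x (snd e))"
    using graph_on_parcs(1,2)[OF assms]
    by (intro sum.mono_neutral_cong_right) auto
  finally show ?thesis by (simp add: case_prod_unfold)
qed

lemma adjacency_eigenbasis:
  assumes G: "graph_on n G" and k: "1 \<le> k" "k \<le> n"
  obtains P :: "nat \<Rightarrow> nat \<Rightarrow> real" and d where
    "\<And>x. edge_form (parcs G) x = (\<Sum>m<n. d m * (\<Sum>i<n. P i m * x i)\<^sup>2)"
    "\<And>x. (\<Sum>i<n. (x i)\<^sup>2) = (\<Sum>m<n. (\<Sum>i<n. P i m * x i)\<^sup>2)"
    "\<And>c m. m < n \<Longrightarrow> (\<Sum>i<n. P i m * (\<Sum>l<n. P i l * c l)) = c m"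
    "k \<le> card {m. m < n \<and> lambda k n G \<le> d m}"
    "card {m. m < n \<and> lambda k n G < d m} < k"
proof -
  let ?A = "adj_matrix n G"
  have A: "?A \<in> carrier_mat n n" by (simp add: adj_matrix_def)
  have "transpose_mat ?A = ?A"
    using graph_on_parcs(3)[OF G] by (intro eq_matI) (auto simp: adj_matrix_def dest: symD)
  then obtain P d where
    P: "\<And>x. (\<Sum>i<n. \<Sum>j<n. ?A $$ (i, j) * x i * x j) = (\<Sum>m<n. d m * (\<Sum>i<n. P i m * x i)\<^sup>2)"
    "\<And>x. (\<Sum>i<n. (x i)\<^sup>2) = (\<Sum>m<n. (\<Sum>i<n. P i m * x i)\<^sup>2)"
    "\<And>c m. m < n \<Longrightarrow> (\<Sum>i<n. P i m * (\<Sum>l<n. P i l * c l)) = c m"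
    and roots: "proots (char_poly ?A) = image_mset d (mset_set {..<n})"
    by (rule symmetric_form_diagonalization[OF A]) (rule that)
  have size: "size (filter_mset Q (proots (char_poly ?A))) = card {m. m < n \<and> Q (d m)}" for Q
    unfolding roots by (simp add: filter_mset_image_mset filter_mset_mset_set lessThan_def)
  have kn: "k \<le> size (proots (char_poly ?A))" using k unfolding roots by simp
  note counts = nth_largest_counts[OF k(1) kn, folded lambda_def, unfolded size]
  show ?thesis by (rule that[OF P(1)[unfolded adj_matrix_form[OF G]] P(2,3) counts])
qed

text \<open>
  The eigenvectors of the \<open>k\<close> largest eigenvalues span a space in which fewer than \<open>k\<close> conditions
  \<open>x v = 0\<close> leave a nonzero vector; there the form is at least \<open>\<lambda>\<^sub>k |x|\<^sup>2\<close>.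
\<close>

lemma lambda_le_of_form_le:
  assumes G: "graph_on n G" and k: "1 \<le> k" "k \<le> n"
    and S: "finite S" "card S < k"
    and form: "\<And>x. (\<forall>v \<in> S. x v = 0) \<Longrightarrow> edge_form (parcs G) x \<le> \<mu> * (\<Sum>i<n. (x i)\<^sup>2)"
  shows "lambda k n G \<le> \<mu>"
proof -
  obtain P d where P: "\<And>x. edge_form (parcs G) x = (\<Sum>m<n. d m * (\<Sum>i<n. P i m * x i)\<^sup>2)"
    "\<And>x. (\<Sum>i<n. (x i)\<^sup>2) = (\<Sum>m<n. (\<Sum>i<n. P i m * x i)\<^sup>2)"
    "\<And>c m. m < n \<Longrightarrow> (\<Sum>i<n. P i m * (\<Sum>l<n. P i l * c l)) = c m"
    and big: "k \<le> card {m. m < n \<and> lambda k n G \<le> d m}"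
    and "card {m. m < n \<and> lambda k n G < d m} < k"
    by (rule adjacency_eigenbasis[OF G k]) (rule that)
  let ?l = "lambda k n G"
  define I where "I = {m. m < n \<and> ?l \<le> d m}"
  have I: "finite I" "I \<subseteq> {..<n}" by (auto simp: I_def)
  have "card S < card I" using S(2) big unfolding I_def by linarith
  from homogeneous_system_solution[OF S(1) I(1) this, of P] obtain c where
    c: "\<exists>i \<in> I. c i \<noteq> 0" "\<forall>s \<in> S. (\<Sum>i \<in> I. P s i * c i) = 0" by blast
  define c' where "c' m = (if m \<in> I then c m else 0)" for m
  define x where "x i = (\<Sum>m<n. P i m * c' m)" for i
  have coord: "(\<Sum>i<n. P i m * x i) = c' m" if "m < n" for m
    using P(3)[OF that] by (simp add: x_def)
  have "x v = (\<Sum>i \<in> I. P v i * c i)" for v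
    unfolding x_def using I by (intro sum.mono_neutral_cong_right) (auto simp: c'_def)
  then have "edge_form (parcs G) x \<le> \<mu> * (\<Sum>i<n. (x i)\<^sup>2)"
    using c(2) by (intro form) auto
  moreover have "edge_form (parcs G) x = (\<Sum>m<n. d m * (c' m)\<^sup>2)"
    unfolding P(1) using coord by (intro sum.cong) auto
  moreover have n2: "(\<Sum>i<n. (x i)\<^sup>2) = (\<Sum>m<n. (c' m)\<^sup>2)"
    unfolding P(2)[of x] using coord by (intro sum.cong) auto
  moreover have "?l * (\<Sum>m<n. (c' m)\<^sup>2) \<le> (\<Sum>m<n. d m * (c' m)\<^sup>2)"
    unfolding sum_distrib_left
    by (intro sum_mono) (auto simp: c'_def I_def intro!: mult_right_mono)
  ultimately have "?l * (\<Sum>m<n. (c' m)\<^sup>2) \<le> \<mu> * (\<Sum>m<n. (c' m)\<^sup>2)" by simp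
  moreover have "(\<Sum>m<n. (c' m)\<^sup>2) > 0"
    using c(1) I by (auto simp: c'_def intro!: sum_pos2)
  ultimately show ?thesis by simp
qed

text \<open>
  Fewer than \<open>k\<close> eigenvalues exceed \<open>\<lambda>\<^sub>k\<close>, so some nonzero combination of \<open>k\<close> independent vectors is
  orthogonal to their eigenvectors; on it the form is at most \<open>\<lambda>\<^sub>k |x|\<^sup>2\<close>.
\<close>

lemma lambda_ge_of_form_ge:
  fixes y :: "nat \<Rightarrow> nat \<Rightarrow> real"
  assumes G: "graph_on n G" and k: "1 \<le> k" "k \<le> n"
    and form: "\<And>a. \<mu> * (\<Sum>i<n. (\<Sum>j<k. a j * y j i)\<^sup>2) \<le> edge_form (parcs G) (\<lambda>i. \<Sum>j<k. a j * y j i)"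
    and indep: "\<And>a. \<exists>j<k. a j \<noteq> 0 \<Longrightarrow> \<exists>i<n. (\<Sum>j<k. a j * y j i) \<noteq> 0"
  shows "\<mu> \<le> lambda k n G"
proof -
  obtain P d where P: "\<And>x. edge_form (parcs G) x = (\<Sum>m<n. d m * (\<Sum>i<n. P i m * x i)\<^sup>2)"
    "\<And>x. (\<Sum>i<n. (x i)\<^sup>2) = (\<Sum>m<n. (\<Sum>i<n. P i m * x i)\<^sup>2)"
    and "\<And>c m. m < n \<Longrightarrow> (\<Sum>i<n. P i m * (\<Sum>l<n. P i l * c l)) = c m"
    and "k \<le> card {m. m < n \<and> lambda k n G \<le> d m}"
    and small: "card {m. m < n \<and> lambda k n G < d m} < k"
    by (rule adjacency_eigenbasis[OF G k]) (rule that)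
  let ?l = "lambda k n G"
  define J where "J = {m. m < n \<and> ?l < d m}"
  have "finite J" "card J < card {..<k}" using small by (auto simp: J_def)
  from homogeneous_system_solution[OF this(1) _ this(2), of "\<lambda>m j. \<Sum>i<n. P i m * y j i"] obtain a where
    a: "\<exists>j \<in> {..<k}. a j \<noteq> 0" "\<forall>m \<in> J. (\<Sum>j<k. (\<Sum>i<n. P i m * y j i) * a j) = 0" by auto
  define x where "x i = (\<Sum>j<k. a j * y j i)" for i
  have "(\<Sum>i<n. P i m * x i) = (\<Sum>j<k. (\<Sum>i<n. P i m * y j i) * a j)" for m
    unfolding x_def sum_distrib_left sum_distrib_right by (subst sum.swap) (simp add: mult_ac)
  then have zero: "(\<Sum>i<n. P i m * x i) = 0" if "m \<in> J" for m using a(2) that by simp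
  have "edge_form (parcs G) x \<le> (\<Sum>m<n. ?l * (\<Sum>i<n. P i m * x i)\<^sup>2)"
    unfolding P(1)
  proof (rule sum_mono)
    fix m assume "m \<in> {..<n}"
    then show "d m * (\<Sum>i<n. P i m * x i)\<^sup>2 \<le> ?l * (\<Sum>i<n. P i m * x i)\<^sup>2"
      using zero[of m] by (cases "m \<in> J") (auto simp: J_def intro!: mult_right_mono)
  qed
  then have "edge_form (parcs G) x \<le> ?l * (\<Sum>i<n. (x i)\<^sup>2)"
    unfolding P(2)[of x] sum_distrib_left .
  moreover have "\<mu> * (\<Sum>i<n. (x i)\<^sup>2) \<le> edge_form (parcs G) x"
    using form[of a] by (simp add: x_def)
  moreover have "\<exists>i<n. x i \<noteq> 0" using indep[of a] a(1) by (auto simp: x_def)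
  then have "(\<Sum>i<n. (x i)\<^sup>2) > 0" by (auto intro!: sum_pos2)
  ultimately show ?thesis by (smt (verit) mult_right_mono mult_less_cancel_right_pos)
qed

section \<open>Quadratic forms of graphs with few hubs\<close>

lemma sum_edges_between:
  assumes "finite A" "finite B"
  shows "(\<Sum>(u, v) \<in> E \<inter> A \<times> B. g u v) = (\<Sum>u \<in> A. \<Sum>v \<in> E `` {u} \<inter> B. (g u v :: real))"
proof -
  have "E \<inter> A \<times> B = Sigma A (\<lambda>u. E `` {u} \<inter> B)" by auto
  then show ?thesis using assms by (simp add: sum.Sigma)
qed

lemma sum_edges_swap:
  assumes "finite A" "finite B"
  shows "(\<Sum>u \<in> A. \<Sum>v \<in> E `` {u} \<inter> B. (g u v :: real)) = (\<Sum>v \<in> B. \<Sum>u \<in> E\<inverse> `` {v} \<inter> A. g u v)"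
proof -
  have "(\<Sum>u \<in> A. \<Sum>v \<in> E `` {u} \<inter> B. g u v) = (\<Sum>u \<in> A. \<Sum>v \<in> B. if (u, v) \<in> E then g u v else 0)"
    using assms by (intro sum.cong sum.mono_neutral_cong_left) auto
  also have "\<dots> = (\<Sum>v \<in> B. \<Sum>u \<in> A. if (u, v) \<in> E then g u v else 0)"
    by (rule sum.swap)
  also have "\<dots> = (\<Sum>v \<in> B. \<Sum>u \<in> E\<inverse> `` {v} \<inter> A. g u v)"
    using assms by (intro sum.cong sum.mono_neutral_cong_right) auto
  finally show ?thesis .
qed

lemma two_products_le_weighted_squares:
  fixes a b t :: real
  assumes "t > 0"
  shows "2 * (a * b) \<le> t * a\<^sup>2 + (1 / t) * b\<^sup>2"
proof -
  have "0 \<le> (t * a - b)\<^sup>2 / t" using assms by simp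
  also have "\<dots> = t * a\<^sup>2 + (1 / t) * b\<^sup>2 - 2 * (a * b)"
    using assms by (simp add: field_simps power2_eq_square)
  finally show ?thesis by simp
qed

text \<open>
  The edge from \<open>u\<close> to \<open>v\<close> is charged to its ends with weights \<open>t u v\<close> and \<open>1 / t u v\<close>, so the
  load on each vertex bounds the form.
\<close>

lemma cross_form_le:
  assumes fin: "finite A" "finite B" and t: "\<And>u v. u \<in> A \<Longrightarrow> v \<in> B \<Longrightarrow> (u, v) \<in> E \<Longrightarrow> t u v > 0"
  shows "2 * edge_form (E \<inter> A \<times> B) x \<le>
     (\<Sum>u \<in> A. (\<Sum>v \<in> E `` {u} \<inter> B. t u v) * (x u)\<^sup>2) +
     (\<Sum>v \<in> B. (\<Sum>u \<in> E\<inverse> `` {v} \<inter> A. 1 / t u v) * (x v)\<^sup>2)"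
proof -
  have "2 * edge_form (E \<inter> A \<times> B) x = (\<Sum>u \<in> A. \<Sum>v \<in> E `` {u} \<inter> B. 2 * (x u * x v))"
    by (simp add: sum_edges_between[OF fin] sum_distrib_left)
  also have "\<dots> \<le> (\<Sum>u \<in> A. \<Sum>v \<in> E `` {u} \<inter> B. t u v * (x u)\<^sup>2 + (1 / t u v) * (x v)\<^sup>2)"
    using t by (intro sum_mono two_products_le_weighted_squares) auto
  also have "\<dots> = (\<Sum>u \<in> A. \<Sum>v \<in> E `` {u} \<inter> B. t u v * (x u)\<^sup>2) +
      (\<Sum>u \<in> A. \<Sum>v \<in> E `` {u} \<inter> B. (1 / t u v) * (x v)\<^sup>2)"
    by (simp only: sum.distrib)
  also have "(\<Sum>u \<in> A. \<Sum>v \<in> E `` {u} \<inter> B. (1 / t u v) * (x v)\<^sup>2) =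
      (\<Sum>v \<in> B. \<Sum>u \<in> E\<inverse> `` {v} \<inter> A. (1 / t u v) * (x v)\<^sup>2)"
    by (rule sum_edges_swap[OF fin])
  finally show ?thesis by (simp only: sum_distrib_right)
qed

lemma form_within_le:
  assumes fin: "finite A" and sym: "sym E"
  shows "edge_form (E \<inter> A \<times> A) x \<le> (\<Sum>u \<in> A. real (card (E `` {u} \<inter> A)) * (x u)\<^sup>2)"
proof -
  have inv: "E\<inverse> = E" using sym by (rule sym_conv_converse_eq[THEN iffD1])
  have "2 * edge_form (E \<inter> A \<times> A) x \<le> 2 * (\<Sum>u \<in> A. real (card (E `` {u} \<inter> A)) * (x u)\<^sup>2)"
    using cross_form_le[OF fin fin, of E "\<lambda>_ _. 1" x] unfolding inv by simp
  then show ?thesis by simp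
qed

lemma edge_form_Un:
  assumes "finite X" "finite Y" "X \<inter> Y = {}"
  shows "edge_form (X \<union> Y) x = edge_form X x + edge_form Y x"
  using assms by (rule sum.union_disjoint)

lemma edge_form_converse: "edge_form (X\<inverse>) x = edge_form X x"
  by (rule sum.reindex_bij_witness[of _ prod.swap prod.swap]) (auto simp: mult.commute)

lemma form_split:
  assumes fin: "finite A" "finite B" and disj: "A \<inter> B = {}" and sym: "sym E"
  shows "edge_form (E \<inter> (A \<union> B) \<times> (A \<union> B)) x =
    edge_form (E \<inter> A \<times> A) x + 2 * edge_form (E \<inter> A \<times> B) x + edge_form (E \<inter> B \<times> B) x"
proof -
  have inv: "(E \<inter> A \<times> B)\<inverse> = E \<inter> B \<times> A"
    using sym by (auto dest: symD)
  have f: "finite (E \<inter> X \<times> Y)" if "finite X" "finite Y" for X Y using that by simp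
  have "E \<inter> (A \<union> B) \<times> (A \<union> B) = ((E \<inter> A \<times> A) \<union> (E \<inter> A \<times> B)) \<union> ((E \<inter> B \<times> A) \<union> (E \<inter> B \<times> B))"
    by blast
  also have "edge_form \<dots> x = edge_form ((E \<inter> A \<times> A) \<union> (E \<inter> A \<times> B)) x + edge_form ((E \<inter> B \<times> A) \<union> (E \<inter> B \<times> B)) x"
    using f fin disj by (intro edge_form_Un) auto
  also have "edge_form ((E \<inter> A \<times> A) \<union> (E \<inter> A \<times> B)) x = edge_form (E \<inter> A \<times> A) x + edge_form (E \<inter> A \<times> B) x"
    using f fin disj by (intro edge_form_Un) auto
  also have "edge_form ((E \<inter> B \<times> A) \<union> (E \<inter> B \<times> B)) x = edge_form (E \<inter> B \<times> A) x + edge_form (E \<inter> B \<times> B) x"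
    using f fin disj by (intro edge_form_Un) auto
  finally have "edge_form (E \<inter> (A \<union> B) \<times> (A \<union> B)) x =
      edge_form (E \<inter> A \<times> A) x + edge_form (E \<inter> A \<times> B) x + (edge_form (E \<inter> B \<times> A) x + edge_form (E \<inter> B \<times> B) x)" .
  then show ?thesis using edge_form_converse[where X = "E \<inter> A \<times> B" and x = x] unfolding inv by simp
qed

text \<open>
  Suppose the edges within \<open>T\<close> put load \<open>f u\<close> on a non-hub \<open>u\<close>. What remains of its budget \<open>\<mu>\<close> is
  divided evenly among the hubs next to it, so an edge from \<open>u\<close> to a hub is charged with
  \<open>(\<mu> - f u) / m\<close> to \<open>u\<close> and with the reciprocal to the hub, where \<open>m\<close> is the number of these hubs.
  The last hypothesis says that the resulting load on every hub is within budget.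
\<close>

lemma hub_form_bound:
  assumes fin: "finite L" "finite T" and disj: "L \<inter> T = {}" and sym: "sym E"
    and T: "edge_form (E \<inter> T \<times> T) x \<le> (\<Sum>u \<in> T. f u * (x u)\<^sup>2)"
    and f: "\<And>u. u \<in> T \<Longrightarrow> f u < \<mu>"
    and hub: "\<And>h. h \<in> L \<Longrightarrow>
      (\<Sum>u \<in> E `` {h} \<inter> T. real (card (E `` {u} \<inter> L)) / (\<mu> - f u)) + real (card (E `` {h} \<inter> L)) \<le> \<mu>"
  shows "edge_form (E \<inter> (L \<union> T) \<times> (L \<union> T)) x \<le> \<mu> * (\<Sum>u \<in> L \<union> T. (x u)\<^sup>2)"
proof -
  have inv: "E\<inverse> = E" using sym by (rule sym_conv_converse_eq[THEN iffD1])
  define m where "m u = real (card (E `` {u} \<inter> L))" for u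
  let ?t = "\<lambda>h u. m u / (\<mu> - f u)"
  have mpos: "m u > 0" if "h \<in> L" "(h, u) \<in> E" for h u
  proof -
    have "h \<in> E `` {u} \<inter> L" using that sym by (auto dest: symD)
    then show ?thesis unfolding m_def using fin by (auto simp: card_gt_0_iff)
  qed
  have "2 * edge_form (E \<inter> L \<times> T) x \<le>
     (\<Sum>h \<in> L. (\<Sum>u \<in> E `` {h} \<inter> T. ?t h u) * (x h)\<^sup>2) +
     (\<Sum>u \<in> T. (\<Sum>h \<in> E\<inverse> `` {u} \<inter> L. 1 / ?t h u) * (x u)\<^sup>2)"
    using mpos f by (intro cross_form_le fin) auto
  also have "(\<Sum>u \<in> T. (\<Sum>h \<in> E\<inverse> `` {u} \<inter> L. 1 / ?t h u) * (x u)\<^sup>2) \<le> (\<Sum>u \<in> T. (\<mu> - f u) * (x u)\<^sup>2)"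
  proof (intro sum_mono mult_right_mono)
    fix u assume u: "u \<in> T"
    have "(\<Sum>h \<in> E\<inverse> `` {u} \<inter> L. 1 / ?t h u) = m u * ((\<mu> - f u) / m u)"
      unfolding inv by (simp add: m_def)
    also have "\<dots> \<le> \<mu> - f u" using f[OF u] by (cases "m u = 0") auto
    finally show "(\<Sum>h \<in> E\<inverse> `` {u} \<inter> L. 1 / ?t h u) \<le> \<mu> - f u" .
  qed simp
  finally have LT: "2 * edge_form (E \<inter> L \<times> T) x \<le>
     (\<Sum>h \<in> L. (\<Sum>u \<in> E `` {h} \<inter> T. ?t h u) * (x h)\<^sup>2) + (\<Sum>u \<in> T. (\<mu> - f u) * (x u)\<^sup>2)"
    by simp
  have LL: "edge_form (E \<inter> L \<times> L) x \<le> (\<Sum>h \<in> L. real (card (E `` {h} \<inter> L)) * (x h)\<^sup>2)"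
    by (rule form_within_le[OF fin(1) sym])
  have "edge_form (E \<inter> (L \<union> T) \<times> (L \<union> T)) x \<le>
      (\<Sum>h \<in> L. real (card (E `` {h} \<inter> L)) * (x h)\<^sup>2) +
      ((\<Sum>h \<in> L. (\<Sum>u \<in> E `` {h} \<inter> T. ?t h u) * (x h)\<^sup>2) + (\<Sum>u \<in> T. (\<mu> - f u) * (x u)\<^sup>2)) +
      (\<Sum>u \<in> T. f u * (x u)\<^sup>2)"
    unfolding form_split[OF fin disj sym] by (intro add_mono LT LL T)
  also have "\<dots> = (\<Sum>h \<in> L. ((\<Sum>u \<in> E `` {h} \<inter> T. ?t h u) + real (card (E `` {h} \<inter> L))) * (x h)\<^sup>2) +
      (\<Sum>u \<in> T. \<mu> * (x u)\<^sup>2)"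
    by (simp add: left_diff_distrib distrib_right sum.distrib sum_subtractf)
  also have "\<dots> \<le> (\<Sum>h \<in> L. \<mu> * (x h)\<^sup>2) + (\<Sum>u \<in> T. \<mu> * (x u)\<^sup>2)"
    using hub unfolding m_def by (intro add_right_mono sum_mono mult_right_mono) auto
  also have "\<dots> = \<mu> * (\<Sum>u \<in> L \<union> T. (x u)\<^sup>2)"
    using fin disj by (simp add: sum.union_disjoint sum_distrib_left distrib_left)
  finally show ?thesis .
qed

text \<open>
  The properties of outerplanar graphs on which all spectral upper bounds rest. The orientation
  \<open>F\<close> may contain an edge in both directions.
\<close>

locale thin_graph =
  fixes n :: nat and E F :: "(nat \<times> nat) set"
  assumes E_sub: "E \<subseteq> {..<n} \<times> {..<n}"
    and E_sym: "sym E" and E_irrefl: "irrefl E"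
    and codegree: "u \<noteq> v \<Longrightarrow> card (E `` {u} \<inter> E `` {v}) \<le> 2"
    and F_sub: "F \<subseteq> E" and F_orients: "E \<subseteq> F \<union> F\<inverse>"
    and F_out: "card (F `` {v}) \<le> 4"
begin

definition deg :: "nat \<Rightarrow> nat" where "deg v = card (E `` {v})"

lemma E_finite: "finite E" using E_sub by (rule finite_subset) simp
lemma F_finite: "finite F" using F_sub E_finite by (rule finite_subset)
lemma nbrs_finite [simp]: "finite (E `` {v})" using E_finite by (rule finite_Image)
lemma F_nbrs_finite [simp]: "finite (F `` {v})" using F_finite by (rule finite_Image)
lemma E_conv: "E\<inverse> = E" using E_sym by (rule sym_conv_converse_eq[THEN iffD1])
lemma nbrs_sub: "E `` {v} \<subseteq> {..<n}" using E_sub by auto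

lemma sum_deg: "(\<Sum>v<n. real (deg v)) \<le> 8 * n"
proof -
  have "F \<subseteq> Sigma {..<n} (\<lambda>v. F `` {v})" using F_sub E_sub by auto
  then have "card F \<le> card (Sigma {..<n} (\<lambda>v. F `` {v}))" by (rule card_mono[rotated]) auto
  also have "\<dots> = (\<Sum>v<n. card (F `` {v}))" by (simp add: card_SigmaI)
  also have "\<dots> \<le> (\<Sum>v<n. 4)" using F_out by (intro sum_mono)
  finally have F: "card F \<le> 4 * n" by simp
  have "E = Sigma {..<n} (\<lambda>v. E `` {v})" using E_sub by auto
  then have "card E = card (Sigma {..<n} (\<lambda>v. E `` {v}))" by simp
  also have "\<dots> = (\<Sum>v<n. deg v)" by (simp add: card_SigmaI deg_def)
  finally have "(\<Sum>v<n. deg v) = card E" by simp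
  also have "\<dots> \<le> card (F \<union> F\<inverse>)" using F_orients F_finite by (intro card_mono) auto
  also have "\<dots> \<le> card F + card (F\<inverse>)" by (rule card_Un_le)
  also have "\<dots> \<le> 8 * n" using F by (simp add: card_inverse)
  finally have "(\<Sum>v<n. deg v) \<le> 8 * n" .
  then have "real (\<Sum>v<n. deg v) \<le> real (8 * n)" by (rule of_nat_mono)
  then show ?thesis by simp
qed

lemma sum_sqrt_deg: "A \<subseteq> {..<n} \<Longrightarrow> (\<Sum>v \<in> A. sqrt (deg v)) \<le> 8 * n"
proof -
  assume A: "A \<subseteq> {..<n}"
  have "(\<Sum>v \<in> A. sqrt (deg v)) \<le> (\<Sum>v<n. sqrt (deg v))"
    using A by (intro sum_mono2) auto
  also have "\<dots> \<le> (\<Sum>v<n. real (deg v))"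
  proof (rule sum_mono)
    fix v
    show "sqrt (deg v) \<le> deg v"
      by (cases "deg v = 0") (auto intro!: real_le_lsqrt simp: power2_eq_square)
  qed
  finally show ?thesis using sum_deg by simp
qed

text \<open>
  The load on \<open>u\<close> when an edge oriented from \<open>u\<close> to \<open>v\<close> is charged with \<open>\<surd>(deg v)\<close> to \<open>u\<close> and with
  \<open>1 / \<surd>(deg v)\<close> to \<open>v\<close>. The incoming edges, of which there are at most \<open>deg u\<close>, cost \<open>u\<close> at most
  \<open>\<surd>(deg u)\<close> together.
\<close>

definition outload :: "nat set \<Rightarrow> nat \<Rightarrow> real" where
  "outload A u = sqrt (deg u) + (\<Sum>v \<in> F `` {u} \<inter> A. sqrt (deg v))"

lemma form_le_outload:
  assumes fin: "finite A"
  shows "edge_form (E \<inter> A \<times> A) x \<le> (\<Sum>u \<in> A. outload A u * (x u)\<^sup>2)"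
proof -
  let ?y = "\<lambda>u. \<bar>x u\<bar>"
  have dpos: "deg v > 0" if "(u, v) \<in> F" for u v
  proof -
    have "u \<in> E `` {v}" using that F_sub E_sym by (auto dest: symD)
    then show ?thesis unfolding deg_def by (auto simp: card_gt_0_iff)
  qed
  have conv: "(F \<inter> A \<times> A)\<inverse> = F\<inverse> \<inter> A \<times> A" by auto
  have finF: "finite (F \<inter> A \<times> A)" "finite (F\<inverse> \<inter> A \<times> A)" using F_finite by auto
  have "edge_form (E \<inter> A \<times> A) x \<le> edge_form (E \<inter> A \<times> A) ?y"
    by (intro sum_mono) (auto simp: abs_mult[symmetric])
  also have "\<dots> \<le> edge_form ((F \<inter> A \<times> A) \<union> (F\<inverse> \<inter> A \<times> A)) ?y"
    using F_orients finF by (intro sum_mono2) auto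
  also have "\<dots> \<le> edge_form (F \<inter> A \<times> A) ?y + edge_form (F\<inverse> \<inter> A \<times> A) ?y"
    using finF by (subst sum.union_inter[symmetric]) (auto intro!: sum_nonneg)
  also have "\<dots> = 2 * edge_form (F \<inter> A \<times> A) ?y"
    using edge_form_converse[where X = "F \<inter> A \<times> A" and x = ?y] unfolding conv by simp
  also have "\<dots> \<le> (\<Sum>u \<in> A. (\<Sum>v \<in> F `` {u} \<inter> A. sqrt (deg v)) * (?y u)\<^sup>2) +
      (\<Sum>v \<in> A. (\<Sum>u \<in> F\<inverse> `` {v} \<inter> A. 1 / sqrt (deg v)) * (?y v)\<^sup>2)"
    using dpos by (intro cross_form_le fin) auto
  also have "(\<Sum>v \<in> A. (\<Sum>u \<in> F\<inverse> `` {v} \<inter> A. 1 / sqrt (deg v)) * (?y v)\<^sup>2) \<le> (\<Sum>v \<in> A. sqrt (deg v) * (?y v)\<^sup>2)"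
  proof (intro sum_mono mult_right_mono)
    fix v
    have "card (F\<inverse> `` {v} \<inter> A) \<le> deg v"
      unfolding deg_def using F_sub E_sym by (intro card_mono) (auto dest: symD)
    then have "real (card (F\<inverse> `` {v} \<inter> A)) / sqrt (deg v) \<le> deg v / sqrt (deg v)"
      by (intro divide_right_mono) auto
    then show "(\<Sum>u \<in> F\<inverse> `` {v} \<inter> A. 1 / sqrt (deg v)) \<le> sqrt (deg v)"
      by (simp add: real_div_sqrt)
  qed simp
  finally show ?thesis by (simp add: outload_def distrib_right sum.distrib)
qed

lemma outload_nonneg: "outload A u \<ge> 0"
  unfolding outload_def by (intro add_nonneg_nonneg sum_nonneg) auto

lemma outload_le:
  assumes "\<And>v. v \<in> A \<Longrightarrow> real (deg v) \<le> b\<^sup>2" "u \<in> A" "b \<ge> 0"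
  shows "outload A u \<le> 5 * b"
proof -
  have s: "sqrt (deg v) \<le> b" if "v \<in> A" for v
    using assms(1)[OF that] assms(3) by (rule real_le_lsqrt[rotated]) 
  have "(\<Sum>v \<in> F `` {u} \<inter> A. sqrt (deg v)) \<le> (\<Sum>v \<in> F `` {u} \<inter> A. b)"
    using s by (intro sum_mono) auto
  also have "\<dots> = card (F `` {u} \<inter> A) * b" by simp
  also have "\<dots> \<le> 4 * b"
  proof (intro mult_right_mono assms)
    have "card (F `` {u} \<inter> A) \<le> card (F `` {u})" by (intro card_mono) auto
    then show "real (card (F `` {u} \<inter> A)) \<le> 4" using F_out[of u] by linarith
  qed
  finally show ?thesis unfolding outload_def using s[OF assms(2)] by simp
qed

text \<open>
  A vertex \<open>v\<close> other than \<open>h\<close> is counted by at most two of the neighbours of \<open>h\<close>, as these are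
  common neighbours of \<open>v\<close> and \<open>h\<close>. So the sum is of the order of the sum of all degrees.
\<close>

lemma sum_outload_nbrs:
  assumes A: "A \<subseteq> {..<n}" and h: "h \<notin> A"
  shows "(\<Sum>u \<in> E `` {h} \<inter> A. outload A u) \<le> 24 * n"
proof -
  have finA: "finite A" using A by (rule finite_subset) simp
  have "(\<Sum>u \<in> E `` {h} \<inter> A. \<Sum>v \<in> F `` {u} \<inter> A. sqrt (deg v)) \<le>
      (\<Sum>u \<in> E `` {h} \<inter> A. \<Sum>v \<in> E `` {u} \<inter> A. sqrt (deg v))"
    using F_sub finA by (intro sum_mono sum_mono2) auto
  also have "\<dots> = (\<Sum>v \<in> A. \<Sum>u \<in> E\<inverse> `` {v} \<inter> (E `` {h} \<inter> A). sqrt (deg v))"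
    using finA by (intro sum_edges_swap) auto
  also have "\<dots> \<le> (\<Sum>v \<in> A. 2 * sqrt (deg v))"
  proof (rule sum_mono)
    fix v assume v: "v \<in> A"
    have "card (E `` {v} \<inter> (E `` {h} \<inter> A)) \<le> card (E `` {v} \<inter> E `` {h})"
      by (intro card_mono) auto
    also have "\<dots> \<le> 2" using v h by (intro codegree) auto
    finally have "real (card (E `` {v} \<inter> (E `` {h} \<inter> A))) \<le> 2" by linarith
    then have "real (card (E `` {v} \<inter> (E `` {h} \<inter> A))) * sqrt (deg v) \<le> 2 * sqrt (deg v)"
      by (intro mult_right_mono) auto
    then show "(\<Sum>u \<in> E\<inverse> `` {v} \<inter> (E `` {h} \<inter> A). sqrt (deg v)) \<le> 2 * sqrt (deg v)"
      unfolding E_conv by simp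
  qed
  also have "\<dots> \<le> 16 * n" using sum_sqrt_deg[OF A] by (simp add: sum_distrib_left[symmetric])
  finally have "(\<Sum>u \<in> E `` {h} \<inter> A. \<Sum>v \<in> F `` {u} \<inter> A. sqrt (deg v)) \<le> 16 * n" .
  moreover have "(\<Sum>u \<in> E `` {h} \<inter> A. sqrt (deg u)) \<le> 8 * n"
    using A by (intro sum_sqrt_deg) auto
  ultimately show ?thesis unfolding outload_def by (simp add: sum.distrib)
qed

end

section \<open>Bounds in terms of the hub degrees\<close>

lemma inverse_gap_le:
  fixes \<mu> f :: real
  assumes "0 \<le> f" "f \<le> \<mu> / 2" "0 < \<mu>"
  shows "1 / (\<mu> - f) \<le> 2 / \<mu>" "1 / (\<mu> - f) \<le> 1 / \<mu> + 2 * f / \<mu>\<^sup>2"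
    "1 / (\<mu> - f) \<le> 1 / \<mu> + f / \<mu>\<^sup>2 + 2 * f\<^sup>2 / \<mu>^3"
proof -
  have pos: "\<mu> - f > 0" using assms by linarith
  show 1: "1 / (\<mu> - f) \<le> 2 / \<mu>" using assms pos by (simp add: field_simps)
  have "1 / (\<mu> - f) = 1 / \<mu> + (f / \<mu>) * (1 / (\<mu> - f))"
    using assms pos by (simp add: field_simps)
  also have "\<dots> \<le> 1 / \<mu> + (f / \<mu>) * (2 / \<mu>)"
    using assms by (intro add_left_mono mult_left_mono 1) auto
  finally show "1 / (\<mu> - f) \<le> 1 / \<mu> + 2 * f / \<mu>\<^sup>2" by (simp add: power2_eq_square mult_ac)
  have "1 / (\<mu> - f) = 1 / \<mu> + f / \<mu>\<^sup>2 + (f\<^sup>2 / \<mu>\<^sup>2) * (1 / (\<mu> - f))"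
    using assms pos by (simp add: field_simps power2_eq_square)
  also have "\<dots> \<le> 1 / \<mu> + f / \<mu>\<^sup>2 + (f\<^sup>2 / \<mu>\<^sup>2) * (2 / \<mu>)"
    using assms by (intro add_left_mono mult_left_mono 1) auto
  finally show "1 / (\<mu> - f) \<le> 1 / \<mu> + f / \<mu>\<^sup>2 + 2 * f\<^sup>2 / \<mu>^3"
    by (simp add: power2_eq_square power3_eq_cube mult_ac)
qed

context thin_graph begin

lemma form_restrict:
  assumes "\<And>v. v \<in> S \<Longrightarrow> x v = 0"
  shows "edge_form (E \<inter> ({..<n} - S) \<times> ({..<n} - S)) x = edge_form E x"
    "(\<Sum>v \<in> {..<n} - S. (x v)\<^sup>2) = (\<Sum>v<n. (x v)\<^sup>2)"
proof -
  show "edge_form (E \<inter> ({..<n} - S) \<times> ({..<n} - S)) x = edge_form E x"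
    using E_finite E_sub assms by (intro sum.mono_neutral_left) auto
  show "(\<Sum>v \<in> {..<n} - S. (x v)\<^sup>2) = (\<Sum>v<n. (x v)\<^sup>2)"
    using assms by (intro sum.mono_neutral_left) auto
qed

text \<open>
  Vertices of degree above \<open>\<delta> n / 100\<close> serve as hubs; there are at most \<open>800 / \<delta>\<close> of them. All other
  vertices carry a load of at most \<open>\<mu> / 2\<close>, so a hub pays \<open>1 / \<mu>\<close> for each neighbour, which adds
  up to \<open>\<surd>D\<close>, and a correction that is bounded in terms of \<open>\<delta>\<close>.
\<close>

lemma form_bound_of_max_degree:
  fixes \<delta> D :: real
  assumes \<delta>: "0 < \<delta>" "\<delta> \<le> 1" and n: "0 < n" and D: "\<delta> * n \<le> D"
    and deg: "\<And>v. v < n \<Longrightarrow> v \<notin> S \<Longrightarrow> real (deg v) \<le> D"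
    and x: "\<And>v. v \<in> S \<Longrightarrow> x v = 0"
  shows "edge_form E x \<le> (sqrt D + 5000 / \<delta>) * (\<Sum>v<n. (x v)\<^sup>2)"
proof -
  define \<mu> where "\<mu> = sqrt D + 5000 / \<delta>"
  define L where "L = {v \<in> {..<n} - S. real (deg v) > \<delta> / 100 * n}"
  define T where "T = ({..<n} - S) - L"
  have LT: "L \<union> T = {..<n} - S" "L \<inter> T = {}" "finite L" "finite T" "L \<subseteq> {..<n}" "T \<subseteq> {..<n}"
    by (auto simp: L_def T_def)
  have "\<delta> * n > 0" using \<delta> n by simp
  then have Dpos: "D > 0" using D by linarith
  have "5000 \<le> 5000 / \<delta>" using \<delta> by (simp add: field_simps)
  then have mu: "\<mu> \<ge> 1" "\<mu> \<ge> sqrt D" "\<mu> > 0"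
    using real_sqrt_gt_zero[OF Dpos] unfolding \<mu>_def by linarith+
  have mu2: "\<delta> * n \<le> \<mu>\<^sup>2"
  proof -
    have "D = (sqrt D)\<^sup>2" using Dpos by simp
    also have "\<dots> \<le> \<mu>\<^sup>2" using mu Dpos by (intro power_mono) auto
    finally show ?thesis using D by simp
  qed
  have cardL: "real (card L) \<le> 800 / \<delta>"
  proof -
    have "card L * (\<delta> / 100 * n) = (\<Sum>v \<in> L. \<delta> / 100 * n)" by simp
    also have "\<dots> \<le> (\<Sum>v \<in> L. real (deg v))" by (intro sum_mono) (auto simp: L_def)
    also have "\<dots> \<le> (\<Sum>v<n. real (deg v))" using LT by (intro sum_mono2) auto
    also have "\<dots> \<le> 8 * n" by (rule sum_deg)
    finally have "card L * (\<delta> / 100) * n \<le> 8 * n" by (simp add: mult.assoc)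
    then have "card L * (\<delta> / 100) \<le> 8" using n by simp
    then show ?thesis using \<delta> by (simp add: field_simps)
  qed
  have f: "outload T u \<le> \<mu> / 2" if "u \<in> T" for u
  proof -
    have "outload T u \<le> 5 * (sqrt (\<delta> * n) / 10)"
    proof (rule outload_le[OF _ that])
      fix v assume "v \<in> T"
      then have "real (deg v) \<le> \<delta> / 100 * n" by (auto simp: T_def L_def)
      also have "\<dots> = (sqrt (\<delta> * n) / 10)\<^sup>2" using \<delta> by (simp add: power_divide)
      finally show "real (deg v) \<le> (sqrt (\<delta> * n) / 10)\<^sup>2" .
    qed (use \<delta> in auto)
    moreover have "sqrt (\<delta> * n) \<le> \<mu>" using mu2 mu by (intro real_le_lsqrt) auto
    ultimately show ?thesis by simp
  qed
  have hub: "(\<Sum>u \<in> E `` {h} \<inter> T. real (card (E `` {u} \<inter> L)) / (\<mu> - outload T u)) + real (card (E `` {h} \<inter> L)) \<le> \<mu>"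
    if h: "h \<in> L" for h
  proof -
    let ?N = "E `` {h} \<inter> T"
    have finN: "finite ?N" by simp
    \<comment> \<open>Only a neighbour of \<open>h\<close> that is next to another hub as well costs more than \<open>1 / (\<mu> - f u)\<close>; codegrees bound the excess.\<close>
    have m: "card (E `` {u} \<inter> L) = Suc (card (E `` {u} \<inter> (L - {h})))" if "u \<in> ?N" for u
    proof -
      have "E `` {u} \<inter> L = insert h (E `` {u} \<inter> (L - {h}))"
        using that h E_sym by (auto dest: symD)
      then show ?thesis using LT by simp
    qed
    have "(\<Sum>u \<in> ?N. real (card (E `` {u} \<inter> L)) / (\<mu> - outload T u)) \<le>
        (\<Sum>u \<in> ?N. 1 / \<mu> + 2 * outload T u / \<mu>\<^sup>2 + 2 * real (card (E `` {u} \<inter> (L - {h}))))"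
    proof (rule sum_mono)
      fix u assume u: "u \<in> ?N"
      then have fu: "0 \<le> outload T u" "outload T u \<le> \<mu> / 2" using f outload_nonneg by auto
      let ?c = "real (card (E `` {u} \<inter> (L - {h})))"
      have "1 / (\<mu> - outload T u) \<le> 2" 
      proof -
        have "2 / \<mu> \<le> 2 / 1" using mu by (intro divide_left_mono) auto
        then show ?thesis using inverse_gap_le(1)[OF fu mu(3)] by simp
      qed
      then have "?c * (1 / (\<mu> - outload T u)) \<le> ?c * 2" by (intro mult_left_mono) auto
      moreover have "real (card (E `` {u} \<inter> L)) / (\<mu> - outload T u) =
          1 / (\<mu> - outload T u) + ?c * (1 / (\<mu> - outload T u))"
        unfolding m[OF u] by (simp add: add_divide_distrib)
      ultimately show "real (card (E `` {u} \<inter> L)) / (\<mu> - outload T u) \<le>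
          1 / \<mu> + 2 * outload T u / \<mu>\<^sup>2 + 2 * ?c"
        using inverse_gap_le(2)[OF fu mu(3)] by linarith
    qed
    also have "\<dots> = card ?N / \<mu> + 2 / \<mu>\<^sup>2 * (\<Sum>u \<in> ?N. outload T u) + 2 * (\<Sum>u \<in> ?N. real (card (E `` {u} \<inter> (L - {h}))))"
      by (simp add: sum.distrib sum_distrib_left)
    also have "card ?N / \<mu> \<le> sqrt D"
    proof -
      have "card ?N \<le> deg h" unfolding deg_def by (intro card_mono) auto
      moreover have "real (deg h) \<le> D" using h by (intro deg) (auto simp: L_def)
      ultimately have "card ?N \<le> D" by linarith
      then have "card ?N / \<mu> \<le> D / sqrt D" using mu Dpos by (intro frac_le) auto
      then show ?thesis using Dpos by (simp add: real_div_sqrt)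
    qed
    also have "2 / \<mu>\<^sup>2 * (\<Sum>u \<in> ?N. outload T u) \<le> 48 / \<delta>"
    proof -
      have "2 / \<mu>\<^sup>2 * (\<Sum>u \<in> ?N. outload T u) \<le> 2 / (\<delta> * n) * (24 * n)"
        using mu2 \<delta> n LT h by (intro mult_mono sum_outload_nbrs frac_le sum_nonneg outload_nonneg) auto
      also have "\<dots> = 48 / \<delta>" using n by simp
      finally show ?thesis .
    qed
    also have "(\<Sum>u \<in> ?N. real (card (E `` {u} \<inter> (L - {h})))) \<le> 2 * real (card L)"
    proof -
      have "(\<Sum>u \<in> ?N. real (card (E `` {u} \<inter> (L - {h})))) = (\<Sum>u \<in> ?N. \<Sum>v \<in> E `` {u} \<inter> (L - {h}). 1)"
        by simp
      also have "\<dots> = (\<Sum>v \<in> L - {h}. \<Sum>u \<in> E\<inverse> `` {v} \<inter> ?N. 1)"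
        using LT finN by (intro sum_edges_swap) auto
      also have "\<dots> \<le> (\<Sum>v \<in> L - {h}. 2)"
      proof (rule sum_mono)
        fix v assume v: "v \<in> L - {h}"
        have "card (E `` {v} \<inter> ?N) \<le> card (E `` {v} \<inter> E `` {h})" by (intro card_mono) auto
        also have "\<dots> \<le> 2" using v by (intro codegree) auto
        finally show "(\<Sum>u \<in> E\<inverse> `` {v} \<inter> ?N. 1 :: real) \<le> 2" unfolding E_conv by simp
      qed
      also have "\<dots> \<le> 2 * real (card L)"
        using card_mono[of L "L - {h}"] LT by auto
      finally show ?thesis .
    qed
    finally have "(\<Sum>u \<in> ?N. real (card (E `` {u} \<inter> L)) / (\<mu> - outload T u)) \<le>
        sqrt D + 48 / \<delta> + 2 * (2 * real (card L))" by simp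
    moreover have "real (card (E `` {h} \<inter> L)) \<le> real (card L)"
      using LT by (intro of_nat_mono card_mono) auto
    ultimately have "(\<Sum>u \<in> ?N. real (card (E `` {u} \<inter> L)) / (\<mu> - outload T u)) + real (card (E `` {h} \<inter> L)) \<le>
        sqrt D + 48 / \<delta> + 5 * (800 / \<delta>)" using cardL by linarith
    also have "\<dots> \<le> \<mu>" using \<delta> unfolding \<mu>_def by (simp add: field_simps)
    finally show ?thesis .
  qed
  have "outload T u < \<mu>" if "u \<in> T" for u using f[OF that] mu(3) by linarith
  from hub_form_bound[OF LT(3,4,2) E_sym form_le_outload[OF LT(4)] this hub, of x]
  show ?thesis unfolding LT(1) \<mu>_def[symmetric] using form_restrict[of S x, OF x] by simp
qed

text \<open>
  The non-hubs split into the neighbours \<open>N\<close> of the hub and the rest \<open>W\<close>. A vertex of \<open>W\<close> has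
  budget of the order \<open>\<surd>n\<close> to spare and at most two neighbours in \<open>N\<close>, so it can bear almost the
  whole cost of its edges to \<open>N\<close>. The load on \<open>u\<close> in \<open>N\<close> is therefore at most 2, from within \<open>N\<close>,
  plus a multiple of \<open>deg u / \<surd>n\<close> that is bounded, and small on average. The hub then
  pays at most \<open>D / \<mu> + 2 D / \<mu>\<^sup>2 + O(1) / \<mu>\<close>, which is at most \<open>\<mu>\<close> for
  \<open>\<mu> = \<surd>D + 1 + O(1 / \<surd>n)\<close>.
\<close>

lemma form_bound_of_single_hub:
  fixes \<delta> B D a c :: real
  assumes \<delta>: "0 < \<delta>" and B: "0 < B" and D: "\<delta> * n \<le> D"
    and h: "h < n" "h \<notin> S" "real (deg h) \<le> D"
    and deg: "\<And>v. v < n \<Longrightarrow> v \<notin> S \<Longrightarrow> v \<noteq> h \<Longrightarrow> real (deg v) \<le> B * sqrt n"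
    and x: "\<And>v. v \<in> S \<Longrightarrow> x v = 0"
    and a: "a = 2 + 8 * B / sqrt \<delta>" and c: "c = (64 / \<delta> + 2 * a\<^sup>2) / (2 * sqrt \<delta>)"
    and large: "400 * B / \<delta> \<le> sqrt n" "2 * a / sqrt \<delta> \<le> sqrt n"
  shows "edge_form E x \<le> (sqrt D + 1 + c / sqrt n) * (\<Sum>v<n. (x v)\<^sup>2)"
proof -
  define s where "s = sqrt n"
  have s: "s > 0" "s\<^sup>2 = n" "s * s = n" using h by (auto simp: s_def)
  \<comment> \<open>Charge per edge to the end in \<open>W\<close>: two such edges use a quarter of \<open>sqrt (\<delta> n)\<close>, a lower bound of \<open>\<mu>\<close>.\<close>
  define \<beta> where "\<beta> = sqrt \<delta> / 8 * s"
  have \<beta>: "\<beta> > 0" using \<delta> s by (simp add: \<beta>_def)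
  define \<mu> where "\<mu> = sqrt D + 1 + c / s"
  have a2: "a \<ge> 2" unfolding a using \<delta> B by simp
  have cpos: "c > 0" unfolding c using \<delta> a2 by (intro divide_pos_pos add_pos_nonneg) auto
  have "\<delta> * n > 0" using \<delta> h by simp
  then have Dpos: "D > 0" using D by linarith
  have sD: "sqrt \<delta> * s \<le> sqrt D" unfolding s_def real_sqrt_mult[symmetric] using D by simp
  have "c / s > 0" using cpos s by simp
  then have mu: "\<mu> > 0" "sqrt D \<le> \<mu>" "\<mu> \<noteq> 0"
    unfolding \<mu>_def using real_sqrt_gt_zero[OF Dpos] by linarith+
  define T where "T = {..<n} - S - {h}"
  define N where "N = E `` {h} \<inter> T"
  define W where "W = T - N"
  have fin: "finite T" "finite N" "finite W" by (auto simp: T_def N_def W_def)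
  have sets: "N \<inter> W = {}" "N \<union> W = T" "{h} \<union> T = {..<n} - S" "{h} \<inter> T = {}" "W \<subseteq> T" "N \<subseteq> T"
    using h by (auto simp: T_def N_def W_def)
  have degT: "real (deg v) \<le> B * s" if "v \<in> T" for v
    using deg[of v] that by (auto simp: T_def s_def)
  define f where "f u = (if u \<in> N then real (card (E `` {u} \<inter> N)) + deg u / \<beta> else 2 * \<beta> + outload W u)" for u
  have eN: "card (E `` {u} \<inter> N) \<le> 2" if "u \<noteq> h" for u
  proof -
    have "card (E `` {u} \<inter> N) \<le> card (E `` {u} \<inter> E `` {h})" by (intro card_mono) (auto simp: N_def)
    also have "\<dots> \<le> 2" using that by (rule codegree)
    finally show ?thesis .
  qed
  have form: "edge_form (E \<inter> T \<times> T) x \<le> (\<Sum>u \<in> T. f u * (x u)\<^sup>2)"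
  proof -
    have "2 * edge_form (E \<inter> N \<times> W) x \<le> (\<Sum>u \<in> N. (\<Sum>v \<in> E `` {u} \<inter> W. 1 / \<beta>) * (x u)\<^sup>2) +
        (\<Sum>v \<in> W. (\<Sum>u \<in> E\<inverse> `` {v} \<inter> N. 1 / (1 / \<beta>)) * (x v)\<^sup>2)"
      using \<beta> by (intro cross_form_le fin) auto
    also have "\<dots> \<le> (\<Sum>u \<in> N. deg u / \<beta> * (x u)\<^sup>2) + (\<Sum>v \<in> W. 2 * \<beta> * (x v)\<^sup>2)"
    proof (intro add_mono sum_mono mult_right_mono)
      fix u
      have "card (E `` {u} \<inter> W) \<le> deg u" unfolding deg_def by (intro card_mono) auto
      then show "(\<Sum>v \<in> E `` {u} \<inter> W. 1 / \<beta>) \<le> deg u / \<beta>"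
        using \<beta> by (simp add: divide_right_mono)
    next
      fix v assume "v \<in> W"
      then have "card (E `` {v} \<inter> N) \<le> 2" by (intro eN) (auto simp: W_def T_def)
      then have "real (card (E `` {v} \<inter> N)) \<le> 2" by linarith
      then show "(\<Sum>u \<in> E\<inverse> `` {v} \<inter> N. 1 / (1 / \<beta>)) \<le> 2 * \<beta>"
        unfolding E_conv using \<beta> by simp
    qed auto
    finally have "2 * edge_form (E \<inter> N \<times> W) x \<le>
        (\<Sum>u \<in> N. deg u / \<beta> * (x u)\<^sup>2) + (\<Sum>v \<in> W. 2 * \<beta> * (x v)\<^sup>2)" .
    note parts = form_within_le[OF fin(2) E_sym, of x] this form_le_outload[OF fin(3), of x]
    have "edge_form (E \<inter> T \<times> T) x = edge_form (E \<inter> N \<times> N) x + 2 * edge_form (E \<inter> N \<times> W) x + edge_form (E \<inter> W \<times> W) x"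
      using form_split[OF fin(2,3) sets(1) E_sym, of x] unfolding sets(2) .
    also have "\<dots> \<le> (\<Sum>u \<in> N. f u * (x u)\<^sup>2) + (\<Sum>u \<in> W. f u * (x u)\<^sup>2)"
    proof -
      have "(\<Sum>u \<in> N. f u * (x u)\<^sup>2) = (\<Sum>u \<in> N. real (card (E `` {u} \<inter> N)) * (x u)\<^sup>2) + (\<Sum>u \<in> N. deg u / \<beta> * (x u)\<^sup>2)"
        by (simp add: f_def distrib_right sum.distrib)
      moreover have "(\<Sum>u \<in> W. f u * (x u)\<^sup>2) = (\<Sum>u \<in> W. 2 * \<beta> * (x u)\<^sup>2 + outload W u * (x u)\<^sup>2)"
        by (intro sum.cong) (auto simp: f_def W_def distrib_right)
      ultimately show ?thesis using parts by (simp add: sum.distrib)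
    qed
    also have "\<dots> = (\<Sum>u \<in> T. f u * (x u)\<^sup>2)"
      unfolding sets(2)[symmetric] by (rule sum.union_disjoint[symmetric]) (use fin sets in auto)
    finally show ?thesis .
  qed
  have fN: "0 \<le> f u" "f u \<le> a" "f u \<le> \<mu> / 2" "f u \<le> 2 + deg u / \<beta>" if u: "u \<in> N" for u
  proof -
    show "0 \<le> f u" using \<beta> u by (simp add: f_def)
    have "u \<noteq> h" using u by (auto simp: N_def T_def)
    then have "real (card (E `` {u} \<inter> N)) \<le> 2" using eN[of u] by linarith
    then show 1: "f u \<le> 2 + deg u / \<beta>" using u by (simp add: f_def)
    have "deg u / \<beta> \<le> B * s / \<beta>" using degT[of u] u sets \<beta> by (intro divide_right_mono) auto
    also have "\<dots> = 8 * B / sqrt \<delta>" using s \<delta> unfolding \<beta>_def by (simp add: field_simps)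
    finally show 2: "f u \<le> a" using 1 unfolding a by linarith
    have "2 * a \<le> s * sqrt \<delta>" using large(2) \<delta> unfolding s_def[symmetric] by (simp add: field_simps)
    then show "f u \<le> \<mu> / 2" using 2 sD mu by (simp add: mult.commute)
  qed
  have f_lt: "f u < \<mu>" if u: "u \<in> T" for u
  proof (cases "u \<in> N")
    case True
    then show ?thesis using fN(3)[OF True] mu by linarith
  next
    case False
    then have uW: "u \<in> W" using u by (simp add: W_def)
    have "outload W u \<le> 5 * sqrt (B * s)"
      using degT sets uW B s by (intro outload_le) auto
    also have "\<dots> \<le> sqrt \<delta> * s / 4"
    proof -
      have "400 * B \<le> s * \<delta>" using large(1) \<delta> unfolding s_def[symmetric] by (simp add: field_simps)
      then have "400 * B * s \<le> s * \<delta> * s" using s by (intro mult_right_mono) auto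
      then have "B * s \<le> \<delta> * s\<^sup>2 / 400" by (simp add: power2_eq_square mult_ac)
      also have "\<dots> = (sqrt \<delta> * s / 20)\<^sup>2" using \<delta> by (simp add: power_mult_distrib power_divide)
      finally have "sqrt (B * s) \<le> sqrt \<delta> * s / 20" using \<delta> s by (intro real_le_lsqrt) auto
      then show ?thesis by simp
    qed
    finally have "outload W u \<le> sqrt \<delta> * s / 4" .
    moreover have "f u = sqrt \<delta> * s / 4 + outload W u" using False by (simp add: f_def \<beta>_def)
    ultimately have "f u \<le> sqrt \<delta> * s / 2" by linarith
    moreover have "sqrt \<delta> * s > 0" using \<delta> s by simp
    ultimately show ?thesis using sD mu by linarith
  qed
  have cardN: "real (card N) \<le> D"
  proof -
    have "card N \<le> deg h" unfolding deg_def N_def by (intro card_mono) auto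
    then show ?thesis using h(3) by linarith
  qed
  have hub: "(\<Sum>u \<in> N. 1 / (\<mu> - f u)) \<le> \<mu>"
  proof -
    have "(\<Sum>u \<in> N. 1 / (\<mu> - f u)) \<le> (\<Sum>u \<in> N. 1 / \<mu> + (2 + deg u / \<beta>) / \<mu>\<^sup>2 + 2 * a\<^sup>2 / \<mu>^3)"
    proof (rule sum_mono)
      fix u assume u: "u \<in> N"
      have "1 / (\<mu> - f u) \<le> 1 / \<mu> + f u / \<mu>\<^sup>2 + 2 * (f u)\<^sup>2 / \<mu>^3"
        by (rule inverse_gap_le(3)[OF fN(1,3)[OF u] mu(1)])
      also have "\<dots> \<le> 1 / \<mu> + (2 + deg u / \<beta>) / \<mu>\<^sup>2 + 2 * a\<^sup>2 / \<mu>^3"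
        using fN[OF u] mu by (intro add_mono divide_right_mono mult_left_mono power_mono) auto
      finally show "1 / (\<mu> - f u) \<le> 1 / \<mu> + (2 + deg u / \<beta>) / \<mu>\<^sup>2 + 2 * a\<^sup>2 / \<mu>^3" .
    qed
    also have "\<dots> = card N * (1 / \<mu> + 2 / \<mu>\<^sup>2 + 2 * a\<^sup>2 / \<mu>^3) + (\<Sum>u \<in> N. real (deg u)) / (\<beta> * \<mu>\<^sup>2)"
      by (simp add: sum.distrib add_divide_distrib sum_divide_distrib distrib_left)
    also have "\<dots> \<le> D * (1 / \<mu> + 2 / \<mu>\<^sup>2 + 2 * a\<^sup>2 / \<mu>^3) + (8 * n) / (\<beta> * \<mu>\<^sup>2)"
    proof (intro add_mono mult_right_mono divide_right_mono cardN)
      have "(\<Sum>u \<in> N. real (deg u)) \<le> (\<Sum>u<n. real (deg u))"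
        by (intro sum_mono2) (auto simp: N_def T_def)
      then show "(\<Sum>u \<in> N. real (deg u)) \<le> 8 * n" using sum_deg by simp
    qed (use mu \<beta> in \<open>auto intro!: add_nonneg_nonneg\<close>)
    also have "\<dots> \<le> \<mu>"
    proof -
      have "\<mu> * (D * (1 / \<mu> + 2 / \<mu>\<^sup>2 + 2 * a\<^sup>2 / \<mu>^3) + (8 * n) / (\<beta> * \<mu>\<^sup>2)) =
          D + 2 * (D / \<mu>) + 2 * a\<^sup>2 * (D / \<mu>\<^sup>2) + (8 * n / \<beta>) / \<mu>"
        using mu(3) \<beta> by (simp add: field_simps power2_eq_square power3_eq_cube)
      also have "\<dots> \<le> D + 2 * sqrt D + 2 * a\<^sup>2 * 1 + 64 / \<delta>"
      proof (intro add_mono mult_left_mono order_refl)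
        have "D / \<mu> \<le> D / sqrt D" using mu Dpos by (intro divide_left_mono) auto
        then show "D / \<mu> \<le> sqrt D" using Dpos by (simp add: real_div_sqrt)
        have "D \<le> \<mu>\<^sup>2" using power_mono[OF mu(2), of 2] Dpos by simp
        then show "D / \<mu>\<^sup>2 \<le> 1" using mu by simp
        have e: "real (8 * n) / \<beta> = 64 * s / sqrt \<delta>"
        proof -
          have "real (8 * n) = 8 * (s * s)" using s(3) by simp
          then show ?thesis using s(1) \<delta> unfolding \<beta>_def by (simp only:) (simp add: field_simps)
        qed
        have "real (8 * n) / \<beta> / \<mu> \<le> (64 * s / sqrt \<delta>) / (sqrt \<delta> * s)"
          unfolding e using sD mu s \<delta> by (intro divide_left_mono) auto
        also have "\<dots> = 64 / \<delta>" using s(1) \<delta> by (simp add: field_simps)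
        finally show "real (8 * n) / \<beta> / \<mu> \<le> 64 / \<delta>" .
      qed auto
      also have "\<dots> \<le> \<mu>\<^sup>2"
      proof -
        have "64 / \<delta> + 2 * a\<^sup>2 = 2 * (c / s) * (sqrt \<delta> * s)"
          unfolding c using \<delta> s by (simp add: field_simps)
        also have "\<dots> \<le> 2 * (c / s) * sqrt D" using sD cpos s by (intro mult_left_mono) auto
        finally have 1: "64 / \<delta> + 2 * a\<^sup>2 \<le> 2 * (c / s) * sqrt D" .
        have "\<mu>\<^sup>2 = (sqrt D)\<^sup>2 + 2 * sqrt D * (1 + c / s) + (1 + c / s)\<^sup>2"
          unfolding \<mu>_def by (simp add: power2_eq_square algebra_simps)
        then have "\<mu>\<^sup>2 \<ge> D + 2 * sqrt D * (1 + c / s)" using Dpos by simp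
        then show ?thesis using 1 by (simp add: algebra_simps)
      qed
      finally have "\<mu> * (D * (1 / \<mu> + 2 / \<mu>\<^sup>2 + 2 * a\<^sup>2 / \<mu>^3) + (8 * n) / (\<beta> * \<mu>\<^sup>2)) \<le> \<mu> * \<mu>"
        by (simp add: power2_eq_square)
      then show ?thesis using mu(1) by (rule mult_left_le_imp_le)
    qed
    finally show ?thesis .
  qed
  have "edge_form (E \<inter> ({h} \<union> T) \<times> ({h} \<union> T)) x \<le> \<mu> * (\<Sum>u \<in> {h} \<union> T. (x u)\<^sup>2)"
  proof (rule hub_form_bound[OF _ fin(1) sets(4) E_sym form f_lt])
    fix h' assume "h' \<in> {h}"
    then have h': "h' = h" by simp
    have "(\<Sum>u \<in> E `` {h} \<inter> T. real (card (E `` {u} \<inter> {h})) / (\<mu> - f u)) = (\<Sum>u \<in> N. 1 / (\<mu> - f u))"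
    proof (intro sum.cong)
      fix u assume "u \<in> N"
      then have "E `` {u} \<inter> {h} = {h}" using E_sym by (auto simp: N_def dest: symD)
      then show "real (card (E `` {u} \<inter> {h})) / (\<mu> - f u) = 1 / (\<mu> - f u)" by simp
    qed (simp add: N_def)
    moreover have "E `` {h} \<inter> {h} = {}" using E_irrefl by (auto simp: irrefl_def)
    ultimately show "(\<Sum>u \<in> E `` {h'} \<inter> T. real (card (E `` {u} \<inter> {h})) / (\<mu> - f u)) + real (card (E `` {h'} \<inter> {h})) \<le> \<mu>"
      unfolding h' using hub by simp
  qed auto
  then show ?thesis unfolding sets(3) \<mu>_def s_def using form_restrict[of S x, OF x] by simp
qed

end

section \<open>Chords of a parabola\<close>

text \<open>
  On the chord of the parabola over \<open>[u, v]\<close> the height above the parabola at \<open>t\<close> is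
  \<open>(t - u) (v - t)\<close>. So \<open>eq\<close> says that two chords have a point in common, and \<open>nc\<close> that
  they do not cross.
\<close>

lemma chords_meet_at_common_end:
  fixes u v x y t :: real
  assumes t: "u \<le> t" "t \<le> v" "x \<le> t" "t \<le> y" and ord: "u < v" "x < y" "(u, v) \<noteq> (x, y)"
    and eq: "(t - u) * (v - t) = (t - x) * (y - t)"
    and nc: "v \<le> x \<or> y \<le> u \<or> (u \<le> x \<and> y \<le> v) \<or> (x \<le> u \<and> v \<le> y)"
  shows "t \<in> {u, v} \<and> t \<in> {x, y}"
proof -
  have nested: "t \<in> {u, v} \<and> t \<in> {x, y}"
    if t: "u \<le> t" "t \<le> v" "x \<le> t" "t \<le> y" and ne: "(u, v) \<noteq> (x, y)"
      and eq: "(t - u) * (v - t) = (t - x) * (y - t)" and n: "u \<le> x" "y \<le> v" for u v x y :: real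
  proof -
    have "(x - u) * (v - t) + (t - x) * (v - y) = 0" using eq by (simp add: algebra_simps)
    moreover have "(x - u) * (v - t) \<ge> 0" "(t - x) * (v - y) \<ge> 0" using t n by simp_all
    ultimately have z: "(x - u) * (v - t) = 0" "(t - x) * (v - y) = 0" by linarith+
    show ?thesis
    proof (cases "u = x")
      case True
      then have "v - y \<noteq> 0" using ne by auto
      then show ?thesis using z True by auto
    next
      case False
      then have "v = t" using z by auto
      then show ?thesis using t n by auto
    qed
  qed
  from nc consider "v \<le> x" | "y \<le> u" | "u \<le> x" "y \<le> v" | "x \<le> u" "v \<le> y" by auto
  then show ?thesis
  proof cases
    case 3
    from nested[OF t ord(3) eq 3] show ?thesis .
  next
    case 4
    have "(x, y) \<noteq> (u, v)" using ord(3) by auto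
    from nested[OF t(3,4,1,2) this eq[symmetric] 4] show ?thesis by blast
  qed (use t ord in auto)
qed

definition parabola :: "nat \<Rightarrow> complex" where
  "parabola i = Complex (real i) ((real i)\<^sup>2)"

lemma parabola_inj: "parabola i = parabola j \<longleftrightarrow> i = j"
  by (auto simp: parabola_def)

lemma parabola_chord:
  assumes "z \<in> closed_segment (parabola u) (parabola v)" "u \<le> v"
  shows "real u \<le> Re z" "Re z \<le> real v" "Im z - (Re z)\<^sup>2 = (Re z - real u) * (real v - Re z)"
proof -
  obtain t where t: "0 \<le> t" "t \<le> 1" "z = (1 - t) *\<^sub>R parabola u + t *\<^sub>R parabola v"
    using assms(1) unfolding closed_segment_def by auto
  have re: "Re z = real u + t * (real v - real u)" and im: "Im z = (1 - t) * (real u)\<^sup>2 + t * (real v)\<^sup>2"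
    unfolding t(3) by (auto simp: parabola_def algebra_simps)
  have d: "0 \<le> real v - real u" using assms(2) by simp
  show "real u \<le> Re z" unfolding re using t d by simp
  have "t * (real v - real u) \<le> 1 * (real v - real u)" using t d by (intro mult_right_mono)
  then show "Re z \<le> real v" unfolding re by simp
  show "Im z - (Re z)\<^sup>2 = (Re z - real u) * (real v - Re z)"
    unfolding re im by (simp add: power2_eq_square algebra_simps)
qed

lemma parabola_chord_cases:
  assumes "z \<in> closed_segment (parabola u) (parabola v)" "u \<noteq> v"
  obtains a b where "a < b" "{a, b} = {u, v}" "real a \<le> Re z" "Re z \<le> real b"
    "Im z - (Re z)\<^sup>2 = (Re z - real a) * (real b - Re z)"
proof (cases "u < v")
  case True
  then show ?thesis using parabola_chord[OF assms(1)] that[of u v] by auto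
next
  case False
  then have "z \<in> closed_segment (parabola v) (parabola u)" "v < u"
    using assms by (auto simp: closed_segment_commute)
  then show ?thesis using parabola_chord[of z v u] that[of v u] by auto
qed

lemma parabola_chord_above:
  assumes "z \<in> closed_segment (parabola u) (parabola v)"
  shows "(Re z)\<^sup>2 \<le> Im z"
proof (cases "u = v")
  case True
  then show ?thesis using assms by (auto simp: parabola_def)
next
  case False
  from parabola_chord_cases[OF assms this] obtain a b where
    "real a \<le> Re z" "Re z \<le> real b" "Im z - (Re z)\<^sup>2 = (Re z - real a) * (real b - Re z)" by metis
  then show ?thesis by (smt (verit) mult_nonneg_nonneg)
qed

lemma below_parabola_outside:
  assumes S: "\<And>z. z \<in> S \<Longrightarrow> (Re z)\<^sup>2 \<le> Im z" and z: "Im z < (Re z)\<^sup>2"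
  shows "z \<in> outside S"
proof -
  define R where "R = (\<lambda>t. z - Complex 0 t) ` {0..}"
  have "R \<subseteq> - S"
  proof
    fix w assume "w \<in> R"
    then obtain t where "t \<ge> 0" "w = z - Complex 0 t" by (auto simp: R_def)
    then have "Im w < (Re w)\<^sup>2" using z by simp
    then show "w \<in> - S" using S[of w] by auto
  qed
  moreover have "Topological_Spaces.connected R"
    unfolding R_def by (intro connected_continuous_image) (auto intro!: continuous_intros simp: Complex_eq)
  moreover have zR: "z \<in> R" unfolding R_def by (intro image_eqI[of _ _ 0]) (auto simp: complex_eq_iff)
  ultimately have sub: "R \<subseteq> connected_component_set (- S) z" by (intro connected_component_maximal)
  have "\<not> bounded R"
  proof
    assume "bounded R"
    then obtain B where B: "\<And>w. w \<in> R \<Longrightarrow> norm w \<le> B" unfolding bounded_iff by auto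
    \<comment> \<open>The ray goes straight down from \<open>z\<close>; this parameter takes it out of the disc of radius \<open>B\<close>.\<close>
    define t where "t = \<bar>B\<bar> + \<bar>Im z\<bar> + 1"
    have "z - Complex 0 t \<in> R" unfolding R_def t_def by (intro imageI) simp
    from B[OF this] have "\<bar>Im (z - Complex 0 t)\<bar> \<le> B" using abs_Im_le_cmod order_trans by blast
    then show False unfolding t_def by simp
  qed
  then have "\<not> bounded (connected_component_set (- S) z)" using sub bounded_subset by blast
  then show ?thesis using z S[of z] unfolding outside_def by auto
qed

text \<open>
  Place vertex \<open>i\<close> at \<open>(i, i\<^sup>2)\<close> and draw edges as chords. The drawing stays above the parabola, so
  the region below belongs to the unbounded face, and all vertices lie on the boundary of that region.
\<close>

lemma outerplanar_of_noncrossing: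
  fixes G :: "nat pair_pre_digraph"
  assumes irr: "irrefl (parcs G)" and wf: "parcs G \<subseteq> pverts G \<times> pverts G"
    and sym: "sym (parcs G)"
    and nc: "\<And>u v x y. (u, v) \<in> parcs G \<Longrightarrow> (x, y) \<in> parcs G \<Longrightarrow> u < x \<Longrightarrow> x < v \<Longrightarrow> v < y \<Longrightarrow> False"
  shows "outerplanar G"
proof -
  define \<gamma> where "\<gamma> = (\<lambda>(u, v). linepath (parabola u) (parabola v))"
  have image: "path_image (\<gamma> (u, v)) = closed_segment (parabola u) (parabola v)" for u v
    by (simp add: \<gamma>_def)
  have neq: "u \<noteq> v" if "(u, v) \<in> parcs G" for u v
    using that irr by (auto simp: irrefl_def)
  have on_parabola: "z = parabola w" if "Re z = real w" "Im z = (Re z)\<^sup>2" for z w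
    using that by (simp add: parabola_def complex_eq_iff)
  have meet: "path_image (\<gamma> (u, v)) \<inter> path_image (\<gamma> (x, y)) \<subseteq> parabola ` ({u, v} \<inter> {x, y})"
    if uv: "(u, v) \<in> parcs G" and xy: "(x, y) \<in> parcs G" and ne: "{u, v} \<noteq> {x, y}" for u v x y
  proof
    fix z assume "z \<in> path_image (\<gamma> (u, v)) \<inter> path_image (\<gamma> (x, y))"
    then have z: "z \<in> closed_segment (parabola u) (parabola v)" "z \<in> closed_segment (parabola x) (parabola y)"
      unfolding image by auto
    obtain a b where ab: "a < b" "{a, b} = {u, v}" "real a \<le> Re z" "Re z \<le> real b"
      "Im z - (Re z)\<^sup>2 = (Re z - real a) * (real b - Re z)"
      using parabola_chord_cases[OF z(1) neq[OF uv]] by metis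
    obtain c d where cd: "c < d" "{c, d} = {x, y}" "real c \<le> Re z" "Re z \<le> real d"
      "Im z - (Re z)\<^sup>2 = (Re z - real c) * (real d - Re z)"
      using parabola_chord_cases[OF z(2) neq[OF xy]] by metis
    have E: "(a, b) \<in> parcs G" "(c, d) \<in> parcs G"
      using ab(2) cd(2) uv xy sym by (auto simp: doubleton_eq_iff dest: symD)
    have "b \<le> c \<or> d \<le> a \<or> (a \<le> c \<and> d \<le> b) \<or> (c \<le> a \<and> b \<le> d)"
    proof -
      have "\<not> (a < c \<and> c < b \<and> b < d)" "\<not> (c < a \<and> a < d \<and> d < b)"
        using nc[OF E] nc[OF E(2,1)] by blast+
      then show ?thesis by linarith
    qed
    then have nc': "real b \<le> real c \<or> real d \<le> real a \<or> (real a \<le> real c \<and> real d \<le> real b) \<or> (real c \<le> real a \<and> real b \<le> real d)"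
      by simp
    have "(a, b) \<noteq> (c, d)" using ne ab(2) cd(2) by auto
    then have ne': "(real a, real b) \<noteq> (real c, real d)" by simp
    have "Re z \<in> {real a, real b} \<and> Re z \<in> {real c, real d}"
      using chords_meet_at_common_end[OF ab(3,4) cd(3,4) _ _ ne' _ nc'] ab cd by simp
    then obtain w where w: "w \<in> {a, b}" "w \<in> {c, d}" "Re z = real w" by auto
    then have "Im z = (Re z)\<^sup>2" using ab(5) by auto
    then show "z \<in> parabola ` ({u, v} \<inter> {x, y})"
      using on_parabola[OF w(3)] w ab(2) cd(2) by auto
  qed
  have drawing: "plane_drawing G parabola \<gamma>"
    unfolding plane_drawing_def
  proof (intro conjI ballI)
    show "inj_on parabola (pverts G)" by (auto simp: inj_on_def parabola_inj)
  next
    fix e assume "e \<in> parcs G"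
    then obtain u v where e: "e = (u, v)" and uv: "(u, v) \<in> parcs G" by (cases e) auto
    have "path_image (\<gamma> (u, v)) \<inter> parabola ` pverts G = {parabola u, parabola v}"
    proof
      show "path_image (\<gamma> (u, v)) \<inter> parabola ` pverts G \<subseteq> {parabola u, parabola v}"
      proof
        fix z assume "z \<in> path_image (\<gamma> (u, v)) \<inter> parabola ` pverts G"
        then obtain w where z: "z \<in> closed_segment (parabola u) (parabola v)" "z = parabola w"
          unfolding image by auto
        obtain a b where ab: "a < b" "{a, b} = {u, v}"
          "Im z - (Re z)\<^sup>2 = (Re z - real a) * (real b - Re z)"
          using parabola_chord_cases[OF z(1) neq[OF uv]] by metis
        have "(real w - real a) * (real b - real w) = 0" using ab(3) z(2) by (simp add: parabola_def)
        then have "w \<in> {a, b}" by auto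
        then show "z \<in> {parabola u, parabola v}" using ab z by auto
      qed
      show "{parabola u, parabola v} \<subseteq> path_image (\<gamma> (u, v)) \<inter> parabola ` pverts G"
        using wf uv unfolding image by auto
    qed
    then show "case e of (u, v) \<Rightarrow> Path_Connected.arc (\<gamma> (u, v)) \<and> pathstart (\<gamma> (u, v)) = parabola u \<and>
        pathfinish (\<gamma> (u, v)) = parabola v \<and> path_image (\<gamma> (v, u)) = path_image (\<gamma> (u, v)) \<and>
        path_image (\<gamma> (u, v)) \<inter> parabola ` pverts G = {parabola u, parabola v}"
      unfolding e using neq[OF uv] by (simp add: \<gamma>_def parabola_inj arc_linepath closed_segment_commute)
  next
    fix e assume "e \<in> parcs G"
    then obtain u v where e: "e = (u, v)" and uv: "(u, v) \<in> parcs G" by (cases e) auto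
    show "case e of (u, v) \<Rightarrow> \<forall>(x, y) \<in> parcs G. {u, v} \<noteq> {x, y} \<longrightarrow>
        path_image (\<gamma> (u, v)) \<inter> path_image (\<gamma> (x, y)) \<subseteq> parabola ` ({u, v} \<inter> {x, y})"
      unfolding e using meet[OF uv] by blast
  qed
  let ?D = "drawing_image G parabola \<gamma>"
  have above: "(Re z)\<^sup>2 \<le> Im z" if "z \<in> ?D" for z
    using that parabola_chord_above unfolding drawing_image_def
    by (auto simp: image parabola_def)
  have "parabola v \<in> frontier (outside ?D)" if v: "v \<in> pverts G" for v
  proof -
    have "parabola v \<in> ?D" using v by (simp add: drawing_image_def)
    then have "parabola v \<notin> outside ?D" using outside_no_overlap by blast
    moreover have "\<exists>w \<in> outside ?D. dist w (parabola v) < e" if "e > 0" for e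
    proof (intro bexI)
      let ?w = "parabola v - Complex 0 (e / 2)"
      show "?w \<in> outside ?D"
        using that by (intro below_parabola_outside above) (auto simp: parabola_def)
      show "dist ?w (parabola v) < e" using that by (simp add: dist_norm complex_norm)
    qed
    ultimately show ?thesis
      unfolding frontier_def closure_approachable[symmetric]
      using interior_subset[of "outside ?D"] by (auto simp: closure_approachable)
  qed
  then show ?thesis unfolding outerplanar_def using drawing by blast
qed

section \<open>Linked fans\<close>

text \<open>
  Vertex 0 is the extra vertex; for \<open>j < k\<close> the fan number \<open>j\<close> occupies the \<open>q\<close> consecutive
  vertices that start at its hub.
\<close>

definition hub :: "nat \<Rightarrow> nat \<Rightarrow> nat" where
  "hub q j = Suc (j * q)"

definition fan_spokes :: "nat \<Rightarrow> nat \<Rightarrow> (nat \<times> nat) set" where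
  "fan_spokes k q = (\<lambda>(j, r). (hub q j, hub q j + r)) ` ({..<k} \<times> {1..<q})"

definition fan_rims :: "nat \<Rightarrow> nat \<Rightarrow> (nat \<times> nat) set" where
  "fan_rims k q = (\<lambda>(j, r). (hub q j + r, hub q j + Suc r)) ` ({..<k} \<times> {1..<q - 1})"

definition fan_links :: "nat \<Rightarrow> nat \<Rightarrow> nat \<Rightarrow> (nat \<times> nat) set" where
  "fan_links k q n = {0} \<times> (hub q ` {..<k} \<union> {k * q<..<n})"

definition fan_arcs :: "nat \<Rightarrow> nat \<Rightarrow> nat \<Rightarrow> (nat \<times> nat) set" where
  "fan_arcs k q n = fan_spokes k q \<union> fan_rims k q \<union> fan_links k q n"

definition linked_fans :: "nat \<Rightarrow> nat \<Rightarrow> nat \<Rightarrow> nat pair_pre_digraph" where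
  "linked_fans k q n = \<lparr>pverts = {0..<n}, parcs = fan_arcs k q n \<union> (fan_arcs k q n)\<inverse>\<rparr>"

lemma hub_mono: "j < j' \<Longrightarrow> hub q j + q \<le> hub q j'"
proof -
  assume "j < j'"
  then have "Suc j * q \<le> j' * q" by (intro mult_right_mono) auto
  then show ?thesis by (simp add: hub_def)
qed

lemma hub_last: "j < k \<Longrightarrow> hub q j + q \<le> Suc (k * q)"
  using hub_mono[of j k q] by (simp add: hub_def)

lemma fan_arcs_cases:
  assumes "(u, v) \<in> fan_arcs k q n" "k * q < n" "2 \<le> q"
  shows "u < v" "v < n"
    "(u = 0 \<and> (v \<in> hub q ` {..<k} \<or> k * q < v)) \<or>
     (\<exists>j<k. hub q j \<le> u \<and> v < hub q j + q \<and> (u = hub q j \<or> v = Suc u))"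
proof -
  consider (link) "u = 0" "v \<in> hub q ` {..<k}" | (pendant) "u = 0" "k * q < v" "v < n" |
    (block) j where "j < k" "hub q j \<le> u" "u < v" "v < hub q j + q" "u = hub q j \<or> v = Suc u"
    using assms(1) by (auto simp: fan_arcs_def fan_spokes_def fan_rims_def fan_links_def)
  note cs = this
  have "u < v \<and> v < n \<and> ((u = 0 \<and> (v \<in> hub q ` {..<k} \<or> k * q < v)) \<or>
     (\<exists>j<k. hub q j \<le> u \<and> v < hub q j + q \<and> (u = hub q j \<or> v = Suc u)))"
    using cs
  proof cases
    case link
    then obtain j where j: "v = hub q j" "j < k" by auto
    then show ?thesis using link hub_last[OF j(2), of q] assms(2,3) by (auto simp: hub_def)
  next
    case pendant
    then show ?thesis by auto
  next
    case block
    then show ?thesis using hub_last[OF block(1), of q] assms(2) by auto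
  qed
  then show "u < v" "v < n"
    "(u = 0 \<and> (v \<in> hub q ` {..<k} \<or> k * q < v)) \<or>
     (\<exists>j<k. hub q j \<le> u \<and> v < hub q j + q \<and> (u = hub q j \<or> v = Suc u))" by auto
qed

text \<open>
  An edge \<open>(x, y)\<close> within a fan that spans an inner vertex starts at the hub of that fan. Any vertex
  \<open>v\<close> strictly between belongs to the same fan and is not a hub, so its edges do not leave the fan,
  and none of them ends before the hub.
\<close>

lemma fan_arcs_noncrossing:
  assumes uv: "(u, v) \<in> fan_arcs k q n" and xy: "(x, y) \<in> fan_arcs k q n"
    and p: "k * q < n" "2 \<le> q" and ord: "u < x" "x < v" "v < y"
  shows False
proof -
  obtain j where j: "j < k" "hub q j \<le> x" "y < hub q j + q" "x = hub q j \<or> y = Suc x"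
    using fan_arcs_cases(3)[OF xy p] ord by auto
  then have x: "x = hub q j" using ord by auto
  from fan_arcs_cases(3)[OF uv p] consider "v \<in> hub q ` {..<k}" | "k * q < v"
    | i where "i < k" "hub q i \<le> u" "v < hub q i + q" by blast
  then show False
  proof cases
    case 1
    then obtain i where i: "v = hub q i" by auto
    show False
    proof (cases "i \<le> j")
      case True
      then have "hub q i \<le> hub q j" by (simp add: hub_def)
      then show False using i x ord by simp
    next
      case False
      then show False using hub_mono[of j i q] i j ord by simp
    qed
  next
    case 2
    then show False using hub_last[OF j(1), of q] j ord by simp
  next
    case i: 3
    have "i = j"
      using hub_mono[of i j q] hub_mono[of j i q] i j ord x by (cases i j rule: linorder_cases) auto
    then show False using i x ord by simp
  qed
qed

lemma finite_fan_arcs: "finite (fan_arcs k q n)"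
  by (simp add: fan_arcs_def fan_spokes_def fan_rims_def fan_links_def)

lemma linked_fans_graph_on:
  assumes "k * q < n" "2 \<le> q"
  shows "graph_on n (linked_fans k q n)"
proof -
  note c = fan_arcs_cases(1,2)[OF _ assms]
  have "pair_graph (linked_fans k q n)"
  proof
    show "e \<in> parcs (linked_fans k q n) \<Longrightarrow> fst e \<in> pverts (linked_fans k q n)" for e
      using c[of "fst e" "snd e"] c[of "snd e" "fst e"] by (cases e) (auto simp: linked_fans_def)
    show "e \<in> parcs (linked_fans k q n) \<Longrightarrow> snd e \<in> pverts (linked_fans k q n)" for e
      using c[of "fst e" "snd e"] c[of "snd e" "fst e"] by (cases e) (auto simp: linked_fans_def)
    show "e \<in> parcs (linked_fans k q n) \<Longrightarrow> fst e \<noteq> snd e" for e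
      using c[of "fst e" "snd e"] c[of "snd e" "fst e"] by (cases e) (auto simp: linked_fans_def)
    show "finite (pverts (linked_fans k q n))" by (simp add: linked_fans_def)
    show "finite (parcs (linked_fans k q n))"
      using finite_fan_arcs by (simp add: linked_fans_def)
    show "symmetric (with_proj (linked_fans k q n))"
      by (auto simp: symmetric_def linked_fans_def sym_def)
  qed
  then show ?thesis by (simp add: graph_on_def linked_fans_def)
qed

lemma linked_fans_outerplanar:
  assumes "k * q < n" "2 \<le> q"
  shows "outerplanar (linked_fans k q n)"
proof (rule outerplanar_of_noncrossing)
  note g = graph_on_parcs[OF linked_fans_graph_on[OF assms]]
  show "irrefl (parcs (linked_fans k q n))" "sym (parcs (linked_fans k q n))"
    "parcs (linked_fans k q n) \<subseteq> pverts (linked_fans k q n) \<times> pverts (linked_fans k q n)"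
    using g by auto
  fix u v x y
  assume "(u, v) \<in> parcs (linked_fans k q n)" "(x, y) \<in> parcs (linked_fans k q n)"
    and ord: "u < x" "x < v" "v < y"
  then have "(u, v) \<in> fan_arcs k q n" "(x, y) \<in> fan_arcs k q n"
    using fan_arcs_cases(1)[OF _ assms, of v u] fan_arcs_cases(1)[OF _ assms, of y x]
    by (auto simp: linked_fans_def)
  then show False using fan_arcs_noncrossing assms ord by blast
qed

lemma linked_fans_connected:
  assumes "k * q < n" "2 \<le> q"
  shows "Digraph_Component.connected (with_proj (linked_fans k q n))"
proof -
  let ?G = "linked_fans k q n" and ?V = "{0..<n}"
  let ?R = "(parcs ?G)\<^sup>s"
  have reach: "(0, v) \<in> rtrancl_on ?V ?R" if v: "v < n" for v
  proof -
    have zero: "(0, 0) \<in> rtrancl_on ?V ?R" using v by auto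
    have step: "(0, w) \<in> rtrancl_on ?V ?R" if "(0, u) \<in> rtrancl_on ?V ?R" "(u, w) \<in> fan_arcs k q n" for u w
    proof (rule rtrancl_on_into_rtrancl_on[OF that(1)])
      show "(u, w) \<in> ?R" using that(2) by (auto simp: linked_fans_def symcl_def)
      show "w \<in> ?V" using fan_arcs_cases(2)[OF that(2) assms] by simp
    qed
    consider "v = 0" | "k * q < v" | "0 < v" "v \<le> k * q" by linarith
    then show ?thesis
    proof cases
      case 1
      then show ?thesis using zero by simp
    next
      case 2
      then show ?thesis using v by (intro step[OF zero]) (auto simp: fan_arcs_def fan_links_def)
    next
      case 3
      define j where "j = (v - 1) div q"
      define r where "r = (v - 1) mod q"
      have vr: "v = hub q j + r" "r < q" using 3 assms(2) by (simp_all add: hub_def j_def r_def)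
      have j: "j < k"
        using 3 assms(2) unfolding j_def by (subst less_mult_imp_div_less) auto
      have h: "(0, hub q j) \<in> rtrancl_on ?V ?R"
        using j by (intro step[OF zero]) (auto simp: fan_arcs_def fan_links_def)
      show ?thesis
      proof (cases "r = 0")
        case True
        then show ?thesis using h vr by simp
      next
        case False
        then show ?thesis using vr j
          by (intro step[OF h]) (auto simp: fan_arcs_def fan_spokes_def image_iff)
      qed
    qed
  qed
  have "sym (rtrancl_on ?V ?R)" by (intro rtrancl_on_sym) (auto simp: sym_def symcl_def)
  then have "(u, v) \<in> rtrancl_on ?V ?R" if "u < n" "v < n" for u v
    using reach[OF that(1)] reach[OF that(2)] by (meson rtrancl_on_trans symD)
  then show ?thesis
    unfolding connected_conv using assms by (auto simp: linked_fans_def)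
qed

text \<open>
  The leading eigenvector of a star: the entry at the hub has half of the squared norm.
\<close>

definition fan_vector :: "nat \<Rightarrow> nat \<Rightarrow> nat \<Rightarrow> real" where
  "fan_vector q j v = (if v = hub q j then sqrt (real (q - 1)) else if hub q j < v \<and> v < hub q j + q then 1 else 0)"

lemma fan_combination:
  assumes "j < k" "r < q"
  shows "(\<Sum>i<k. a i * fan_vector q i (hub q j + r)) = a j * (if r = 0 then sqrt (real (q - 1)) else 1)"
proof -
  have "fan_vector q i (hub q j + r) = 0" if "i \<noteq> j" for i
    using hub_mono[of i j q] hub_mono[of j i q] that assms
    by (cases i j rule: linorder_cases) (auto simp: fan_vector_def)
  then have "(\<Sum>i<k. a i * fan_vector q i (hub q j + r)) = (\<Sum>i \<in> {j}. a i * fan_vector q i (hub q j + r))"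
    using assms by (intro sum.mono_neutral_right) auto
  then show ?thesis using assms by (simp add: fan_vector_def)
qed

lemma fan_combination_outside:
  assumes "v = 0 \<or> k * q < v" "2 \<le> q"
  shows "(\<Sum>i<k. a i * fan_vector q i v) = 0"
proof (rule sum.neutral, intro ballI)
  fix i assume "i \<in> {..<k}"
  then have "hub q i + q \<le> Suc (k * q)" by (intro hub_last) auto
  then show "a i * fan_vector q i v = 0" using assms by (auto simp: fan_vector_def hub_def)
qed

lemma hub_offset_inj:
  assumes "hub q j + r = hub q j' + r'" "r < q" "r' < q"
  shows "j = j'" "r = r'"
proof -
  show "j = j'"
    using hub_mono[of j j' q] hub_mono[of j' j q] assms by (cases j j' rule: linorder_cases) auto
  then show "r = r'" using assms by simp
qed

text \<open>
  The fans do not interact, since the test vectors vanish at vertex 0. A fan with coefficient \<open>a\<close>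
  contributes \<open>2 m a\<^sup>2\<close> to the squared norm and \<open>2 (m \<surd>m + (m - 1)) a\<^sup>2\<close> to the form, the first
  term from the spokes and the second from the rim.
\<close>

lemma linked_fans_lambda:
  assumes k: "1 \<le> k" and q: "2 \<le> q" and n: "k * q < n"
  defines "m \<equiv> real (q - 1)"
  shows "sqrt m + 1 - 1 / m \<le> lambda k n (linked_fans k q n)"
proof (rule lambda_ge_of_form_ge[of _ _ _ _ "fan_vector q"])
  show "graph_on n (linked_fans k q n)" by (rule linked_fans_graph_on[OF n q])
  show "1 \<le> k" by (rule k)
  have "k \<le> k * q" using q by simp
  then show "k \<le> n" using n by linarith
  have m: "m \<ge> 1" using q by (simp add: m_def)
  fix a :: "nat \<Rightarrow> real"
  define x where "x i = (\<Sum>j<k. a j * fan_vector q j i)" for i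
  have x: "x (hub q j + r) = a j * (if r = 0 then sqrt m else 1)" if "j < k" "r < q" for j r
    unfolding x_def m_def by (rule fan_combination[OF that])
  have x0: "x v = 0" if "v = 0 \<or> k * q < v" for v
    unfolding x_def by (rule fan_combination_outside[OF that q])
  define s where "s = (\<Sum>j<k. (a j)\<^sup>2)"
  let ?I = "(\<lambda>(j, r). hub q j + r) ` ({..<k} \<times> {..<q})"
  have inI: "v \<in> ?I" if "v \<noteq> 0" "v \<le> k * q" for v
  proof -
    have "v = hub q ((v - 1) div q) + (v - 1) mod q" using that by (simp add: hub_def)
    moreover have "(v - 1) div q < k" using that q by (subst less_mult_imp_div_less) auto
    moreover have "(v - 1) mod q < q" using q by simp
    ultimately show ?thesis by (intro image_eqI[of _ _ "((v - 1) div q, (v - 1) mod q)"]) auto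
  qed
  have "(\<Sum>i<n. (x i)\<^sup>2) \<le> 2 * m * s"
  proof -
    have "(\<Sum>i<n. (x i)\<^sup>2) \<le> (\<Sum>i \<in> ?I. (x i)\<^sup>2)"
    proof -
      have "(\<Sum>i<n. (x i)\<^sup>2) = (\<Sum>i \<in> {..<n} \<inter> ?I. (x i)\<^sup>2)"
      proof (intro sum.mono_neutral_right ballI)
        fix v assume "v \<in> {..<n} - {..<n} \<inter> ?I"
        then have "v = 0 \<or> k * q < v" using inI[of v] by (meson DiffD1 DiffD2 IntI not_le)
        then show "(x v)\<^sup>2 = 0" using x0 by simp
      qed auto
      also have "\<dots> \<le> (\<Sum>i \<in> ?I. (x i)\<^sup>2)" by (intro sum_mono2) auto
      finally show ?thesis .
    qed
    also have "\<dots> = (\<Sum>(j, r) \<in> {..<k} \<times> {..<q}. (x (hub q j + r))\<^sup>2)"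
      by (subst sum.reindex) (auto simp: inj_on_def o_def case_prod_unfold dest: hub_offset_inj)
    also have "\<dots> = (\<Sum>j<k. \<Sum>r<q. (a j)\<^sup>2 * (if r = 0 then m else 1))"
      unfolding sum.cartesian_product[symmetric] using x m
      by (intro sum.cong) (auto simp: power_mult_distrib)
    also have "\<dots> = (\<Sum>j<k. (a j)\<^sup>2 * (2 * m))"
    proof -
      have "{..<q} = insert 0 {1..<q}" using q by auto
      then have "(\<Sum>r<q. (if r = 0 then m else 1)) = m + (\<Sum>r \<in> {1..<q}. 1)" by simp
      also have "\<dots> = 2 * m" by (simp add: m_def)
      finally show ?thesis by (simp add: sum_distrib_left[symmetric])
    qed
    also have "\<dots> = 2 * m * s" by (simp add: s_def sum_distrib_left mult_ac)
    finally show ?thesis .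
  qed
  moreover have "sqrt m + 1 - 1 / m \<ge> 0"
  proof -
    have "1 / m \<le> 1" using m by simp
    moreover have "sqrt m \<ge> 0" using m by simp
    ultimately show ?thesis by linarith
  qed
  ultimately have "(sqrt m + 1 - 1 / m) * (\<Sum>i<n. (x i)\<^sup>2) \<le> (sqrt m + 1 - 1 / m) * (2 * m * s)"
    by (rule mult_left_mono)
  also have "\<dots> = 2 * (m * sqrt m * s + (m - 1) * s)"
    using m by (simp add: field_simps)
  also have "\<dots> = 2 * edge_form (fan_arcs k q n) x"
  proof -
    have spokes: "edge_form (fan_spokes k q) x = m * sqrt m * s"
    proof -
      have "edge_form (fan_spokes k q) x = (\<Sum>(j, r) \<in> {..<k} \<times> {1..<q}. x (hub q j) * x (hub q j + r))"
        unfolding fan_spokes_def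
        by (subst sum.reindex) (auto simp: inj_on_def o_def case_prod_unfold hub_def)
      also have "\<dots> = (\<Sum>j<k. \<Sum>r \<in> {1..<q}. sqrt m * (a j)\<^sup>2)"
        unfolding sum.cartesian_product[symmetric] using x x[of _ 0] q
        by (intro sum.cong) (auto simp: power2_eq_square)
      also have "\<dots> = m * sqrt m * s"
      proof -
        have "(\<Sum>r \<in> {1..<q}. sqrt m * (a j)\<^sup>2) = m * sqrt m * (a j)\<^sup>2" for j
          using q by (simp add: m_def of_nat_diff)
        then show ?thesis by (simp only: s_def sum_distrib_left)
      qed
      finally show ?thesis .
    qed
    have rims: "edge_form (fan_rims k q) x = (m - 1) * s"
    proof -
      have "edge_form (fan_rims k q) x = (\<Sum>(j, r) \<in> {..<k} \<times> {1..<q - 1}. x (hub q j + r) * x (hub q j + Suc r))"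
        unfolding fan_rims_def
      proof (subst sum.reindex)
        show "inj_on (\<lambda>(j, r). (hub q j + r, hub q j + Suc r)) ({..<k} \<times> {1..<q - 1})"
        proof (rule inj_onI)
          fix e e' assume "e \<in> {..<k} \<times> {1..<q - 1}" "e' \<in> {..<k} \<times> {1..<q - 1}"
            and eq: "(\<lambda>(j, r). (hub q j + r, hub q j + Suc r)) e = (\<lambda>(j, r). (hub q j + r, hub q j + Suc r)) e'"
          then obtain j r j' r' where e: "e = (j, r)" "e' = (j', r')" "r < q" "r' < q"
            by (cases e; cases e') auto
          then have "hub q j + r = hub q j' + r'" using eq by simp
          from hub_offset_inj[OF this e(3,4)] show "e = e'" using e by simp
        qed
      qed (simp add: o_def case_prod_unfold)
      also have "\<dots> = (\<Sum>j<k. \<Sum>r \<in> {1..<q - 1}. (a j)\<^sup>2)"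
        unfolding sum.cartesian_product[symmetric]
      proof (intro sum.cong refl)
        fix j r assume "j \<in> {..<k}" "r \<in> {1..<q - 1}"
        then have "j < k" "r < q" "Suc r < q" "r \<noteq> 0" by auto
        then show "x (hub q j + r) * x (hub q j + Suc r) = (a j)\<^sup>2"
          using x[of j r] x[of j "Suc r"] by (simp add: power2_eq_square)
      qed
      also have "\<dots> = (m - 1) * s"
        using q by (simp add: m_def s_def sum_distrib_left of_nat_diff mult_ac)
      finally show ?thesis .
    qed
    have links: "edge_form (fan_links k q n) x = 0"
      using x0[of 0] by (intro sum.neutral) (auto simp: fan_links_def)
    have fin: "finite (fan_spokes k q)" "finite (fan_rims k q)" "finite (fan_links k q n)"
      by (simp_all add: fan_spokes_def fan_rims_def fan_links_def)
    have d1: "fan_spokes k q \<inter> fan_rims k q = {}"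
    proof -
      have "(u, v) \<notin> fan_rims k q" if "(u, v) \<in> fan_spokes k q" for u v
      proof
        assume "(u, v) \<in> fan_rims k q"
        then obtain j r where "u = hub q j + r" "1 \<le> r" "r < q" by (auto simp: fan_rims_def)
        moreover obtain i where "u = hub q i + 0" using \<open>(u, v) \<in> fan_spokes k q\<close> by (auto simp: fan_spokes_def)
        ultimately show False using hub_offset_inj(2)[of q i 0 j r] by simp
      qed
      then show ?thesis by auto
    qed
    have d2: "(fan_spokes k q \<union> fan_rims k q) \<inter> fan_links k q n = {}"
      by (auto simp: fan_spokes_def fan_rims_def fan_links_def hub_def)
    have "edge_form (fan_arcs k q n) x = m * sqrt m * s + (m - 1) * s"
      unfolding fan_arcs_def using fin d1 d2 spokes rims links
      by (simp add: sum.union_disjoint)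
    then show ?thesis by simp
  qed
  also have "\<dots> = edge_form (parcs (linked_fans k q n)) x"
  proof -
    have "fan_arcs k q n \<inter> (fan_arcs k q n)\<inverse> = {}"
    proof -
      have "(v, u) \<notin> fan_arcs k q n" if "(u, v) \<in> fan_arcs k q n" for u v
        using fan_arcs_cases(1)[OF that n q] fan_arcs_cases(1)[OF _ n q, of v u] by auto
      then show ?thesis by auto
    qed
    moreover have "edge_form ((fan_arcs k q n)\<inverse>) x = edge_form (fan_arcs k q n) x"
      by (rule sum.reindex_bij_witness[of _ prod.swap prod.swap]) (auto simp: mult.commute)
    ultimately show ?thesis
      using finite_fan_arcs[of k q n] by (simp add: linked_fans_def sum.union_disjoint)
  qed
  finally show "(sqrt m + 1 - 1 / m) * (\<Sum>i<n. (\<Sum>j<k. a j * fan_vector q j i)\<^sup>2) \<le>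
      edge_form (parcs (linked_fans k q n)) (\<lambda>i. \<Sum>j<k. a j * fan_vector q j i)"
    unfolding x_def .
  assume "\<exists>j<k. a j \<noteq> 0"
  then obtain j where j: "j < k" "a j \<noteq> 0" by auto
  have "x (hub q j) \<noteq> 0" using x[of j 0] j m q by simp
  moreover have "hub q j < n" using hub_last[OF j(1), of q] n q by simp
  ultimately show "\<exists>i<n. (\<Sum>j<k. a j * fan_vector q j i) \<noteq> 0" unfolding x_def by blast
qed

section \<open>The vertices of largest degree\<close>

lemma outerplanar_thin_graph:
  assumes G: "graph_on n G" and op: "outerplanar G"
  obtains F where "thin_graph n (parcs G) F"
proof -
  note g = graph_on_parcs[OF G]
  have free: "fat_K23_free (parcs G)" by (rule outerplanar_fat_K23_free[OF op g(5,3,4)])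
  obtain F where F: "F \<subseteq> parcs G" "parcs G \<subseteq> F \<union> F\<inverse>" "\<And>v. finite (F `` {v}) \<and> card (F `` {v}) \<le> 4"
    by (rule fat_K23_free_orientation[OF free g(3)]) (rule that)
  have "thin_graph n (parcs G) F"
  proof
    show "parcs G \<subseteq> {..<n} \<times> {..<n}" using g(1) by auto
    show "card (parcs G `` {u} \<inter> parcs G `` {v}) \<le> 2" if "u \<noteq> v" for u v
      using fat_K23_free_codegree[OF free g(3,4) that] by simp
  qed (use g F in auto)
  then show ?thesis by (rule that)
qed

text \<open>
  Inclusion and exclusion: two neighbourhoods overlap in at most two vertices.
\<close>

lemma (in thin_graph) sum_deg_le:
  assumes "finite K"
  shows "(\<Sum>v \<in> K. deg v) \<le> n + card K * (card K - 1)"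
proof -
  have "(\<Sum>v \<in> K. deg v) \<le> card (\<Union>v \<in> K. E `` {v}) + card K * (card K - 1)"
    using assms
  proof (induction K rule: finite_induct)
    case (insert v K)
    let ?U = "\<Union>u \<in> K. E `` {u}"
    have finU: "finite ?U" using insert by simp
    have "card (?U \<inter> E `` {v}) = card (\<Union>u \<in> K. E `` {u} \<inter> E `` {v})"
      by (rule arg_cong[of _ _ card]) blast
    also have "\<dots> \<le> (\<Sum>u \<in> K. card (E `` {u} \<inter> E `` {v}))"
      by (rule card_UN_le[OF insert(1)])
    also have "\<dots> \<le> (\<Sum>u \<in> K. 2)"
      using insert(2) by (intro sum_mono codegree) auto
    finally have "card (?U \<inter> E `` {v}) \<le> 2 * card K" by simp
    moreover have "card ?U + deg v = card (?U \<union> E `` {v}) + card (?U \<inter> E `` {v})"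
      unfolding deg_def by (rule card_Un_Int) (use finU in auto)
    moreover have "(\<Union>u \<in> insert v K. E `` {u}) = ?U \<union> E `` {v}" by auto
    ultimately have "deg v + (\<Sum>u \<in> K. deg u) \<le> card (\<Union>u \<in> insert v K. E `` {u}) + (card K * (card K - 1) + 2 * card K)"
      using insert.IH by simp
    also have "card K * (card K - 1) + 2 * card K = card (insert v K) * (card (insert v K) - 1)"
      using insert by (cases "card K") auto
    finally show ?case using insert by simp
  qed simp
  moreover have "card (\<Union>v \<in> K. E `` {v}) \<le> card {..<n}"
    using nbrs_sub by (intro card_mono) auto
  ultimately show ?thesis by simp
qed

lemma ex_top_subset:
  fixes f :: "'a \<Rightarrow> nat"
  assumes "finite V" "k \<le> card V"
  shows "\<exists>K \<subseteq> V. card K = k \<and> (\<forall>u \<in> K. \<forall>v \<in> V - K. f v \<le> f u)"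
  using assms(2)
proof (induction k)
  case 0
  then show ?case by (intro exI[of _ "{}"]) auto
next
  case (Suc k)
  then obtain K where K: "K \<subseteq> V" "card K = k" "\<forall>u \<in> K. \<forall>v \<in> V - K. f v \<le> f u" by auto
  have fin: "finite (V - K)" "finite K" using assms(1) K(1) by (auto intro: finite_subset)
  have "V - K \<noteq> {}" using Suc.prems K fin card_mono[OF fin(2), of V] by auto
  then have "Max (f ` (V - K)) \<in> f ` (V - K)" using fin(1) by (intro Max_in) auto
  then obtain w where "w \<in> V - K" "f w = Max (f ` (V - K))" by auto
  then have w: "w \<in> V - K" "\<forall>v \<in> V - K. f v \<le> f w" using fin(1) by auto
  then show ?case using K fin(2) by (intro exI[of _ "insert w K"]) auto
qed

lemma sqrt_diff_le:
  assumes "0 < x" "0 \<le> t" "t \<le> x"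
  shows "sqrt (x - t) \<le> sqrt x - t / (2 * sqrt x)"
proof (rule real_le_lsqrt)
  have s: "sqrt x > 0" "sqrt x * sqrt x = x" using assms by auto
  then have "t / (2 * sqrt x) \<le> x / (sqrt x)" using assms by (intro frac_le) auto
  then show "0 \<le> sqrt x - t / (2 * sqrt x)" using assms by (simp add: real_div_sqrt)
  have "(sqrt x - t / (2 * sqrt x))\<^sup>2 = x - t + (t / (2 * sqrt x))\<^sup>2"
    using s by (simp add: power2_diff)
  then show "x - t \<le> (sqrt x - t / (2 * sqrt x))\<^sup>2" by simp
qed

lemma sqrt_add_le:
  assumes "0 < x" "0 \<le> t"
  shows "sqrt (x + t) \<le> sqrt x + t / (2 * sqrt x)"
proof (rule real_le_lsqrt)
  have s: "sqrt x > 0" "sqrt x * sqrt x = x" using assms by auto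
  then show "0 \<le> sqrt x + t / (2 * sqrt x)" using assms by simp
  have "(sqrt x + t / (2 * sqrt x))\<^sup>2 = x + t + (t / (2 * sqrt x))\<^sup>2"
    using s by (simp add: power2_sum)
  then show "x + t \<le> (sqrt x + t / (2 * sqrt x))\<^sup>2" by simp
qed

text \<open>
  \<open>K\<close> holds the \<open>k\<close> vertices of largest degree and \<open>h\<close> has the smallest degree in \<open>K\<close>. The first
  alternative arises if \<open>deg h\<close> falls short of \<open>n / k\<close> by a large multiple of \<open>\<surd>n\<close>, which
  outweighs the additive constant of the crude bound.
\<close>

lemma lambda_dichotomy:
  fixes k :: nat
  assumes k: "1 \<le> k"
  obtains B c :: real and n0 where "0 < B" "0 < c"
    "\<And>n G F. n0 \<le> n \<Longrightarrow> graph_on n G \<Longrightarrow> thin_graph n (parcs G) F \<Longrightarrow>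
      \<exists>K h. K \<subseteq> {..<n} \<and> card K = k \<and> h \<in> K \<and>
        (\<forall>u \<in> K. card (parcs G `` {h}) \<le> card (parcs G `` {u})) \<and>
        (lambda k n G \<le> sqrt (n / k) \<or>
         lambda k n G \<le> sqrt (card (parcs G `` {h})) + 1 + c / sqrt n \<and>
         (\<forall>v \<in> {..<n} - K. card (parcs G `` {v}) \<le> B * sqrt n))"
proof -
  define \<delta> :: real where "\<delta> = 1 / (2 * k)"
  have d: "0 < \<delta>" "\<delta> \<le> 1" using k by (auto simp: \<delta>_def)
  \<comment> \<open>Twice the constant \<open>5000 / \<delta>\<close>, since \<open>sqrt (N - C s)\<close> is below \<open>sqrt N\<close> by about \<open>C s / (2 sqrt N)\<close>.\<close>
  define C :: real where "C = 20000 * k"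
  define B :: real where "B = k * C + k * (k + 1)"
  define a where "a = 2 + 8 * B / sqrt \<delta>"
  define c where "c = (64 / \<delta> + 2 * a\<^sup>2) / (2 * sqrt \<delta>)"
  have Bpos: "0 < B" using k by (simp add: B_def C_def add_pos_pos)
  have a2: "a \<ge> 2" unfolding a_def using d Bpos by simp
  have cpos: "0 < c" unfolding c_def using d a2 by (intro divide_pos_pos add_pos_nonneg) auto
  \<comment> \<open>In turn: \<open>k \<le> n\<close>; a loss of \<open>C s\<close> is at most half of \<open>N\<close>; the two size conditions of the sharp bound.\<close>
  define s0 where "s0 = Max {real k, 2 * k * C, 400 * B / \<delta>, 2 * a / sqrt \<delta>, 1}"
  define n0 where "n0 = nat \<lceil>s0\<^sup>2\<rceil>"
  show ?thesis
  proof (rule that[OF Bpos cpos])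
    fix n G F
    assume n0: "n0 \<le> n" and G: "graph_on n G" and thin: "thin_graph n (parcs G) F"
    interpret thin_graph n "parcs G" F by (rule thin)
    define s where "s = sqrt n"
    have s0: "s0 \<ge> k" "s0 \<ge> 2 * k * C" "s0 \<ge> 400 * B / \<delta>" "s0 \<ge> 2 * a / sqrt \<delta>" "s0 \<ge> 1"
      unfolding s0_def by (auto intro!: Max_ge)
    have "s0\<^sup>2 \<le> n" using n0 unfolding n0_def by linarith
    then have ss0: "s0 \<le> s" unfolding s_def by (rule real_le_rsqrt)
    have "s \<ge> 1" using ss0 s0(5) by linarith
    then have s: "s \<ge> 1" "s\<^sup>2 = n" "s * s = n" by (auto simp: s_def)
    have npos: "n > 0" using s by (cases n) auto
    have "real k \<le> s * s" using s0(1) ss0 s(1) mult_mono[of "real k" s 1 s] by simp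
    then have kn: "k \<le> n" using s(3) by simp
    obtain K where K: "K \<subseteq> {..<n}" "card K = k" "\<forall>u \<in> K. \<forall>v \<in> {..<n} - K. deg v \<le> deg u"
      using ex_top_subset[of "{..<n}" k deg] kn by auto
    have finK: "finite K" "K \<noteq> {}" using K k by (auto intro: finite_subset)
    then have "Min (deg ` K) \<in> deg ` K" by (intro Min_in) auto
    then obtain h where "h \<in> K" "deg h = Min (deg ` K)" by auto
    then have h: "h \<in> K" "\<forall>u \<in> K. deg h \<le> deg u" using finK by auto
    define S where "S = K - {h}"
    have S: "finite S" "card S < k" using finK h K k by (auto simp: S_def)
    define N where "N = real n / k"
    have N: "N > 0" "k * N = n" using npos k by (auto simp: N_def)
    have CsN: "C * s \<le> N / 2"
    proof -
      have "2 * k * C * s \<le> s * s" using s0(2) ss0 s(1) by (intro mult_right_mono) auto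
      then show ?thesis unfolding s(3) N_def using k by (simp add: field_simps)
    qed
    have dN: "\<delta> * n = N / 2" using k by (simp add: \<delta>_def N_def)
    have off: "deg v \<le> deg h" if "v < n" "v \<notin> S" for v
      using K(3) h that by (auto simp: S_def)
    have dich: "lambda k n G \<le> sqrt N \<or> lambda k n G \<le> sqrt (deg h) + 1 + c / s \<and> (\<forall>v \<in> {..<n} - K. deg v \<le> B * s)"
    proof (cases "deg h \<le> N - C * s")
      case True
      have "lambda k n G \<le> sqrt (N - C * s) + 5000 / \<delta>"
      proof (rule lambda_le_of_form_le[OF G k kn S])
        fix x :: "nat \<Rightarrow> real" assume "\<forall>v \<in> S. x v = 0"
        then show "edge_form (parcs G) x \<le> (sqrt (N - C * s) + 5000 / \<delta>) * (\<Sum>i<n. (x i)\<^sup>2)"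
        proof (intro form_bound_of_max_degree[OF d npos, where S = S])
          show "\<delta> * n \<le> N - C * s" using CsN dN by linarith
          show "real (deg v) \<le> N - C * s" if "v < n" "v \<notin> S" for v
            using off[OF that] True by linarith
        qed (use \<open>\<forall>v \<in> S. x v = 0\<close> in auto)
      qed
      also have "sqrt (N - C * s) \<le> sqrt N - C * s / (2 * sqrt N)"
        using N CsN s by (intro sqrt_diff_le) (auto simp: C_def)
      also have "C * s / (2 * sqrt N) \<ge> 5000 / \<delta>"
      proof -
        have "sqrt N \<le> s" unfolding s_def N_def using k npos by (simp add: divide_le_eq)
        then have "C * s / (2 * s) \<le> C * s / (2 * sqrt N)"
          using N s k by (intro divide_left_mono) (auto simp: C_def)
        moreover have "C * s / (2 * s) = 5000 / \<delta>" using s k by (simp add: C_def \<delta>_def)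
        ultimately show ?thesis by simp
      qed
      finally show ?thesis by simp
    next
      case False
      have small: "deg v \<le> B * s" if v: "v \<in> {..<n} - K" for v
      proof -
        have "(\<Sum>u \<in> insert v K. deg u) \<le> n + (k + 1) * k"
          using sum_deg_le[of "insert v K"] finK K v by simp
        moreover have "(\<Sum>u \<in> insert v K. deg u) = deg v + (\<Sum>u \<in> K. deg u)"
          using finK v by simp
        moreover have "k * deg h \<le> (\<Sum>u \<in> K. deg u)"
          using sum_bounded_below[of K "deg h" deg] h K by simp
        ultimately have "deg v + k * deg h \<le> n + (k + 1) * k" by linarith
        then have "real (deg v + k * deg h) \<le> real (n + (k + 1) * k)" by (rule of_nat_mono)
        then have "real (deg v) + k * real (deg h) \<le> n + (k + 1) * k" by simp
        moreover have "k * (N - C * s) \<le> k * real (deg h)" using False by (intro mult_left_mono) auto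
        ultimately have "real (deg v) \<le> k * C * s + real ((k + 1) * k) * 1"
          using N(2) by (simp add: right_diff_distrib)
        also have "real ((k + 1) * k) * 1 \<le> real ((k + 1) * k) * s"
          using s(1) by (intro mult_left_mono) auto
        finally show ?thesis by (simp add: B_def algebra_simps)
      qed
      have "lambda k n G \<le> sqrt (deg h) + 1 + c / s"
      proof (rule lambda_le_of_form_le[OF G k kn S])
        fix x :: "nat \<Rightarrow> real" assume x: "\<forall>v \<in> S. x v = 0"
        show "edge_form (parcs G) x \<le> (sqrt (deg h) + 1 + c / s) * (\<Sum>i<n. (x i)\<^sup>2)"
          unfolding s_def
        proof (rule form_bound_of_single_hub[OF d(1) Bpos _ _ _ order_refl _ _ a_def c_def, where S = S])
          show "\<delta> * n \<le> deg h" using False CsN dN by linarith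
          show "h < n" "h \<notin> S" using h K by (auto simp: S_def)
          show "real (deg v) \<le> B * sqrt n" if "v < n" "v \<notin> S" "v \<noteq> h" for v
            using small[of v] that unfolding s_def by (auto simp: S_def)
          show "400 * B / \<delta> \<le> sqrt n" "2 * a / sqrt \<delta> \<le> sqrt n"
            using s0 ss0 unfolding s_def by linarith+
        qed (use x in auto)
      qed
      then show ?thesis using small by blast
    qed
    show "\<exists>K h. K \<subseteq> {..<n} \<and> card K = k \<and> h \<in> K \<and>
        (\<forall>u \<in> K. card (parcs G `` {h}) \<le> card (parcs G `` {u})) \<and>
        (lambda k n G \<le> sqrt (n / k) \<or>
         lambda k n G \<le> sqrt (card (parcs G `` {h})) + 1 + c / sqrt n \<and>
         (\<forall>v \<in> {..<n} - K. card (parcs G `` {v}) \<le> B * sqrt n))"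
      using K(1,2) h dich unfolding deg_def N_def s_def by blast
  qed
qed

section \<open>Asymptotics\<close>

lemma finite_graphs_on: "finite {G. graph_on n G}"
proof -
  have "{G. graph_on n G} \<subseteq> (\<lambda>E. \<lparr>pverts = {0..<n}, parcs = E\<rparr>) ` Pow ({0..<n} \<times> {0..<n})"
  proof
    fix G assume "G \<in> {G. graph_on n G}"
    then have "parcs G \<in> Pow ({0..<n} \<times> {0..<n})" "G = \<lparr>pverts = {0..<n}, parcs = parcs G\<rparr>"
      using graph_on_parcs(1)[of n G] by (auto simp: graph_on_def)
    then show "G \<in> (\<lambda>E. \<lparr>pverts = {0..<n}, parcs = E\<rparr>) ` Pow ({0..<n} \<times> {0..<n})" by blast
  qed
  then show ?thesis by (rule finite_subset) simp
qed

text \<open>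
  The second part holds because the maximum ranges over a finite set that is nonempty once the linked fans
  exist.
\<close>

lemma lambda_max_ge:
  assumes k: "1 \<le> k" and n: "9 * k \<le> n"
  shows "sqrt (n / k) + 1 - 3 * real k / sqrt n \<le> lambda_max k n"
    "\<exists>G. graph_on n G \<and> Digraph_Component.connected (with_proj G) \<and> outerplanar G \<and> lambda k n G = lambda_max k n"
proof -
  define N where "N = real n / k"
  have N9: "N \<ge> 9" unfolding N_def using n k by (simp add: le_divide_eq) 
  \<comment> \<open>One vertex is set aside to link the fans.\<close>
  define q where "q = (n - 1) div k"
  define m where "m = real (q - 1)"
  have "n - 1 = k * q + (n - 1) mod k" by (simp add: q_def)
  then have "n \<le> k * q + k" "k * q < n" using k n mod_less_divisor[of k "n - 1"] by linarith+
  then have "real n \<le> real (k * q + k)" by linarith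
  then have "N \<le> q + 1" unfolding N_def using k by (simp add: divide_le_eq algebra_simps)
  then have q: "2 \<le> q" and mN: "N - 2 \<le> m" using N9 by (auto simp: m_def of_nat_diff)
  let ?X = "{G. graph_on n G \<and> Digraph_Component.connected (with_proj G) \<and> outerplanar G}"
  have fin: "finite (lambda k n ` ?X)"
    using finite_subset[OF _ finite_graphs_on[of n], of ?X] by blast
  have mem: "linked_fans k q n \<in> ?X"
    using linked_fans_graph_on linked_fans_connected linked_fans_outerplanar \<open>k * q < n\<close> q by blast
  have "lambda_max k n \<in> lambda k n ` ?X"
    unfolding lambda_max_def using fin mem by (intro Max_in) auto
  then show "\<exists>G. graph_on n G \<and> Digraph_Component.connected (with_proj G) \<and> outerplanar G \<and> lambda k n G = lambda_max k n"
    by auto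
  have s: "sqrt N > 0" "sqrt N * sqrt N = N" "sqrt N \<ge> 3" using N9 by (auto intro: real_le_rsqrt)
  have "sqrt N - 2 / sqrt N \<le> sqrt m"
  proof (rule real_le_rsqrt)
    have "(sqrt N - 2 / sqrt N)\<^sup>2 = N - 4 + 4 / N"
      using s by (simp add: power2_diff power_divide)
    also have "4 / N \<le> 2" using N9 by (simp add: divide_le_eq)
    finally show "(sqrt N - 2 / sqrt N)\<^sup>2 \<le> m" using mN by simp
  qed
  moreover have "1 / m \<le> 1 / sqrt N"
  proof (rule divide_left_mono)
    have "sqrt N + 2 \<le> 3 * sqrt N" using s(3) by linarith
    also have "\<dots> \<le> sqrt N * sqrt N" using s(1,3) by (intro mult_right_mono) linarith+
    finally show "sqrt N \<le> m" using s(2) mN by linarith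
    then show "0 < m * sqrt N" using s by simp
  qed simp
  moreover have "sqrt m + 1 - 1 / m \<le> lambda k n (linked_fans k q n)"
    unfolding m_def by (rule linked_fans_lambda[OF k q \<open>k * q < n\<close>])
  moreover have "lambda k n (linked_fans k q n) \<le> lambda_max k n"
    unfolding lambda_max_def using fin mem by (intro Max_ge) auto
  moreover have "1 / sqrt N \<le> k / sqrt n"
  proof -
    have "1 / sqrt N = sqrt k / sqrt n" by (simp add: N_def real_sqrt_divide)
    also have "\<dots> \<le> k / sqrt n"
      using k by (intro divide_right_mono real_le_lsqrt) (auto simp: power2_eq_square)
    finally show ?thesis .
  qed
  ultimately show "sqrt (n / k) + 1 - 3 * real k / sqrt n \<le> lambda_max k n"
    unfolding N_def[symmetric] by simp
qed

lemma eventually_sqrt_ge: "\<forall>\<^sub>F n in sequentially. c \<le> sqrt (real n)"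
  using filterlim_compose[OF sqrt_at_top filterlim_real_sequentially]
  by (simp add: filterlim_at_top)

lemma out_degree_eq: "out_degree (with_proj G) v = card (parcs G `` {v})"
proof -
  have "out_arcs (with_proj G) v = Pair v ` (parcs G `` {v})" by (auto simp: out_arcs_def)
  then show ?thesis by (simp add: out_degree_def card_image inj_on_def)
qed

theorem theorem1:
  fixes k :: nat
  assumes "k \<ge> 2"
  shows "(\<lambda>n. lambda_max k n - (sqrt (real n / real k) + 1)) \<in> O(\<lambda>n. 1 / sqrt (real n)) \<and>
    (\<exists>C :: real. \<forall>\<^sub>F n in sequentially. \<forall>G.
       graph_on n G \<and> outerplanar G \<and> lambda k n G = lambda_max k n \<longrightarrow>
       card {v \<in> pverts G. \<bar>real (out_degree (with_proj G) v) - real n / real k\<bar> \<le> C} = k)"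
proof -
  have k: "1 \<le> k" using assms by simp
  obtain B c :: real and n0 where B: "0 < B" and c: "0 < c" and
    dich: "\<And>n G F. n0 \<le> n \<Longrightarrow> graph_on n G \<Longrightarrow> thin_graph n (parcs G) F \<Longrightarrow>
      \<exists>K h. K \<subseteq> {..<n} \<and> card K = k \<and> h \<in> K \<and>
        (\<forall>u \<in> K. card (parcs G `` {h}) \<le> card (parcs G `` {u})) \<and>
        (lambda k n G \<le> sqrt (n / k) \<or>
         lambda k n G \<le> sqrt (card (parcs G `` {h})) + 1 + c / sqrt n \<and>
         (\<forall>v \<in> {..<n} - K. card (parcs G `` {v}) \<le> B * sqrt n))"
    by (rule lambda_dichotomy[OF k]) (rule that)
  \<comment> \<open>The error terms of the upper and of the lower bound for \<open>\<lambda>\<^sub>k\<close> together.\<close>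
  define e :: real where "e = c + 3 * real k"
  define C :: real where "C = (real k)\<^sup>2 + 2 * e * k"
  \<comment> \<open>In turn: \<open>\<lambda>\<^sub>k > sqrt N\<close>; \<open>sqrt N\<close> exceeds the error \<open>e / s\<close>; degrees of order \<open>sqrt n\<close> are far from \<open>N\<close>.\<close>
  define s0 where "s0 = Max {3 * real k, k * e, k * (B + C), 1}"
  have s0: "s0 \<ge> 3 * real k" "s0 \<ge> k * e" "s0 \<ge> k * (B + C)" "s0 \<ge> 1"
    unfolding s0_def by (auto intro!: Max_ge)
  have epos: "e > 0" "C > 0" using c k unfolding e_def C_def by (auto intro!: add_nonneg_pos add_pos_pos)
  have core: "\<exists>K. K \<subseteq> {..<n} \<and> card K = k \<and> lambda k n G \<le> sqrt (n / k) + 1 + (c + (real k)\<^sup>2) / sqrt n \<and>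
      (lambda k n G = lambda_max k n \<longrightarrow>
        (\<forall>v \<in> K. \<bar>card (parcs G `` {v}) - n / k\<bar> \<le> C) \<and>
        (\<forall>v \<in> {..<n} - K. \<bar>card (parcs G `` {v}) - n / k\<bar> > C))"
    if n: "n0 \<le> n" "9 * k \<le> n" "s0 < sqrt n" and G: "graph_on n G" and op: "outerplanar G" for n G
  proof -
    obtain F where thin: "thin_graph n (parcs G) F" by (rule outerplanar_thin_graph[OF G op])
    interpret thin_graph n "parcs G" F by (rule thin)
    define s where "s = sqrt n"
    define N where "N = real n / k"
    have "s > s0" "s * s = n" using n(3) by (auto simp: s_def)
    then have s: "s > s0" "s > 1" "s * s = n" using s0(4) by linarith+
    have npos: "n > 0" using n(2) k by simp
    have N: "N > 0" "k * N = n" using npos k by (auto simp: N_def)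
    have sN: "s / k \<le> sqrt N" "sqrt N \<le> s" "1 / sqrt N \<le> k / s"
    proof -
      have "sqrt N * sqrt k = s" using k by (simp add: N_def s_def real_sqrt_mult[symmetric])
      moreover have "1 \<le> sqrt k" "sqrt k \<le> k"
        using k by (auto intro!: real_le_lsqrt simp: power2_eq_square)
      moreover have "sqrt N > 0" using N by simp
      ultimately have "sqrt N * 1 \<le> s" "s \<le> sqrt N * k" by (metis mult_left_mono less_imp_le)+
      then show "s / k \<le> sqrt N" "sqrt N \<le> s" "1 / sqrt N \<le> k / s"
        using k s N by (auto simp: field_simps)
    qed
    obtain K h where K: "K \<subseteq> {..<n}" "card K = k" "h \<in> K" "\<forall>u \<in> K. deg h \<le> deg u"
      and alt: "lambda k n G \<le> sqrt N \<or> lambda k n G \<le> sqrt (deg h) + 1 + c / s \<and> (\<forall>v \<in> {..<n} - K. deg v \<le> B * s)"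
      using dich[OF n(1) G thin] unfolding deg_def N_def s_def by blast
    have finK: "finite K" using K(1) by (rule finite_subset) simp
    have total: "real (\<Sum>u \<in> K. deg u) \<le> n + real (k * (k - 1))"
      using of_nat_mono[OF sum_deg_le[OF finK], where 'a = real] K(2) by simp
    have kk: "real (k * (k - 1)) \<le> k * k" by (simp add: mult_le_mono2 of_nat_mono del: of_nat_mult flip: of_nat_mult)
    have "k * deg h \<le> (\<Sum>u \<in> K. deg u)" using sum_bounded_below[of K "deg h" deg] K by simp
    then have "real (k * deg h) \<le> real (\<Sum>u \<in> K. deg u)" by (rule of_nat_mono)
    then have "k * real (deg h) \<le> k * (N + k)" using total kk N by (simp add: distrib_left)
    then have "real (deg h) \<le> N + k" using k by simp
    then have "sqrt (deg h) \<le> sqrt (N + k)" by simp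
    also have "\<dots> \<le> sqrt N + k / (2 * sqrt N)" using N by (intro sqrt_add_le) auto
    also have "k / (2 * sqrt N) = k / 2 * (1 / sqrt N)" by simp
    also have "\<dots> \<le> k / 2 * (k / s)" using sN by (intro mult_left_mono) auto
    also have "\<dots> \<le> (real k)\<^sup>2 / s" using s by (simp add: power2_eq_square field_simps)
    finally have dh: "sqrt (deg h) \<le> sqrt N + (real k)\<^sup>2 / s" by simp
    have up: "lambda k n G \<le> sqrt N + 1 + (c + (real k)\<^sup>2) / s"
      using alt
    proof
      assume "lambda k n G \<le> sqrt N"
      moreover have "(c + (real k)\<^sup>2) / s \<ge> 0" using c s by (intro divide_nonneg_nonneg) auto
      ultimately show ?thesis by simp
    next
      assume "lambda k n G \<le> sqrt (deg h) + 1 + c / s \<and> (\<forall>v \<in> {..<n} - K. deg v \<le> B * s)"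
      then show ?thesis using dh by (simp add: add_divide_distrib)
    qed
    have "(\<forall>v \<in> K. \<bar>deg v - N\<bar> \<le> C) \<and> (\<forall>v \<in> {..<n} - K. \<bar>deg v - N\<bar> > C)"
      if max: "lambda k n G = lambda_max k n"
    proof -
      have low: "sqrt N + 1 - 3 * real k / s \<le> lambda k n G"
        using lambda_max_ge(1)[OF k n(2)] max by (simp add: N_def s_def)
      have "3 * real k / s < 1" using s s0 by simp
      then have big: "lambda k n G \<le> sqrt (deg h) + 1 + c / s" and small: "\<forall>v \<in> {..<n} - K. deg v \<le> B * s"
        using alt low by linarith+
      have "sqrt N - e / s \<le> sqrt (deg h)" using low big by (simp add: e_def add_divide_distrib)
      moreover have "0 \<le> sqrt N - e / s"
      proof -
        have "k * e \<le> s * s" using s s0 mult_mono[of "k * e" s 1 s] epos by simp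
        then have "e / s \<le> s / k" using k s by (simp add: field_simps)
        then show ?thesis using sN by simp
      qed
      ultimately have "(sqrt N - e / s)\<^sup>2 \<le> (sqrt (deg h))\<^sup>2" by (rule power_mono)
      then have "N - 2 * sqrt N * (e / s) + (e / s)\<^sup>2 \<le> deg h" using N by (simp add: power2_diff)
      moreover have "sqrt N * (e / s) \<le> s * (e / s)" using sN s epos by (intro mult_right_mono) auto
      moreover have "s * (e / s) = e" using s by simp
      moreover have "0 \<le> (e / s)\<^sup>2" by simp
      ultimately have hlow: "N - 2 * e \<le> deg h" by linarith
      \<comment> \<open>From above by the sum of all degrees in \<open>K\<close>, since the other ones are at least \<open>N - 2 e\<close>.\<close>
      have "\<bar>deg v - N\<bar> \<le> C" if v: "v \<in> K" for v
      proof -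
        have "deg h \<le> deg v" using K(4) v by blast
        then have "N - 2 * e \<le> deg v" using hlow by linarith
        moreover have "2 * e \<le> C"
        proof -
          have "2 * e * 1 \<le> 2 * e * k" using epos k by (intro mult_left_mono) auto
          then show ?thesis by (simp add: C_def add_increasing)
        qed
        moreover have "deg v \<le> N + C"
        proof -
          have "real (card (K - {v})) * (N - 2 * e) \<le> (\<Sum>u \<in> K - {v}. real (deg u))"
          proof (rule sum_bounded_below)
            fix u assume "u \<in> K - {v}"
            then have "deg h \<le> deg u" using K(4) by blast
            then show "N - 2 * e \<le> deg u" using hlow by linarith
          qed
          moreover have "real (card (K - {v})) = k - 1" using v finK K(2) k by (simp add: of_nat_diff)
          moreover have "(\<Sum>u \<in> K. real (deg u)) = deg v + (\<Sum>u \<in> K - {v}. real (deg u))"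
            using v finK by (simp add: sum.remove)
          moreover have "(\<Sum>u \<in> K. real (deg u)) \<le> k * N + k * k"
            using total kk N(2) by simp
          ultimately have "deg v + real (k - 1) * (N - 2 * e) \<le> k * N + k * k" by simp
          then have "deg v + (real k - 1) * (N - 2 * e) \<le> k * N + k * k"
            using k by (simp add: of_nat_diff)
          then have "deg v \<le> N + k * k + 2 * e * (real k - 1)" by (simp add: algebra_simps)
          moreover have "2 * e * (real k - 1) \<le> 2 * e * k" using epos by (intro mult_left_mono) auto
          ultimately show ?thesis by (simp add: C_def power2_eq_square)
        qed
        ultimately show ?thesis by linarith
      qed
      moreover have "\<bar>deg v - N\<bar> > C" if v: "v \<in> {..<n} - K" for v
      proof -
        have "k * (B + C) * s < s * s" using s s0 by (intro mult_strict_right_mono) auto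
        then have "k * ((B + C) * s) < k * N" using s(3) N(2) by (simp add: mult.assoc)
        then have "(B + C) * s < N" using k by simp
        moreover have "C * 1 \<le> C * s" using epos s by (intro mult_left_mono) auto
        moreover have "deg v \<le> B * s" using small v by blast
        ultimately show ?thesis by (simp add: distrib_right)
      qed
      ultimately show ?thesis by blast
    qed
    then show ?thesis
      using K(1,2) up unfolding deg_def N_def s_def by (intro exI[of _ K] conjI impI) simp_all
  qed
  have ev: "\<forall>\<^sub>F n in sequentially. n0 \<le> n \<and> 9 * k \<le> n \<and> s0 < sqrt (real n)"
    using eventually_ge_at_top[of n0] eventually_ge_at_top[of "9 * k"] eventually_sqrt_ge[of "s0 + 1"]
    by eventually_elim auto
  have "(\<lambda>n. lambda_max k n - (sqrt (real n / real k) + 1)) \<in> O(\<lambda>n. 1 / sqrt (real n))"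
  proof (rule bigoI)
    show "\<forall>\<^sub>F n in sequentially. norm (lambda_max k n - (sqrt (real n / real k) + 1)) \<le>
        (c + (real k)\<^sup>2 + 3 * real k) * norm (1 / sqrt (real n))"
      using ev
    proof eventually_elim
      case (elim n)
      obtain G where G: "graph_on n G" "outerplanar G" "lambda k n G = lambda_max k n"
        using lambda_max_ge(2)[OF k, of n] elim by blast
      have "lambda_max k n \<le> sqrt (n / k) + 1 + (c + (real k)\<^sup>2) / sqrt n"
        using core[OF _ _ _ G(1,2)] elim G(3) by auto
      moreover have "sqrt (n / k) + 1 - 3 * real k / sqrt n \<le> lambda_max k n"
        using lambda_max_ge(1)[OF k] elim by blast
      moreover have "(c + (real k)\<^sup>2) / sqrt n \<ge> 0" "3 * real k / sqrt n \<ge> 0"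
        using c by (auto intro!: divide_nonneg_nonneg)
      moreover have "(c + (real k)\<^sup>2 + 3 * real k) * norm (1 / sqrt (real n)) =
          (c + (real k)\<^sup>2) / sqrt n + 3 * real k / sqrt n"
        by (simp add: add_divide_distrib)
      ultimately show ?case unfolding real_norm_def abs_le_iff by linarith
    qed
  qed
  moreover have "\<forall>\<^sub>F n in sequentially. \<forall>G.
       graph_on n G \<and> outerplanar G \<and> lambda k n G = lambda_max k n \<longrightarrow>
       card {v \<in> pverts G. \<bar>real (out_degree (with_proj G) v) - real n / real k\<bar> \<le> C} = k"
    using ev
  proof eventually_elim
    case (elim n)
    show ?case
    proof (intro allI impI)
      fix G assume G: "graph_on n G \<and> outerplanar G \<and> lambda k n G = lambda_max k n"
      have "\<exists>K. K \<subseteq> {..<n} \<and> card K = k \<and> lambda k n G \<le> sqrt (n / k) + 1 + (c + (real k)\<^sup>2) / sqrt n \<and>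
          (lambda k n G = lambda_max k n \<longrightarrow>
            (\<forall>v \<in> K. \<bar>card (parcs G `` {v}) - n / k\<bar> \<le> C) \<and>
            (\<forall>v \<in> {..<n} - K. \<bar>card (parcs G `` {v}) - n / k\<bar> > C))"
        by (rule core) (use elim G in auto)
      then obtain K where K: "K \<subseteq> {..<n}" "card K = k"
        "\<forall>v \<in> K. \<bar>card (parcs G `` {v}) - n / k\<bar> \<le> C"
        "\<forall>v \<in> {..<n} - K. \<bar>card (parcs G `` {v}) - n / k\<bar> > C"
        using G by (elim exE conjE) (simp only: simp_thms, elim conjE, rule that)
      have "{v \<in> pverts G. \<bar>real (out_degree (with_proj G) v) - real n / real k\<bar> \<le> C} = K"
      proof -
        have V: "pverts G = {..<n}" 
          using conjunct1[OF G] unfolding graph_on_def lessThan_atLeast0 by (rule conjunct2)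
        have "\<bar>real (card (parcs G `` {v})) - real n / real k\<bar> \<le> C \<longleftrightarrow> v \<in> K" if "v < n" for v
        proof (cases "v \<in> K")
          case True
          then show ?thesis using bspec[OF K(3), of v] by simp
        next
          case False
          then show ?thesis using bspec[OF K(4), of v] that by simp
        qed
        then have "{v. v < n \<and> \<bar>real (card (parcs G `` {v})) - real n / real k\<bar> \<le> C} = {v. v < n \<and> v \<in> K}"
          by (intro Collect_cong conj_cong refl)
        then show ?thesis unfolding out_degree_eq V lessThan_iff using K(1) by (simp only:) blast
      qed
      then show "card {v \<in> pverts G. \<bar>real (out_degree (with_proj G) v) - real n / real k\<bar> \<le> C} = k"
        unfolding K(2)[symmetric] by (rule arg_cong)
    qed
  qed
  ultimately show ?thesis by (intro conjI exI[of _ C])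
qed

end
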